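(* For every model of set theory $M\models\mathrm{ZFC}$, there is a $\Sigma_2$ assertion $\sigma(n)$ with some natural-number parameter $n\in\omega^M$, which is not true in $M$ but is consistent with the $\Sigma_2$ diagram of $M$.
   Context: Models of set theory are arbitrary first-order models, not necessarily countable, well-founded or $\omega$-standard; so $n\in\omega^M$ may be nonstandard. $\Sigma_2$ refers to the Lévy hierarchy. The $\Sigma_2$ diagram of $M$ is the set of all $\Sigma_2$ assertions with parameters from $M$ (in the language of set theory expanded by a constant for each element of $M$) that are true in $M$. Consistency of $\sigma(n)$ with the $\Sigma_2$ diagram of $M$ means that $\mathrm{ZFC}$ together with the $\Sigma_2$ diagram of $M$ and $\sigma(n)$ is a consistent theory. *)

theory Defs
  imports Main
begin

text \<open>
  First-order language of set theory with equality, expanded by a constant for each element of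
  the type \<open>'a\<close>. Variables are de Bruijn indices.
\<close>

datatype 'a tm = Var nat | Cst 'a

datatype 'a fm =
    Bot
  | Mem "'a tm" "'a tm"  (infix "\<^bold>\<in>" 60)
  | Eq "'a tm" "'a tm"  (infix "\<^bold>=" 60)
  | Imp "'a fm" "'a fm"  (infixr "\<^bold>\<longrightarrow>" 50)
  | Forall "'a fm"

abbreviation Neg :: "'a fm \<Rightarrow> 'a fm" where
  "Neg \<phi> \<equiv> \<phi> \<^bold>\<longrightarrow> Bot"

abbreviation Con :: "'a fm \<Rightarrow> 'a fm \<Rightarrow> 'a fm" (infixr "\<^bold>\<and>" 55) where
  "\<phi> \<^bold>\<and> \<psi> \<equiv> Neg (\<phi> \<^bold>\<longrightarrow> Neg \<psi>)"

abbreviation Dis :: "'a fm \<Rightarrow> 'a fm \<Rightarrow> 'a fm" (infixr "\<^bold>\<or>" 53) where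
  "\<phi> \<^bold>\<or> \<psi> \<equiv> Neg \<phi> \<^bold>\<longrightarrow> \<psi>"

abbreviation Iff :: "'a fm \<Rightarrow> 'a fm \<Rightarrow> 'a fm" (infix "\<^bold>\<longleftrightarrow>" 48) where
  "\<phi> \<^bold>\<longleftrightarrow> \<psi> \<equiv> (\<phi> \<^bold>\<longrightarrow> \<psi>) \<^bold>\<and> (\<psi> \<^bold>\<longrightarrow> \<phi>)"

abbreviation Exists :: "'a fm \<Rightarrow> 'a fm" where
  "Exists \<phi> \<equiv> Neg (Forall (Neg \<phi>))"

fun fv_tm :: "'a tm \<Rightarrow> nat set" where
  "fv_tm (Var i) = {i}"
| "fv_tm (Cst a) = {}"

primrec fv :: "'a fm \<Rightarrow> nat set" where
  "fv Bot = {}"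
| "fv (s \<^bold>\<in> t) = fv_tm s \<union> fv_tm t"
| "fv (s \<^bold>= t) = fv_tm s \<union> fv_tm t"
| "fv (\<phi> \<^bold>\<longrightarrow> \<psi>) = fv \<phi> \<union> fv \<psi>"
| "fv (Forall \<phi>) = {i. Suc i \<in> fv \<phi>}"

abbreviation params :: "'a fm \<Rightarrow> 'a set" where
  "params \<phi> \<equiv> set_fm \<phi>"

abbreviation sentence :: "'a fm \<Rightarrow> bool" where
  "sentence \<phi> \<equiv> fv \<phi> = {}"

text \<open>Simultaneous substitution of terms for the free variables.\<close>

fun subst_tm :: "(nat \<Rightarrow> 'a tm) \<Rightarrow> 'a tm \<Rightarrow> 'a tm" where
  "subst_tm s (Var i) = s i"
| "subst_tm s (Cst a) = Cst a"

abbreviation lift_tm :: "'a tm \<Rightarrow> 'a tm" where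
  "lift_tm \<equiv> subst_tm (\<lambda>i. Var (Suc i))"

primrec subst :: "(nat \<Rightarrow> 'a tm) \<Rightarrow> 'a fm \<Rightarrow> 'a fm" where
  "subst s Bot = Bot"
| "subst s (t \<^bold>\<in> u) = (subst_tm s t \<^bold>\<in> subst_tm s u)"
| "subst s (t \<^bold>= u) = (subst_tm s t \<^bold>= subst_tm s u)"
| "subst s (\<phi> \<^bold>\<longrightarrow> \<psi>) = (subst s \<phi> \<^bold>\<longrightarrow> subst s \<psi>)"
| "subst s (Forall \<phi>) = Forall (subst (case_nat (Var 0) (\<lambda>i. lift_tm (s i))) \<phi>)"

text \<open>
  \<open>lift_at k \<phi>\<close> makes room for a variable with index \<open>k\<close> that does not occur free in \<open>\<phi>\<close>.
  \<open>inst \<phi> t\<close> puts \<open>t\<close> for the variable with index \<open>0\<close> and lowers the other indices.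
\<close>

definition lift_at :: "nat \<Rightarrow> 'a fm \<Rightarrow> 'a fm" where
  "lift_at k = subst (\<lambda>i. Var (if i < k then i else Suc i))"

definition inst :: "'a fm \<Rightarrow> 'a tm \<Rightarrow> 'a fm" where
  "inst \<phi> t = subst (case_nat t Var) \<phi>"

definition universal_closure :: "'a fm \<Rightarrow> 'a fm" where
  "universal_closure \<phi> = (Forall ^^ (LEAST n. fv \<phi> \<subseteq> {..<n})) \<phi>"


text \<open>
  Structures have the whole type \<open>'a\<close> as domain and \<open>E\<close> as the membership relation; each
  constant \<open>Cst a\<close> denotes \<open>a\<close>.
\<close>

fun val :: "(nat \<Rightarrow> 'a) \<Rightarrow> 'a tm \<Rightarrow> 'a" where
  "val e (Var i) = e i"
| "val e (Cst a) = a"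

primrec sat :: "('a \<Rightarrow> 'a \<Rightarrow> bool) \<Rightarrow> (nat \<Rightarrow> 'a) \<Rightarrow> 'a fm \<Rightarrow> bool" where
  "sat E e Bot \<longleftrightarrow> False"
| "sat E e (s \<^bold>\<in> t) \<longleftrightarrow> E (val e s) (val e t)"
| "sat E e (s \<^bold>= t) \<longleftrightarrow> val e s = val e t"
| "sat E e (\<phi> \<^bold>\<longrightarrow> \<psi>) \<longleftrightarrow> (sat E e \<phi> \<longrightarrow> sat E e \<psi>)"
| "sat E e (Forall \<phi>) \<longleftrightarrow> (\<forall>a. sat E (case_nat a e) \<phi>)"

definition true_in :: "('a \<Rightarrow> 'a \<Rightarrow> bool) \<Rightarrow> 'a fm \<Rightarrow> bool" where
  "true_in E \<phi> \<longleftrightarrow> (\<forall>e. sat E e \<phi>)"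

definition models :: "('a \<Rightarrow> 'a \<Rightarrow> bool) \<Rightarrow> 'a fm set \<Rightarrow> bool" where
  "models E T \<longleftrightarrow> (\<forall>\<phi>\<in>T. true_in E \<phi>)"


text \<open>Classical natural deduction with equality.\<close>

inductive derives :: "'a fm set \<Rightarrow> 'a fm \<Rightarrow> bool" (infix "\<turnstile>" 40) where
  Assm: "\<phi> \<in> T \<Longrightarrow> T \<turnstile> \<phi>"
| ImpI: "insert \<phi> T \<turnstile> \<psi> \<Longrightarrow> T \<turnstile> (\<phi> \<^bold>\<longrightarrow> \<psi>)"
| ImpE: "T \<turnstile> (\<phi> \<^bold>\<longrightarrow> \<psi>) \<Longrightarrow> T \<turnstile> \<phi> \<Longrightarrow> T \<turnstile> \<psi>"
| Contr: "insert (Neg \<phi>) T \<turnstile> Bot \<Longrightarrow> T \<turnstile> \<phi>"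
| AllI: "lift_at 0 ` T \<turnstile> \<phi> \<Longrightarrow> T \<turnstile> Forall \<phi>"
| AllE: "T \<turnstile> Forall \<phi> \<Longrightarrow> T \<turnstile> inst \<phi> t"
| EqI: "T \<turnstile> (t \<^bold>= t)"
| EqE: "T \<turnstile> (s \<^bold>= t) \<Longrightarrow> T \<turnstile> inst \<phi> s \<Longrightarrow> T \<turnstile> inst \<phi> t"

definition consistent :: "'a fm set \<Rightarrow> bool" where
  "consistent T \<longleftrightarrow> \<not> T \<turnstile> Bot"


text \<open>
  The Levy hierarchy. Lifting the bounding term ensures that the bound variable does not occur
  in it. Blocks of like quantifiers of any finite length, also empty, are allowed.
\<close>

inductive delta0 :: "'a fm \<Rightarrow> bool" where
  "delta0 Bot"
| "delta0 (s \<^bold>\<in> t)"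
| "delta0 (s \<^bold>= t)"
| "delta0 \<phi> \<Longrightarrow> delta0 \<psi> \<Longrightarrow> delta0 (\<phi> \<^bold>\<longrightarrow> \<psi>)"
| "delta0 \<phi> \<Longrightarrow> delta0 (Forall (Var 0 \<^bold>\<in> lift_tm t \<^bold>\<longrightarrow> \<phi>))"
| "delta0 \<phi> \<Longrightarrow> delta0 (Exists (Var 0 \<^bold>\<in> lift_tm t \<^bold>\<and> \<phi>))"

inductive levy_sigma :: "nat \<Rightarrow> 'a fm \<Rightarrow> bool" and levy_pi :: "nat \<Rightarrow> 'a fm \<Rightarrow> bool" where
  "delta0 \<phi> \<Longrightarrow> levy_sigma 0 \<phi>"
| "delta0 \<phi> \<Longrightarrow> levy_pi 0 \<phi>"
| "levy_pi n \<phi> \<Longrightarrow> levy_sigma (Suc n) \<phi>"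
| "levy_sigma (Suc n) \<phi> \<Longrightarrow> levy_sigma (Suc n) (Exists \<phi>)"
| "levy_sigma n \<phi> \<Longrightarrow> levy_pi (Suc n) \<phi>"
| "levy_pi (Suc n) \<phi> \<Longrightarrow> levy_pi (Suc n) (Forall \<phi>)"

definition sigma_diagram :: "nat \<Rightarrow> ('a \<Rightarrow> 'a \<Rightarrow> bool) \<Rightarrow> 'a fm set" where
  "sigma_diagram k E = {\<phi>. sentence \<phi> \<and> levy_sigma k \<phi> \<and> true_in E \<phi>}"


text \<open>In the following formulas, \<open>i\<close> and \<open>j\<close> are indices of free variables.\<close>

definition empty_fm :: "nat \<Rightarrow> 'a fm" where
  "empty_fm i = Forall (Neg (Var 0 \<^bold>\<in> Var (Suc i)))"

definition subset_fm :: "nat \<Rightarrow> nat \<Rightarrow> 'a fm" where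
  "subset_fm i j = Forall (Var 0 \<^bold>\<in> Var (Suc i) \<^bold>\<longrightarrow> Var 0 \<^bold>\<in> Var (Suc j))"

text \<open>\<open>x\<^sub>j = x\<^sub>i \<union> {x\<^sub>i}\<close>\<close>

definition succ_fm :: "nat \<Rightarrow> nat \<Rightarrow> 'a fm" where
  "succ_fm i j =
    Forall (Var 0 \<^bold>\<in> Var (Suc j) \<^bold>\<longleftrightarrow> Var 0 \<^bold>\<in> Var (Suc i) \<^bold>\<or> Var 0 \<^bold>= Var (Suc i))"

definition inductive_fm :: "nat \<Rightarrow> 'a fm" where
  "inductive_fm i =
    Exists (Var 0 \<^bold>\<in> Var (Suc i) \<^bold>\<and> empty_fm 0) \<^bold>\<and>
    Forall (Var 0 \<^bold>\<in> Var (Suc i) \<^bold>\<longrightarrow> Exists (Var 0 \<^bold>\<in> Var (Suc (Suc i)) \<^bold>\<and> succ_fm 1 0))"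

text \<open>\<open>x\<^sub>i\<close> is the least inductive set.\<close>

definition omega_fm :: "nat \<Rightarrow> 'a fm" where
  "omega_fm i = inductive_fm i \<^bold>\<and> Forall (inductive_fm 0 \<^bold>\<longrightarrow> subset_fm (Suc i) 0)"

definition natural_in :: "('a \<Rightarrow> 'a \<Rightarrow> bool) \<Rightarrow> 'a \<Rightarrow> bool" where
  "natural_in E n \<longleftrightarrow> (\<exists>w. true_in E (inst (omega_fm 0) (Cst w)) \<and> E n w)"


definition extensionality :: "'a fm" where
  "extensionality =
    Forall (Forall (Forall (Var 0 \<^bold>\<in> Var 2 \<^bold>\<longleftrightarrow> Var 0 \<^bold>\<in> Var 1) \<^bold>\<longrightarrow> Var 1 \<^bold>= Var 0))"

definition foundation :: "'a fm" where
  "foundation =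
    Forall (Exists (Var 0 \<^bold>\<in> Var 1) \<^bold>\<longrightarrow>
      Exists (Var 0 \<^bold>\<in> Var 1 \<^bold>\<and> Neg (Exists (Var 0 \<^bold>\<in> Var 2 \<^bold>\<and> Var 0 \<^bold>\<in> Var 1))))"

definition pairing :: "'a fm" where
  "pairing = Forall (Forall (Exists (Forall (Var 0 \<^bold>\<in> Var 1 \<^bold>\<longleftrightarrow> Var 0 \<^bold>= Var 3 \<^bold>\<or> Var 0 \<^bold>= Var 2))))"

definition union_set :: "'a fm" where
  "union_set = Forall (Exists (Forall (Var 0 \<^bold>\<in> Var 1 \<^bold>\<longleftrightarrow> Exists (Var 1 \<^bold>\<in> Var 0 \<^bold>\<and> Var 0 \<^bold>\<in> Var 3))))"

definition power_set :: "'a fm" where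
  "power_set = Forall (Exists (Forall (Var 0 \<^bold>\<in> Var 1 \<^bold>\<longleftrightarrow> subset_fm 0 2)))"

definition infinity :: "'a fm" where
  "infinity = Exists (inductive_fm 0)"

text \<open>Every family of nonempty pairwise disjoint sets has a transversal.\<close>

definition choice :: "'a fm" where
  "choice =
    Forall (Forall (Var 0 \<^bold>\<in> Var 1 \<^bold>\<longrightarrow> Exists (Var 0 \<^bold>\<in> Var 1)) \<^bold>\<and>
         Forall (Var 0 \<^bold>\<in> Var 1 \<^bold>\<longrightarrow> Forall (Var 0 \<^bold>\<in> Var 2 \<^bold>\<longrightarrow>
           Exists (Var 0 \<^bold>\<in> Var 2 \<^bold>\<and> Var 0 \<^bold>\<in> Var 1) \<^bold>\<longrightarrow> Var 1 \<^bold>= Var 0))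
         \<^bold>\<longrightarrow>
         Exists (Forall (Var 0 \<^bold>\<in> Var 2 \<^bold>\<longrightarrow>
           Exists (Forall (Var 0 \<^bold>\<in> Var 2 \<^bold>\<and> Var 0 \<^bold>\<in> Var 3 \<^bold>\<longleftrightarrow> Var 0 \<^bold>= Var 1)))))"

text \<open>
  \<open>\<forall>x \<exists>y \<forall>z (z \<in> y \<longleftrightarrow> z \<in> x \<and> \<phi>)\<close>. In \<open>\<phi>\<close>, index \<open>0\<close> is \<open>z\<close>, index \<open>1\<close> is \<open>x\<close>, and the higher
  indices are parameters; lifting keeps \<open>y\<close> out of \<open>\<phi>\<close>.
\<close>

definition separation :: "'a fm \<Rightarrow> 'a fm" where
  "separation \<phi> = universal_closure
    (Forall (Exists (Forall (Var 0 \<^bold>\<in> Var 1 \<^bold>\<longleftrightarrow> Var 0 \<^bold>\<in> Var 2 \<^bold>\<and> lift_at 1 \<phi>))))"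

text \<open>
  \<open>\<forall>y z x (\<phi>(x,y) \<and> \<phi>(x,z) \<longrightarrow> y = z) \<longrightarrow> \<forall>a \<exists>b \<forall>y (y \<in> b \<longleftrightarrow> \<exists>x (x \<in> a \<and> \<phi>(x,y)))\<close>. In \<open>\<phi>\<close>, index \<open>0\<close>
  is the argument, index \<open>1\<close> is the value, and the higher indices are parameters.
\<close>

definition replacement :: "'a fm \<Rightarrow> 'a fm" where
  "replacement \<phi> = universal_closure
    (Forall (Forall (Forall (lift_at 1 \<phi> \<^bold>\<and> lift_at 2 \<phi> \<^bold>\<longrightarrow> Var 2 \<^bold>= Var 1))) \<^bold>\<longrightarrow>
     Forall (Exists (Forall (Var 0 \<^bold>\<in> Var 1 \<^bold>\<longleftrightarrow>
       Exists (Var 0 \<^bold>\<in> Var 3 \<^bold>\<and> lift_at 2 (lift_at 2 \<phi>))))))"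

text \<open>
  The schemes range over the formulas of the language of set theory proper, without constants.
\<close>

definition ZFC :: "'a fm set" where
  "ZFC =
    {extensionality, foundation, pairing, union_set, power_set, infinity, choice} \<union>
    {separation \<phi> | \<phi>. params \<phi> = {}} \<union>
    {replacement \<phi> | \<phi>. params \<phi> = {}}"

end

theory Submission
  imports Defs
begin

text \<open>
  Say that \<open>k\<close> is bounded if, for some \<open>p\<close>, no transitive set \<open>B\<close> containing \<open>p\<close> satisfies the
  fragment of ZFC of complexity \<open>k\<close>. This is a \<open>\<Sigma>\<^sub>2\<close> property of \<open>k\<close>, and by reflection it fails for
  standard \<open>k\<close>. If \<open>k\<close> is not bounded, then above any \<open>q\<close> there is an \<open>\<in>\<close>-minimal transitive \<open>B\<close>
  satisfying the fragment \<open>k\<close>, and this \<open>B\<close> believes that \<open>k\<close> is bounded, with witness \<open>q\<close>. If \<open>k\<close> is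
  at least as large as every standard number, such \<open>B\<close> show that boundedness of \<open>k\<close> is consistent with
  ZFC and the \<open>\<Sigma>\<^sub>2\<close> diagram, since \<open>q\<close> can hold the witnesses of any finite part of the diagram.

  If some natural number of the model is bounded, the least one is a nonstandard successor \<open>m + 1\<close>, and
  \<open>\<sigma>(n)\<close> says that \<open>n\<close> is bounded, with \<open>n = m\<close>. Otherwise \<open>\<sigma>\<close> says that some natural number is
  bounded, and for each finite part of ZFC a large standard \<open>k\<close> is used. No self-reference is needed.
\<close>

section \<open>Satisfaction relative to a domain\<close>

text \<open>The number \<open>k\<close> may be nonstandard, so the fragment \<open>k\<close> cannot
  be given by formulas of the metatheory. Instead, \<open>C\<close> speaks of a list of relations on
  \<open>B\<close>, built up rank by rank by operations that mimic the formation of formulas. All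
  quantifiers in \<open>C\<close> are bounded, so it means the same in the model and in every
  transitive set. Minimality of \<open>B\<close> takes the place of a fixed point: if
  \<open>B\<close> were wrong about itself, it would contain a smaller set of the same kind. Two
  demands on the number pull against each other. It must exceed all standard numbers, so that
  \<open>B\<close> satisfies every axiom that a derivation can use; and it must be unbounded in the
  model, so that such \<open>B\<close> exist and the assertion is false. The predecessor of the
  least bounded number meets both. If no natural number is bounded, the model may be omega-standard
  and have no number above the standard ones; the number is then quantified inside the assertion and
  may vary with the finite set of axioms.\<close>

primrec valI :: "('a \<Rightarrow> 'b) \<Rightarrow> (nat \<Rightarrow> 'b) \<Rightarrow> 'a tm \<Rightarrow> 'b" where
  "valI I e (Var i) = e i"
| "valI I e (Cst c) = I c"

text \<open>The language has a constant for each element of the model, but a set \<open>B\<close>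
  contains only some of these elements. The interpretation \<open>I\<close> of the constants is
  therefore an argument, to be redirected into the domain \<open>D\<close> when necessary.\<close>

primrec satI :: "('b \<Rightarrow> 'b \<Rightarrow> bool) \<Rightarrow> 'b set \<Rightarrow> ('a \<Rightarrow> 'b) \<Rightarrow> (nat \<Rightarrow> 'b) \<Rightarrow> 'a fm \<Rightarrow> bool" where
  "satI E D I e Bot \<longleftrightarrow> False"
| "satI E D I e (s \<^bold>\<in> t) \<longleftrightarrow> E (valI I e s) (valI I e t)"
| "satI E D I e (s \<^bold>= t) \<longleftrightarrow> valI I e s = valI I e t"
| "satI E D I e (\<phi> \<^bold>\<longrightarrow> \<psi>) \<longleftrightarrow> (satI E D I e \<phi> \<longrightarrow> satI E D I e \<psi>)"
| "satI E D I e (Forall \<phi>) \<longleftrightarrow> (\<forall>a\<in>D. satI E D I (case_nat a e) \<phi>)"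

lemma val_eq_valI: "val e t = valI (\<lambda>c. c) e t"
  by (cases t) auto

lemma sat_eq_satI: "sat E e \<phi> \<longleftrightarrow> satI E UNIV (\<lambda>c. c) e \<phi>"
  by (induction \<phi> arbitrary: e) (auto simp: val_eq_valI)

lemma valI_subst_tm: "valI I e (subst_tm s t) = valI I (\<lambda>i. valI I e (s i)) t"
  by (cases t) auto

lemma satI_subst: "satI E D I e (subst s \<phi>) \<longleftrightarrow> satI E D I (\<lambda>i. valI I e (s i)) \<phi>"
proof (induction \<phi> arbitrary: s e)
  case (Forall \<phi>)
  have "(\<lambda>i. valI I (case_nat a e) (case_nat (Var 0) (\<lambda>i. lift_tm (s i)) i))
      = case_nat a (\<lambda>i. valI I e (s i))" for a
    by (rule ext) (auto simp: valI_subst_tm split: nat.split)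
  then show ?case using Forall by simp
qed (auto simp: valI_subst_tm)

lemma satI_inst: "satI E D I e (inst \<phi> t) \<longleftrightarrow> satI E D I (case_nat (valI I e t) e) \<phi>"
proof -
  have "(\<lambda>i. valI I e (case_nat t Var i)) = case_nat (valI I e t) e"
    by (rule ext) (auto split: nat.split)
  then show ?thesis by (simp add: inst_def satI_subst)
qed

lemma satI_lift_at:
  "satI E D I e (lift_at k \<phi>) \<longleftrightarrow> satI E D I (\<lambda>i. e (if i < k then i else Suc i)) \<phi>"
  by (simp add: lift_at_def satI_subst if_distrib cong: if_cong)

lemma satI_lift_at_0: "satI E D I (case_nat a e) (lift_at 0 \<phi>) \<longleftrightarrow> satI E D I e \<phi>"
  by (simp add: satI_lift_at)

lemma satI_cong:
  assumes "\<And>c. c \<in> params \<phi> \<Longrightarrow> I c = J c" "\<And>i. i \<in> fv \<phi> \<Longrightarrow> e i = e' i"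
  shows "satI E D I e \<phi> \<longleftrightarrow> satI E D J e' \<phi>"
  using assms
proof (induction \<phi> arbitrary: e e')
  case (Mem s t)
  then show ?case by (cases s; cases t) auto
next
  case (Eq s t)
  then show ?case by (cases s; cases t) auto
next
  case (Imp \<phi> \<psi>)
  have "satI E D I e \<phi> \<longleftrightarrow> satI E D J e' \<phi>" "satI E D I e \<psi> \<longleftrightarrow> satI E D J e' \<psi>"
    using Imp.prems by (auto intro!: Imp.IH)
  then show ?case by simp
next
  case (Forall \<phi>)
  have "satI E D I (case_nat a e) \<phi> \<longleftrightarrow> satI E D J (case_nat a e') \<phi>" for a
    by (rule Forall.IH) (use Forall.prems in \<open>auto split: nat.split\<close>)
  then show ?case by simp
qed auto

lemma range_case_nat: "range (case_nat a e) = insert a (range e)"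
proof
  show "insert a (range e) \<subseteq> range (case_nat a e)"
    by (auto intro: range_eqI[where x = 0] range_eqI[where x = "Suc _"])
qed (auto split: nat.splits)

text \<open>An assignment is a value at \<open>0\<close> followed by a tail, so one
  \<open>Forall\<close> is absorbed when all assignments into \<open>D\<close> are considered. The
  length of the quantifier prefix given by \<open>LEAST\<close> never has to be computed.\<close>

lemma satI_universal_closure:
  fixes E :: "'b \<Rightarrow> 'b \<Rightarrow> bool" and \<phi> :: "'a fm"
  shows "(\<forall>e. range e \<subseteq> D \<longrightarrow> satI E D I e (universal_closure \<phi>)) \<longleftrightarrow>
   (\<forall>e. range e \<subseteq> D \<longrightarrow> satI E D I e \<phi>)"
proof -
  have step: "(\<forall>e. range e \<subseteq> D \<longrightarrow> satI E D I e (Forall \<psi>)) \<longleftrightarrow>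
      (\<forall>e. range e \<subseteq> D \<longrightarrow> satI E D I e \<psi>)" for \<psi> :: "'a fm"
  proof (intro iffI allI impI)
    fix e :: "nat \<Rightarrow> 'b" assume *: "\<forall>e. range e \<subseteq> D \<longrightarrow> satI E D I e (Forall \<psi>)" and e: "range e \<subseteq> D"
    have "case_nat (e 0) (\<lambda>i. e (Suc i)) = e" by (rule ext) (auto split: nat.split)
    moreover have "satI E D I (\<lambda>i. e (Suc i)) (Forall \<psi>)"
      by (rule *[rule_format]) (use e in auto)
    moreover have "e 0 \<in> D" using e by auto
    ultimately show "satI E D I e \<psi>" unfolding satI.simps by metis
  next
    fix e :: "nat \<Rightarrow> 'b" assume *: "\<forall>e. range e \<subseteq> D \<longrightarrow> satI E D I e \<psi>" and e: "range e \<subseteq> D"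
    show "satI E D I e (Forall \<psi>)" using * e by (simp add: range_case_nat)
  qed
  have "(\<forall>e. range e \<subseteq> D \<longrightarrow> satI E D I e ((Forall ^^ n) \<phi>)) \<longleftrightarrow>
      (\<forall>e. range e \<subseteq> D \<longrightarrow> satI E D I e \<phi>)" for n
    by (induction n) (simp_all add: step del: satI.simps)
  then show ?thesis unfolding universal_closure_def .
qed

section \<open>Soundness and finiteness of derivations, for substructures of a fixed
  relation\<close>

definition entails :: "('b \<Rightarrow> 'b \<Rightarrow> bool) \<Rightarrow> 'a fm set \<Rightarrow> 'a fm \<Rightarrow> bool" where
  "entails E T \<phi> \<longleftrightarrow> (\<forall>D (I :: 'a \<Rightarrow> 'b) e. range I \<subseteq> D \<longrightarrow> range e \<subseteq> D \<longrightarrow>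
    (\<forall>\<psi>\<in>T. satI E D I e \<psi>) \<longrightarrow> satI E D I e \<phi>)"

lemma entailsD:
  "entails E T \<phi> \<Longrightarrow> range I \<subseteq> D \<Longrightarrow> range e \<subseteq> D \<Longrightarrow> (\<And>\<psi>. \<psi> \<in> T \<Longrightarrow> satI E D I e \<psi>) \<Longrightarrow>
   satI E D I e \<phi>"
  unfolding entails_def by blast

lemma entailsI:
  "(\<And>D I e. range I \<subseteq> D \<Longrightarrow> range e \<subseteq> D \<Longrightarrow> (\<And>\<psi>. \<psi> \<in> T \<Longrightarrow> satI E D I e \<psi>) \<Longrightarrow> satI E D I e \<phi>) \<Longrightarrow>
   entails E T \<phi>"
  unfolding entails_def by blast

text \<open>A finite set of hypotheses is carried through the induction, which gives soundness and
  the finite character of derivability together. Later each finite part of the theory gets its own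
  set \<open>B\<close>.\<close>

lemma derives_sound: "T \<turnstile> \<phi> \<Longrightarrow> \<exists>T0\<subseteq>T. finite T0 \<and> entails E T0 \<phi>"
proof (induction rule: derives.induct)
  case (Assm \<phi> T)
  then show ?case by (intro exI[of _ "{\<phi>}"]) (auto simp: entails_def)
next
  case (ImpI \<phi> T \<psi>)
  then obtain T0 where T0: "T0 \<subseteq> insert \<phi> T" "finite T0" and s: "entails E T0 \<psi>" by auto
  have "entails E (T0 - {\<phi>}) (\<phi> \<^bold>\<longrightarrow> \<psi>)"
  proof (rule entailsI)
    fix D I e assume *: "range I \<subseteq> D" "range e \<subseteq> D" "\<And>\<psi>. \<psi> \<in> T0 - {\<phi>} \<Longrightarrow> satI E D I e \<psi>"
    show "satI E D I e (\<phi> \<^bold>\<longrightarrow> \<psi>)" using entailsD[OF s *(1,2)] *(3) by auto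
  qed
  then show ?case using T0 by (intro exI[of _ "T0 - {\<phi>}"]) auto
next
  case (ImpE T \<phi> \<psi>)
  then obtain T0 T1 where T: "T0 \<subseteq> T" "finite T0" "T1 \<subseteq> T" "finite T1"
    and s: "entails E T0 (\<phi> \<^bold>\<longrightarrow> \<psi>)" "entails E T1 \<phi>" by auto
  have "entails E (T0 \<union> T1) \<psi>"
    by (rule entailsI) (use entailsD[OF s(1)] entailsD[OF s(2)] in simp)
  then show ?case using T by (intro exI[of _ "T0 \<union> T1"]) auto
next
  case (Contr \<phi> T)
  then obtain T0 where T0: "T0 \<subseteq> insert (Neg \<phi>) T" "finite T0" and s: "entails E T0 Bot" by auto
  have "entails E (T0 - {Neg \<phi>}) \<phi>"
  proof (rule entailsI)
    fix D I e assume *: "range I \<subseteq> D" "range e \<subseteq> D" "\<And>\<psi>. \<psi> \<in> T0 - {Neg \<phi>} \<Longrightarrow> satI E D I e \<psi>"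
    show "satI E D I e \<phi>"
      using entailsD[OF s *(1,2)] *(3) by (metis DiffI satI.simps(1,4) singletonD)
  qed
  moreover have "T0 - {Neg \<phi>} \<subseteq> T" using T0(1) by blast
  ultimately show ?case using T0(2) by (intro exI[of _ "T0 - {Neg \<phi>}"]) simp
next
  case (AllI T \<phi>)
  then obtain T0 where T0: "T0 \<subseteq> lift_at 0 ` T" "finite T0" and s: "entails E T0 \<phi>" by auto
  \<comment> \<open>A finite part of the lifted hypotheses is the lift of a finite part, and the
    value of the new variable does not affect lifted formulas.\<close>
  then obtain T1 where T1: "T1 \<subseteq> T" "finite T1" "T0 = lift_at 0 ` T1"
    by (meson finite_subset_image)
  have "entails E T1 (Forall \<phi>)"
  proof (rule entailsI)
    fix D I e assume *: "range I \<subseteq> D" "range e \<subseteq> D" "\<And>\<psi>. \<psi> \<in> T1 \<Longrightarrow> satI E D I e \<psi>"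
    have "satI E D I (case_nat a e) \<phi>" if "a \<in> D" for a
      by (rule entailsD[OF s]) (use * that T1(3) in \<open>auto simp: satI_lift_at_0 range_case_nat\<close>)
    then show "satI E D I e (Forall \<phi>)" by simp
  qed
  then show ?case using T1 by auto
next
  case (AllE T \<phi> t)
  then obtain T0 where T0: "T0 \<subseteq> T" "finite T0" and s: "entails E T0 (Forall \<phi>)" by auto
  have "entails E T0 (inst \<phi> t)"
  proof (rule entailsI)
    fix D I e assume *: "range I \<subseteq> D" "range e \<subseteq> D" "\<And>\<psi>. \<psi> \<in> T0 \<Longrightarrow> satI E D I e \<psi>"
    have "valI I e t \<in> D" using * by (cases t) auto
    then show "satI E D I e (inst \<phi> t)" using entailsD[OF s *] by (simp add: satI_inst)
  qed
  then show ?case using T0 by auto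
next
  case (EqI T t)
  show ?case by (intro exI[of _ "{}"]) (auto simp: entails_def)
next
  case (EqE T s t \<phi>)
  then obtain T0 T1 where T: "T0 \<subseteq> T" "finite T0" "T1 \<subseteq> T" "finite T1"
    and s: "entails E T0 (s \<^bold>= t)" "entails E T1 (inst \<phi> s)" by auto
  have "entails E (T0 \<union> T1) (inst \<phi> t)"
    by (rule entailsI) (use entailsD[OF s(1)] entailsD[OF s(2)] in \<open>simp add: satI_inst\<close>, metis)
  then show ?case using T by (intro exI[of _ "T0 \<union> T1"]) auto
qed

section \<open>Absoluteness\<close>

definition transitive_in :: "('a \<Rightarrow> 'a \<Rightarrow> bool) \<Rightarrow> 'a set \<Rightarrow> bool" where
  "transitive_in E D \<longleftrightarrow> (\<forall>x\<in>D. \<forall>y. E y x \<longrightarrow> y \<in> D)"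

lemma valI_lift_tm: "valI I (case_nat a e) (lift_tm t) = valI I e t"
  by (cases t) auto

lemma valI_in: "range e \<subseteq> D \<Longrightarrow> set_tm t \<subseteq> D \<Longrightarrow> valI (\<lambda>c. c) e t \<in> D"
  by (cases t) auto

lemma set_tm_lift_tm: "set_tm (lift_tm t) = set_tm t"
  by (cases t) auto

text \<open>The value of a bounding term lies in \<open>D\<close>, and transitivity puts all its
  elements into \<open>D\<close>, so a bounded quantifier ranges over the same objects in both
  structures.\<close>

lemma delta0_absolute:
  assumes "delta0 \<phi>" "transitive_in E D" "range e \<subseteq> D" "params \<phi> \<subseteq> D"
  shows "satI E D (\<lambda>c. c) e \<phi> \<longleftrightarrow> sat E e \<phi>"
  using assms
proof (induction arbitrary: e rule: delta0.induct)
  case (5 \<phi> t)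
  have t: "valI (\<lambda>c. c) e t \<in> D" using "5.prems" by (auto intro!: valI_in simp: set_tm_lift_tm)
  have "satI E D (\<lambda>c. c) (case_nat a e) \<phi> \<longleftrightarrow> sat E (case_nat a e) \<phi>" if "a \<in> D" for a
    by (rule "5.IH") (use "5.prems" that in \<open>simp_all add: range_case_nat\<close>)
  then show ?case using t "5.prems"(1)
    by (auto simp: valI_lift_tm val_eq_valI transitive_in_def)
next
  case (6 \<phi> t)
  have t: "valI (\<lambda>c. c) e t \<in> D" using "6.prems" by (auto intro!: valI_in simp: set_tm_lift_tm)
  have "satI E D (\<lambda>c. c) (case_nat a e) \<phi> \<longleftrightarrow> sat E (case_nat a e) \<phi>" if "a \<in> D" for a
    by (rule "6.IH") (use "6.prems" that in \<open>simp_all add: range_case_nat\<close>)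
  then show ?case using t "6.prems"(1)
    by (auto simp: valI_lift_tm val_eq_valI transitive_in_def)
qed (auto simp: val_eq_valI)

lemma levy_pi_1_cases:
  assumes "levy_pi 1 \<phi>"
  obtains "delta0 \<phi>" | \<psi> where "\<phi> = Forall \<psi>" "levy_pi 1 \<psi>"
  using assms
proof (cases rule: levy_pi.cases)
  case (2 n)
  from 2(2) have "delta0 \<phi>" by (cases rule: levy_sigma.cases) (use 2(1) in simp_all)
  then show ?thesis by (rule that)
qed (use that in simp_all)

lemma pi_1_downward:
  assumes "levy_pi 1 \<phi>" "transitive_in E D" "range e \<subseteq> D" "params \<phi> \<subseteq> D" "sat E e \<phi>"
  shows "satI E D (\<lambda>c. c) e \<phi>"
  using assms(1,3-)
proof (induction "size \<phi>" arbitrary: \<phi> e rule: less_induct)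
  case less
  show ?case
    using less.prems(1)
  proof (cases rule: levy_pi_1_cases)
    case 1
    then show ?thesis using delta0_absolute assms(2) less.prems by blast
  next
    case (2 \<psi>)
    have "satI E D (\<lambda>c. c) (case_nat a e) \<psi>" if "a \<in> D" for a
      by (rule less.hyps) (use 2 less.prems that in \<open>simp_all add: range_case_nat\<close>)
    then show ?thesis using 2 by simp
  qed
qed

text \<open>Witnesses of the leading existential quantifiers are chosen in the whole model and
  collected in \<open>K\<close>; the remaining Pi_1 formula passes down to any transitive domain. A
  true Sigma_2 sentence thus asks of a transitive domain only that it contain finitely many given
  elements.\<close>

lemma sigma_2_upward:
  assumes "levy_sigma 2 \<phi>" "sat E e \<phi>"
  shows "\<exists>K. finite K \<and> (\<forall>D. transitive_in E D \<longrightarrow> K \<subseteq> D \<longrightarrow> range e \<subseteq> D \<longrightarrow> params \<phi> \<subseteq> D \<longrightarrow>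
    satI E D (\<lambda>c. c) e \<phi>)"
  using assms
proof (induction "size \<phi>" arbitrary: \<phi> e rule: less_induct)
  case less
  show ?case
    using less.prems(1)
  proof (cases rule: levy_sigma.cases)
    case (2 n)
    then have "levy_pi 1 \<phi>" by (simp add: numeral_2_eq_2)
    then show ?thesis using pi_1_downward less.prems(2) by (intro exI[of _ "{}"]) blast
  next
    case (3 n \<psi>)
    obtain a where a: "sat E (case_nat a e) \<psi>" using less.prems(2) 3(2) by auto
    have psi: "levy_sigma 2 \<psi>" using 3(3) unfolding 3(1) .
    have "size \<psi> < size \<phi>" by (simp add: 3(2))
    from less.hyps[OF this psi a] obtain K where K: "finite K"
      "\<And>D. transitive_in E D \<Longrightarrow> K \<subseteq> D \<Longrightarrow> range (case_nat a e) \<subseteq> D \<Longrightarrow> params \<psi> \<subseteq> D \<Longrightarrow>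
        satI E D (\<lambda>c. c) (case_nat a e) \<psi>"
      by blast
    show ?thesis
    proof (intro exI[of _ "insert a K"] conjI allI impI)
      fix D assume "transitive_in E D" "insert a K \<subseteq> D" "range e \<subseteq> D" "params \<phi> \<subseteq> D"
      then have "satI E D (\<lambda>c. c) (case_nat a e) \<psi>" "a \<in> D"
        using K(2)[of D] 3 by (simp_all add: range_case_nat)
      then show "satI E D (\<lambda>c. c) e \<phi>" using 3 by auto
    qed (use K in simp)
  qed simp
qed

section \<open>Definability in a model\<close>

primrec elim_tm :: "('a \<Rightarrow> nat) \<Rightarrow> nat \<Rightarrow> 'a tm \<Rightarrow> 'a tm" where
  "elim_tm g k (Var i) = Var (if i < k then i else k + 2 * (i - k))"
| "elim_tm g k (Cst c) = Var (k + 2 * g c + 1)"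

text \<open>
  Constants become free variables. From index \<open>k\<close> on, the even places hold the old variables
  and the odd places hold the constants.
\<close>

primrec elim :: "('a \<Rightarrow> nat) \<Rightarrow> nat \<Rightarrow> 'a fm \<Rightarrow> 'a fm" where
  "elim g k Bot = Bot"
| "elim g k (s \<^bold>\<in> t) = (elim_tm g k s \<^bold>\<in> elim_tm g k t)"
| "elim g k (s \<^bold>= t) = (elim_tm g k s \<^bold>= elim_tm g k t)"
| "elim g k (\<phi> \<^bold>\<longrightarrow> \<psi>) = (elim g k \<phi> \<^bold>\<longrightarrow> elim g k \<psi>)"
| "elim g k (Forall \<phi>) = Forall (elim g (Suc k) \<phi>)"

lemma finite_params: "finite (params \<phi>)"
proof (induction \<phi>)
  case (Mem s t)
  then show ?case by (cases s; cases t) auto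
next
  case (Eq s t)
  then show ?case by (cases s; cases t) auto
qed auto

lemma params_elim: "params (elim g k \<phi>) = {}"
proof (induction \<phi> arbitrary: k)
  case (Mem s t)
  then show ?case by (cases s; cases t) auto
next
  case (Eq s t)
  then show ?case by (cases s; cases t) auto
qed auto

lemma val_elim_tm:
  assumes "\<And>i. i < k \<Longrightarrow> e' i = e i" "\<And>j. e' (k + 2 * j) = e (k + j)"
    "\<And>c. c \<in> set_tm t \<Longrightarrow> e' (Suc (k + 2 * g c)) = c"
  shows "val e' (elim_tm g k t) = val e t"
  using assms(1) assms(2)[of "_ - k"] assms(3) by (cases t) auto

lemma sat_elim:
  assumes "\<And>i. i < k \<Longrightarrow> e' i = e i" "\<And>j. e' (k + 2 * j) = e (k + j)"
    "\<And>c. c \<in> params \<phi> \<Longrightarrow> e' (Suc (k + 2 * g c)) = c"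
  shows "sat E e' (elim g k \<phi>) \<longleftrightarrow> sat E e \<phi>"
  using assms
proof (induction \<phi> arbitrary: k e e')
  case (Forall \<phi>)
  have "sat E (case_nat a e') (elim g (Suc k) \<phi>) \<longleftrightarrow> sat E (case_nat a e) \<phi>" for a
    by (rule Forall.IH) (use Forall.prems in \<open>auto split: nat.split\<close>)
  then show ?case by simp
next
  case (Mem s t)
  have "val e' (elim_tm g k s) = val e s" "val e' (elim_tm g k t) = val e t"
    by (rule val_elim_tm; use Mem in simp)+
  then show ?case by simp
next
  case (Eq s t)
  have "val e' (elim_tm g k s) = val e s" "val e' (elim_tm g k t) = val e t"
    by (rule val_elim_tm; use Eq in simp)+
  then show ?case by simp
next
  case (Imp \<phi> \<psi>)
  have "sat E e' (elim g k \<phi>) \<longleftrightarrow> sat E e \<phi>" "sat E e' (elim g k \<psi>) \<longleftrightarrow> sat E e \<psi>"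
    by (rule Imp.IH; use Imp.prems in simp)+
  then show ?case by simp
qed simp

locale zfc_model =
  fixes E :: "'a \<Rightarrow> 'a \<Rightarrow> bool" (infix "\<epsilon>" 50)
  assumes zfc: "models E ZFC"
begin

text \<open>Definability with parameters, stated for predicates on assignments. Large de Bruijn
  formulas need not be written out: definability is derived by introduction rules along the shape of
  the HOL predicate.\<close>

definition df :: "((nat \<Rightarrow> 'a) \<Rightarrow> bool) \<Rightarrow> bool" where
  "df P \<longleftrightarrow> (\<exists>\<phi>. \<forall>e. sat E e \<phi> \<longleftrightarrow> P e)"

definition dt :: "((nat \<Rightarrow> 'a) \<Rightarrow> 'a) \<Rightarrow> bool" where
  "dt f \<longleftrightarrow> df (\<lambda>e. e 0 = f (\<lambda>i. e (Suc i)))"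

lemma df_rename: "df P \<Longrightarrow> df (\<lambda>e. P (\<lambda>i. e (r i)))"
proof -
  assume "df P"
  then obtain \<phi> where "\<And>e. sat E e \<phi> \<longleftrightarrow> P e" unfolding df_def by blast
  then have "sat E e (subst (\<lambda>i. Var (r i)) \<phi>) \<longleftrightarrow> P (\<lambda>i. e (r i))" for e
    by (simp add: sat_eq_satI satI_subst)
  then show ?thesis unfolding df_def by blast
qed

lemma df_imp: "df P \<Longrightarrow> df Q \<Longrightarrow> df (\<lambda>e. P e \<longrightarrow> Q e)"
  unfolding df_def by (metis sat.simps(4))

lemma df_const: "df (\<lambda>e. c)"
  unfolding df_def by (cases c) (auto intro: exI[of _ Bot] exI[of _ "Neg Bot"])

lemma df_not: "df P \<Longrightarrow> df (\<lambda>e. \<not> P e)"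
  using df_imp[OF _ df_const[of False], of P] by simp

lemma df_conj: "df P \<Longrightarrow> df Q \<Longrightarrow> df (\<lambda>e. P e \<and> Q e)"
  using df_not[OF df_imp[OF _ df_not, of P Q]] by simp

lemma df_disj: "df P \<Longrightarrow> df Q \<Longrightarrow> df (\<lambda>e. P e \<or> Q e)"
  using df_imp[OF df_not, of P Q] by (simp add: disj_imp)

lemma df_iff: "df P \<Longrightarrow> df Q \<Longrightarrow> df (\<lambda>e. P e \<longleftrightarrow> Q e)"
  using df_conj[OF df_imp df_imp, of P Q Q P] by (simp add: iff_conv_conj_imp)

lemma df_all:
  assumes "df (\<lambda>e. Q (\<lambda>i. e (Suc i)) (e 0))"
  shows "df (\<lambda>e. \<forall>x. Q e x)"
proof -
  obtain \<phi> where "\<And>e. sat E e \<phi> \<longleftrightarrow> Q (\<lambda>i. e (Suc i)) (e 0)" using assms unfolding df_def by blast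
  then have "sat E e (Forall \<phi>) \<longleftrightarrow> (\<forall>x. Q e x)" for e by simp
  then show ?thesis unfolding df_def by blast
qed

lemma df_ex:
  assumes "df (\<lambda>e. Q (\<lambda>i. e (Suc i)) (e 0))"
  shows "df (\<lambda>e. \<exists>x. Q e x)"
  using df_not[OF df_all[OF df_not[OF assms]]] by simp

text \<open>\<open>Q (f e) e\<close> is rewritten with an existential quantifier over the value of
  \<open>f\<close>, so a definable function may be used inside a formula as if it were a
  term.\<close>

lemma df_subst: "df (\<lambda>e. Q (e 0) (\<lambda>i. e (Suc i))) \<Longrightarrow> dt f \<Longrightarrow> df (\<lambda>e. Q (f e) e)"
  unfolding dt_def
  using df_ex[of "\<lambda>e x. x = f e \<and> Q x e"] df_conj[of "\<lambda>e. e 0 = f (\<lambda>i. e (Suc i))" "\<lambda>e. Q (e 0) (\<lambda>i. e (Suc i))"]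
  by simp

lemma dt_lift: "dt f \<Longrightarrow> dt (\<lambda>e. f (\<lambda>i. e (Suc i)))"
  unfolding dt_def
  using df_rename[of "\<lambda>e. e 0 = f (\<lambda>i. e (Suc i))" "case_nat 0 (\<lambda>i. Suc (Suc i))"] by simp

lemma df_fun2:
  assumes "df (\<lambda>e. R (e 0) (e 1))" "dt f" "dt g"
  shows "df (\<lambda>e. R (f e) (g e))"
proof -
  have "df (\<lambda>e. R (e 0) (e (Suc 0)))" using assms by simp
  then have "df (\<lambda>e. R (e 1) (e 0))"
    using df_rename[of "\<lambda>e. R (e 0) (e (Suc 0))" "\<lambda>i. 1 - i"] by simp
  then have "df (\<lambda>e. R (e 0) (g (\<lambda>i. e (Suc i))))"
    using df_subst[of "\<lambda>y e. R (e 0) y", OF _ dt_lift[OF assms(3)]] by simp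
  then show ?thesis using df_subst[of "\<lambda>x e. R x (g e)", OF _ assms(2)] by simp
qed

lemma df_fun1: "df (\<lambda>e. R (e 0)) \<Longrightarrow> dt f \<Longrightarrow> df (\<lambda>e. R (f e))"
  using df_subst[of "\<lambda>x e. R x"] by simp

lemma df_mem: "dt f \<Longrightarrow> dt g \<Longrightarrow> df (\<lambda>e. f e \<epsilon> g e)"
  by (rule df_fun2, unfold df_def) (rule exI[of _ "Var 0 \<^bold>\<in> Var 1"], simp)

lemma df_eq: "dt f \<Longrightarrow> dt g \<Longrightarrow> df (\<lambda>e. f e = g e)"
  by (rule df_fun2, unfold df_def) (rule exI[of _ "Var 0 \<^bold>= Var 1"], simp)

lemma dt_var: "dt (\<lambda>e. e i)"
  unfolding dt_def df_def by (rule exI[of _ "Var 0 \<^bold>= Var (Suc i)"]) simp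

lemma dt_const: "dt (\<lambda>e. c)"
  unfolding dt_def df_def by (rule exI[of _ "Var 0 \<^bold>= Cst c"]) simp

lemmas df_intros = df_not df_conj df_disj df_imp df_iff df_all df_ex df_mem df_eq dt_var dt_const df_const

lemma dt_app1:
  assumes "dt (\<lambda>e. h (e 0))" "dt f"
  shows "dt (\<lambda>e. h (f e))"
proof -
  have "df (\<lambda>e. e 0 = h (e 1))" using assms(1) unfolding dt_def by simp
  from df_fun2[OF this dt_var[of 0] dt_lift[OF assms(2)]] show ?thesis unfolding dt_def .
qed

lemma dt_app2:
  assumes "dt (\<lambda>e. h (e 0) (e 1))" "dt f" "dt g"
  shows "dt (\<lambda>e. h (f e) (g e))"
proof -
  have "df (\<lambda>e. e 0 = h (e 1) (e 2))" using assms(1) unfolding dt_def by (simp add: numeral_2_eq_2)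
  then have "df (\<lambda>e. e 2 = h (e 0) (e 1))"
    using df_rename[of "\<lambda>e. e 0 = h (e 1) (e 2)" "\<lambda>i. if i = 0 then 2 else i - 1"] by simp
  then have "df (\<lambda>e. e 1 = h (e 0) (g (\<lambda>i. e (Suc (Suc i)))))"
    using df_subst[of "\<lambda>y e. e 1 = h (e 0) y", OF _ dt_lift[OF dt_lift[OF assms(3)]]]
      df_rename[of "\<lambda>e. e 2 = h (e 0) (e 1)" "\<lambda>i. if i = 0 then 1 else if i = 1 then 0 else i"]
    by (simp add: numeral_2_eq_2)
  then show ?thesis
    using df_subst[of "\<lambda>x e. e 0 = h x (g (\<lambda>i. e (Suc i)))", OF _ dt_lift[OF assms(2)]]
    unfolding dt_def by simp
qed

text \<open>The schemes in \<open>ZFC\<close> admit no constants. The parameters of the defining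
  formula become values of a fixed assignment \<open>rest\<close>, so the schemes can be applied to
  predicates defined with parameters.\<close>

lemma df_code:
  assumes "df P"
  obtains \<phi> rest where "params \<phi> = {}"
    "\<And>x y. sat E (case_nat x (case_nat y rest)) \<phi> \<longleftrightarrow> P (case_nat x (case_nat y (\<lambda>_. undefined)))"
proof -
  obtain \<psi> where \<psi>: "\<And>e. sat E e \<psi> \<longleftrightarrow> P e" using assms unfolding df_def by blast
  have "finite (params \<psi>)"
    by (rule finite_params)
  then obtain g :: "'a \<Rightarrow> nat" where g: "inj_on g (params \<psi>)"
    using finite_imp_inj_to_nat_seg by meson
  \<comment> \<open>Even places keep the default value of the old variables; odd places hold the
    parameters, recovered from their numbers under \<open>g\<close>.\<close>
  define rest where "rest j = (if even j then undefined else inv_into (params \<psi>) g (j div 2))" for j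
  have "sat E (case_nat x (case_nat y rest)) (elim g 2 \<psi>) \<longleftrightarrow>
      sat E (case_nat x (case_nat y (\<lambda>_. undefined))) \<psi>" for x y
  proof (rule sat_elim)
    fix i :: nat assume "i < 2"
    then show "case_nat x (case_nat y rest) i = case_nat x (case_nat y (\<lambda>_. undefined)) i"
      by (auto simp: less_Suc_eq numeral_2_eq_2)
  qed (use g in \<open>auto simp: rest_def\<close>)
  then show ?thesis using that[of "elim g 2 \<psi>" rest] \<psi> by (simp add: params_elim)
qed

section \<open>Elementary set theory in a model\<close>

lemma axiom_true: "\<phi> \<in> ZFC \<Longrightarrow> sat E e \<phi>"
  using zfc unfolding models_def true_in_def by blast

lemma sat_universal_closure: "(\<forall>e. sat E e (universal_closure \<phi>)) \<longleftrightarrow> (\<forall>e. sat E e \<phi>)"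
  using satI_universal_closure[of UNIV E "\<lambda>c. c" \<phi>] by (simp add: sat_eq_satI)

lemma sat_lift_at: "sat E e (lift_at k \<phi>) \<longleftrightarrow> sat E (\<lambda>i. e (if i < k then i else Suc i)) \<phi>"
  by (simp add: sat_eq_satI satI_lift_at)

lemma ext: "(\<And>z. z \<epsilon> x \<longleftrightarrow> z \<epsilon> y) \<Longrightarrow> x = y"
  using axiom_true[of extensionality "\<lambda>_. undefined"] by (fastforce simp: ZFC_def extensionality_def numeral_2_eq_2)

definition is_set :: "('a \<Rightarrow> bool) \<Rightarrow> bool" where
  "is_set Q \<longleftrightarrow> (\<exists>b. \<forall>z. z \<epsilon> b \<longleftrightarrow> Q z)"

definition the_set :: "('a \<Rightarrow> bool) \<Rightarrow> 'a" where
  "the_set Q = (THE b. \<forall>z. z \<epsilon> b \<longleftrightarrow> Q z)"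

lemma mem_the_set: "is_set Q \<Longrightarrow> z \<epsilon> the_set Q \<longleftrightarrow> Q z"
proof -
  assume "is_set Q"
  then have "\<exists>!b. \<forall>z. z \<epsilon> b \<longleftrightarrow> Q z" unfolding is_set_def by (blast intro: ext)
  from theI'[OF this] show ?thesis unfolding the_set_def by blast
qed

lemma eq_the_set: "is_set Q \<Longrightarrow> b = the_set Q \<longleftrightarrow> (\<forall>z. z \<epsilon> b \<longleftrightarrow> Q z)"
  by (auto simp: mem_the_set intro: ext)

text \<open>\<open>b = the_set Q\<close> unfolds to a statement about the members of
  \<open>b\<close>, so an operation given by a definable comprehension has a definable
  graph.\<close>

lemma dt_the_set:
  assumes "df (\<lambda>e. Q (\<lambda>i. e (Suc i)) (e 0))" "\<And>e. is_set (Q e)"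
  shows "dt (\<lambda>e. the_set (Q e))"
proof -
  have "df (\<lambda>e. Q (\<lambda>i. e (Suc (Suc i))) (e 0))"
    using df_rename[OF assms(1), of "case_nat 0 (\<lambda>i. Suc (Suc i))"] by simp
  then show ?thesis unfolding dt_def eq_the_set[OF assms(2)]
    by (intro df_intros)
qed

lemma separation_set:
  assumes "df (\<lambda>e. Q (e 0))"
  shows "is_set (\<lambda>z. z \<epsilon> a \<and> Q z)"
proof -
  obtain \<phi> rest where \<phi>: "params \<phi> = {}" "\<And>x y. sat E (case_nat x (case_nat y rest)) \<phi> \<longleftrightarrow> Q x"
    using df_code[OF assms] by auto
  have "separation \<phi> \<in> ZFC" using \<phi>(1) by (auto simp: ZFC_def)
  then have "\<forall>e. sat E e (separation \<phi>)" using axiom_true by blast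
  then have "sat E rest (Forall (Exists (Forall (Var 0 \<^bold>\<in> Var 1 \<^bold>\<longleftrightarrow> Var 0 \<^bold>\<in> Var 2 \<^bold>\<and> lift_at 1 \<phi>))))"
    unfolding separation_def sat_universal_closure by blast
  then have *: "sat E (case_nat a rest) (Exists (Forall (Var 0 \<^bold>\<in> Var 1 \<^bold>\<longleftrightarrow> Var 0 \<^bold>\<in> Var 2 \<^bold>\<and> lift_at 1 \<phi>)))"
    by (simp only: sat.simps) blast
  have "(\<lambda>i. case_nat z (case_nat b (case_nat a rest)) (if i < 1 then i else Suc i)) =
      case_nat z (case_nat a rest)" for z b
    by (rule HOL.ext) (auto split: nat.split)
  then have "sat E (case_nat z (case_nat b (case_nat a rest))) (lift_at 1 \<phi>) \<longleftrightarrow> Q z" for z b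
    by (simp only: sat_lift_at \<phi>(2))
  then show ?thesis using * unfolding is_set_def by (auto simp: numeral_2_eq_2)
qed

lemma is_set_subset: "df (\<lambda>e. Q (e 0)) \<Longrightarrow> (\<And>z. Q z \<Longrightarrow> z \<epsilon> a) \<Longrightarrow> is_set Q"
  using separation_set[of Q a] unfolding is_set_def by metis

lemma replacement_set:
  assumes "df (\<lambda>e. Q (e 0) (e 1))" "\<And>x y z. Q x y \<Longrightarrow> Q x z \<Longrightarrow> y = z"
  shows "is_set (\<lambda>y. \<exists>x. x \<epsilon> a \<and> Q x y)"
proof -
  obtain \<phi> rest where \<phi>: "params \<phi> = {}" "\<And>x y. sat E (case_nat x (case_nat y rest)) \<phi> \<longleftrightarrow> Q x y"
    using df_code[OF assms(1)] by auto
  have "(\<lambda>i. case_nat x (case_nat y (case_nat z rest)) (if i < 1 then i else Suc i)) = case_nat x (case_nat z rest)"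
    "(\<lambda>i. case_nat x (case_nat y (case_nat z rest)) (if i < 2 then i else Suc i)) = case_nat x (case_nat y rest)"
    for x y z
    by (rule HOL.ext; auto split: nat.split)+
  then have l: "sat E (case_nat x (case_nat y (case_nat z rest))) (lift_at 1 \<phi>) \<longleftrightarrow> Q x z"
    "sat E (case_nat x (case_nat y (case_nat z rest))) (lift_at 2 \<phi>) \<longleftrightarrow> Q x y" for x y z
    by (simp_all only: sat_lift_at \<phi>(2))
  have "replacement \<phi> \<in> ZFC" using \<phi>(1) by (auto simp: ZFC_def)
  then have "\<forall>e. sat E e (replacement \<phi>)" using axiom_true by blast
  then have "sat E rest (Forall (Forall (Forall (lift_at 1 \<phi> \<^bold>\<and> lift_at 2 \<phi> \<^bold>\<longrightarrow> Var 2 \<^bold>= Var 1))) \<^bold>\<longrightarrow>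
     Forall (Exists (Forall (Var 0 \<^bold>\<in> Var 1 \<^bold>\<longleftrightarrow>
       Exists (Var 0 \<^bold>\<in> Var 3 \<^bold>\<and> lift_at 2 (lift_at 2 \<phi>))))))"
    unfolding replacement_def sat_universal_closure by blast
  moreover have "sat E rest (Forall (Forall (Forall (lift_at 1 \<phi> \<^bold>\<and> lift_at 2 \<phi> \<^bold>\<longrightarrow> Var 2 \<^bold>= Var 1))))"
    by (auto simp: l simp del: One_nat_def) (auto simp: numeral_2_eq_2 intro: assms(2))
  ultimately have "sat E (case_nat a rest) (Exists (Forall (Var 0 \<^bold>\<in> Var 1 \<^bold>\<longleftrightarrow>
       Exists (Var 0 \<^bold>\<in> Var 3 \<^bold>\<and> lift_at 2 (lift_at 2 \<phi>)))))"
    by (simp only: sat.simps) blast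
  moreover have "(\<lambda>i. (\<lambda>i. case_nat x (case_nat y (case_nat b (case_nat a rest)))
        (if i < 2 then i else Suc i)) (if i < 2 then i else Suc i)) = case_nat x (case_nat y rest)" for x y b
    by (rule HOL.ext) (auto split: nat.split)
  then have "sat E (case_nat x (case_nat y (case_nat b (case_nat a rest)))) (lift_at 2 (lift_at 2 \<phi>)) \<longleftrightarrow> Q x y" for x y b
    by (simp only: sat_lift_at \<phi>(2))
  ultimately show ?thesis unfolding is_set_def by (simp add: numeral_3_eq_3) blast
qed

lemma is_set_upair: "is_set (\<lambda>v. v = x \<or> v = y)"
proof -
  have "sat E (\<lambda>_. undefined) pairing" by (rule axiom_true) (simp add: ZFC_def)
  then have "sat E (case_nat y (case_nat x (\<lambda>_. undefined)))
      (Exists (Forall (Var 0 \<^bold>\<in> Var 1 \<^bold>\<longleftrightarrow> Var 0 \<^bold>= Var 3 \<^bold>\<or> Var 0 \<^bold>= Var 2)))"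
    unfolding pairing_def by (simp only: sat.simps) blast
  then obtain b where "\<And>z. z \<epsilon> b \<longleftrightarrow> z = x \<or> z = y"
    by (simp add: numeral_2_eq_2 numeral_3_eq_3) metis
  then show ?thesis unfolding is_set_def by blast
qed

lemma is_set_Union: "is_set (\<lambda>z. \<exists>y. z \<epsilon> y \<and> y \<epsilon> a)"
proof -
  have "sat E (\<lambda>_. undefined) union_set" by (rule axiom_true) (simp add: ZFC_def)
  then have "sat E (case_nat a (\<lambda>_. undefined))
      (Exists (Forall (Var 0 \<^bold>\<in> Var 1 \<^bold>\<longleftrightarrow> Exists (Var 1 \<^bold>\<in> Var 0 \<^bold>\<and> Var 0 \<^bold>\<in> Var 3))))"
    unfolding union_set_def by (simp only: sat.simps) blast
  then obtain b where "\<And>z. z \<epsilon> b \<longleftrightarrow> (\<exists>y. z \<epsilon> y \<and> y \<epsilon> a)"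
    by (simp add: numeral_2_eq_2 numeral_3_eq_3) metis
  then show ?thesis unfolding is_set_def by blast
qed

lemma is_set_Pow: "is_set (\<lambda>z. \<forall>u. u \<epsilon> z \<longrightarrow> u \<epsilon> a)"
proof -
  have "sat E (\<lambda>_. undefined) power_set" by (rule axiom_true) (simp add: ZFC_def)
  then have "sat E (case_nat a (\<lambda>_. undefined)) (Exists (Forall (Var 0 \<^bold>\<in> Var 1 \<^bold>\<longleftrightarrow> subset_fm 0 2)))"
    unfolding power_set_def by (simp only: sat.simps) blast
  then obtain b where "\<And>z. z \<epsilon> b \<longleftrightarrow> (\<forall>u. u \<epsilon> z \<longrightarrow> u \<epsilon> a)"
    by (simp add: subset_fm_def numeral_2_eq_2 numeral_3_eq_3) metis
  then show ?thesis unfolding is_set_def by blast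
qed

lemma foundation_true: "y \<epsilon> x \<Longrightarrow> \<exists>y. y \<epsilon> x \<and> (\<forall>z. z \<epsilon> x \<longrightarrow> \<not> z \<epsilon> y)"
  using axiom_true[of foundation "\<lambda>_. undefined"]
  by (simp add: ZFC_def foundation_def numeral_2_eq_2 numeral_3_eq_3) blast

definition em :: 'a where "em = the_set (\<lambda>_. False)"
definition upair :: "'a \<Rightarrow> 'a \<Rightarrow> 'a" where "upair x y = the_set (\<lambda>v. v = x \<or> v = y)"
definition Uni :: "'a \<Rightarrow> 'a" where "Uni a = the_set (\<lambda>z. \<exists>y. z \<epsilon> y \<and> y \<epsilon> a)"
definition Pw :: "'a \<Rightarrow> 'a" where "Pw a = the_set (\<lambda>z. \<forall>u. u \<epsilon> z \<longrightarrow> u \<epsilon> a)"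
definition un :: "'a \<Rightarrow> 'a \<Rightarrow> 'a" where "un a b = Uni (upair a b)"
definition sc :: "'a \<Rightarrow> 'a" where "sc a = un a (upair a a)"
definition pr :: "'a \<Rightarrow> 'a \<Rightarrow> 'a" where "pr x y = upair (upair x x) (upair x y)"

lemma is_set_empty: "is_set (\<lambda>_. False)"
  using separation_set[OF df_const[of False]] by simp

lemma mem_em [simp]: "\<not> z \<epsilon> em"
  unfolding em_def by (simp add: mem_the_set is_set_empty)

lemma mem_upair [simp]: "z \<epsilon> upair x y \<longleftrightarrow> z = x \<or> z = y"
  unfolding upair_def by (simp add: mem_the_set is_set_upair)

lemma mem_Uni: "z \<epsilon> Uni a \<longleftrightarrow> (\<exists>y. z \<epsilon> y \<and> y \<epsilon> a)"
  unfolding Uni_def by (simp add: mem_the_set is_set_Union)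

lemma mem_Pw [simp]: "z \<epsilon> Pw a \<longleftrightarrow> (\<forall>u. u \<epsilon> z \<longrightarrow> u \<epsilon> a)"
  unfolding Pw_def by (simp add: mem_the_set is_set_Pow)

lemma mem_un [simp]: "z \<epsilon> un a b \<longleftrightarrow> z \<epsilon> a \<or> z \<epsilon> b"
  unfolding un_def by (auto simp: mem_Uni)

lemma mem_sc [simp]: "z \<epsilon> sc a \<longleftrightarrow> z \<epsilon> a \<or> z = a"
  unfolding sc_def by auto

lemma upair_eq_iff: "upair x y = upair x' y' \<longleftrightarrow> x = x' \<and> y = y' \<or> x = y' \<and> y = x'"
proof -
  have "x = x' \<and> y = y' \<or> x = y' \<and> y = x'" if eq: "upair x y = upair x' y'"
  proof -
    have "z = x \<or> z = y \<longleftrightarrow> z = x' \<or> z = y'" for z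
      using arg_cong[OF eq, of "\<lambda>b. z \<epsilon> b"] by simp
    then show ?thesis by metis
  qed
  moreover have "upair x y = upair y x" by (rule ext) auto
  ultimately show ?thesis by auto
qed

lemma pr_eq_iff [simp]: "pr x y = pr x' y' \<longleftrightarrow> x = x' \<and> y = y'"
  unfolding pr_def upair_eq_iff by auto

lemma dt_upair0: "dt (\<lambda>e. upair (e 0) (e 1))"
  unfolding upair_def by (intro dt_the_set df_intros is_set_upair)

lemma dt_Uni0: "dt (\<lambda>e. Uni (e 0))"
  unfolding Uni_def by (intro dt_the_set df_intros is_set_Union)

lemma dt_upair: "dt f \<Longrightarrow> dt g \<Longrightarrow> dt (\<lambda>e. upair (f e) (g e))"
  by (rule dt_app2[OF dt_upair0])

lemma dt_Uni: "dt f \<Longrightarrow> dt (\<lambda>e. Uni (f e))"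
  by (rule dt_app1[OF dt_Uni0])

lemma dt_un: "dt f \<Longrightarrow> dt g \<Longrightarrow> dt (\<lambda>e. un (f e) (g e))"
  unfolding un_def by (intro dt_Uni dt_upair)

lemma dt_sc: "dt f \<Longrightarrow> dt (\<lambda>e. sc (f e))"
  unfolding sc_def by (intro dt_un dt_upair)

lemma dt_pr: "dt f \<Longrightarrow> dt g \<Longrightarrow> dt (\<lambda>e. pr (f e) (g e))"
  unfolding pr_def by (intro dt_upair)

lemmas df_rules = df_intros dt_upair dt_Uni dt_un dt_sc dt_pr

lemma not_mem_self: "\<not> x \<epsilon> x"
  using foundation_true[of x "upair x x"] by auto

lemma not_mem_cycle: "x \<epsilon> y \<Longrightarrow> \<not> y \<epsilon> x"
  using foundation_true[of x "upair x y"] by auto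

lemma sc_inj: "sc m = sc n \<Longrightarrow> m = n"
  by (metis mem_sc not_mem_cycle)

lemma em_neq_sc: "em \<noteq> sc n"
  by (metis mem_em mem_sc)

text \<open>Repeated pairing and union turn finite collections of the metatheory into sets of the
  model. This is how finitely many witnesses or relations are handed to the model as one
  element.\<close>

lemma is_set_finite: "finite A \<Longrightarrow> is_set (\<lambda>z. z \<in> A)"
proof (induction rule: finite_induct)
  case empty
  then show ?case using is_set_empty by simp
next
  case (insert x A)
  then obtain b where "\<And>z. z \<epsilon> b \<longleftrightarrow> z \<in> A" unfolding is_set_def by blast
  then have "z \<epsilon> un b (upair x x) \<longleftrightarrow> z \<in> insert x A" for z by auto
  then show ?case unfolding is_set_def by blast
qed

subsection \<open>The natural numbers\<close>

definition ind :: "'a \<Rightarrow> bool" where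
  "ind I \<longleftrightarrow> em \<epsilon> I \<and> (\<forall>x. x \<epsilon> I \<longrightarrow> sc x \<epsilon> I)"

lemma sc_eq_iff: "y = sc x \<longleftrightarrow> (\<forall>z. z \<epsilon> y \<longleftrightarrow> z \<epsilon> x \<or> z = x)"
  by (auto intro: ext)

lemma em_eq_iff: "y = em \<longleftrightarrow> (\<forall>z. \<not> z \<epsilon> y)"
  by (auto intro: ext)

lemma sat_empty_fm: "sat E e (empty_fm i) \<longleftrightarrow> e i = em"
  by (simp add: empty_fm_def em_eq_iff)

lemma sat_succ_fm: "sat E e (succ_fm i j) \<longleftrightarrow> e j = sc (e i)"
  unfolding succ_fm_def sc_eq_iff by simp blast

lemma sat_inductive_fm: "sat E e (inductive_fm i) \<longleftrightarrow> ind (e i)"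
  unfolding inductive_fm_def ind_def by (auto simp: sat_empty_fm sat_succ_fm)

definition om :: 'a where "om = the_set (\<lambda>n. \<forall>I. ind I \<longrightarrow> n \<epsilon> I)"

lemma mem_om: "n \<epsilon> om \<longleftrightarrow> (\<forall>I. ind I \<longrightarrow> n \<epsilon> I)"
proof -
  obtain I where "ind I"
    using axiom_true[of infinity "\<lambda>_. undefined"] by (auto simp: ZFC_def infinity_def sat_inductive_fm)
  moreover have "df (\<lambda>e. \<forall>I. ind I \<longrightarrow> e 0 \<epsilon> I)"
    unfolding ind_def by (intro df_rules)
  ultimately have "is_set (\<lambda>n. \<forall>I. ind I \<longrightarrow> n \<epsilon> I)"
    by (intro is_set_subset[of _ I]) auto
  then show ?thesis unfolding om_def by (simp add: mem_the_set)
qed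

lemma ind_om: "ind om"
  unfolding ind_def mem_om by blast

lemma em_om: "em \<epsilon> om" and sc_om: "n \<epsilon> om \<Longrightarrow> sc n \<epsilon> om"
  using ind_om unfolding ind_def by auto

text \<open>The part of \<open>om\<close> where \<open>Q\<close> holds is an inductive set.
  Definability of \<open>Q\<close> is essential: standardness is not definable when
  \<open>om\<close> has nonstandard elements.\<close>

lemma om_induct:
  assumes "n \<epsilon> om" "df (\<lambda>e. Q (e 0))" "Q em" "\<And>n. n \<epsilon> om \<Longrightarrow> Q n \<Longrightarrow> Q (sc n)"
  shows "Q n"
proof -
  obtain I where I: "\<And>z. z \<epsilon> I \<longleftrightarrow> z \<epsilon> om \<and> Q z"
    using separation_set[OF assms(2)] unfolding is_set_def by blast
  have "ind I" unfolding ind_def I using assms em_om sc_om by blast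
  then show ?thesis using assms(1) I unfolding mem_om by blast
qed

lemma om_cases:
  assumes "n \<epsilon> om"
  obtains "n = em" | m where "m \<epsilon> om" "n = sc m"
proof -
  have "n = em \<or> (\<exists>m. m \<epsilon> om \<and> n = sc m)"
    by (rule om_induct[OF assms]) (intro df_rules, auto)
  then show ?thesis using that by blast
qed

lemma om_natural_in: "natural_in E n \<longleftrightarrow> n \<epsilon> om"
proof -
  have "true_in E (inst (omega_fm 0) (Cst w)) \<longleftrightarrow> ind w \<and> (\<forall>I. ind I \<longrightarrow> (\<forall>z. z \<epsilon> w \<longrightarrow> z \<epsilon> I))" for w
    unfolding true_in_def
    by (simp add: sat_eq_satI satI_inst) (simp add: flip: sat_eq_satI add: omega_fm_def sat_inductive_fm subset_fm_def)
  moreover have "ind w \<and> (\<forall>I. ind I \<longrightarrow> (\<forall>z. z \<epsilon> w \<longrightarrow> z \<epsilon> I)) \<longleftrightarrow> w = om" for w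
    using ind_om mem_om by (auto intro!: ext)
  ultimately show ?thesis unfolding natural_in_def by simp
qed

text \<open>The standard natural numbers of the model, indexed by \<open>nat\<close> in the
  metatheory; \<open>om\<close> may contain further elements.\<close>

definition num :: "nat \<Rightarrow> 'a" where "num i = (sc ^^ i) em"

lemma num_0: "num 0 = em" and num_Suc: "num (Suc i) = sc (num i)"
  by (simp_all add: num_def)

lemma num_om: "num i \<epsilon> om"
  by (induction i) (simp_all add: num_0 num_Suc em_om sc_om)

lemma mem_num: "z \<epsilon> num n \<longleftrightarrow> (\<exists>m<n. z = num m)"
  by (induction n) (auto simp: num_0 num_Suc less_Suc_eq)

lemma num_mem_num: "num m \<epsilon> num n \<longleftrightarrow> m < n"
proof
  assume "num m \<epsilon> num n"
  then obtain k where k: "k < n" "num m = num k" by (auto simp: mem_num)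
  have "\<not> n \<le> m"
  proof
    assume "n \<le> m"
    then have "k < m" using k by simp
    then have "num k \<epsilon> num m" by (auto simp: mem_num)
    then show False using k not_mem_self by simp
  qed
  then show "m < n" by simp
qed (auto simp: mem_num)

subsection \<open>Closure under a definable function\<close>

text \<open>Iteration of \<open>G\<close> along \<open>om\<close>, by set approximations.
  \<open>good f\<close> requires that each pair be the start or be justified by another pair in
  \<open>f\<close>; since \<open>f\<close> need be neither a function nor total, the next pair can
  be added at once. Values are unique by induction on \<open>n\<close>, and Replacement collects
  them.\<close>

lemma closure_set:
  assumes G: "dt (\<lambda>e. G (e 0))"
  shows "\<exists>S. a \<epsilon> S \<and> (\<forall>x. x \<epsilon> S \<longrightarrow> G x \<epsilon> S)"
proof -
  define good where "good f \<longleftrightarrow> (\<forall>m y. pr m y \<epsilon> f \<longrightarrow> m = em \<and> y = a \<or>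
    (\<exists>m' y'. pr m' y' \<epsilon> f \<and> m = sc m' \<and> y = G y'))" for f
  define P where "P n y \<longleftrightarrow> (\<exists>f. good f \<and> pr n y \<epsilon> f)" for n y
  have df_P: "df (\<lambda>e. P (e 0) (e 1))"
    unfolding P_def good_def by (intro df_rules dt_app1[OF G])
  have P0: "P em a"
    unfolding P_def good_def by (rule exI[of _ "upair (pr em a) (pr em a)"]) auto
  have P_step: "P (sc n) (G y)" if P: "P n y" for n y
  proof -
    obtain f where f: "good f" "pr n y \<epsilon> f" using P unfolding P_def by blast
    let ?f = "un f (upair (pr (sc n) (G y)) (pr (sc n) (G y)))"
    have "good ?f" using f unfolding good_def mem_un mem_upair pr_eq_iff by metis
    then show ?thesis unfolding P_def by auto
  qed
  have P_em: "y = a" if P: "P em y" for y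
  proof -
    obtain f where "good f" "pr em y \<epsilon> f" using P unfolding P_def by blast
    then show ?thesis using em_neq_sc unfolding good_def by blast
  qed
  have P_sc: "\<exists>y'. P n y' \<and> y = G y'" if P: "P (sc n) y" for n y
  proof -
    obtain f where f: "good f" "pr (sc n) y \<epsilon> f" using P unfolding P_def by blast
    then obtain m' y' where "pr m' y' \<epsilon> f" "sc n = sc m'" "y = G y'"
      using em_neq_sc unfolding good_def by metis
    then show ?thesis using f(1) sc_inj unfolding P_def by blast
  qed
  have uniq: "y = z" if "n \<epsilon> om" "P n y" "P n z" for n y z
  proof -
    have "\<forall>y z. P n y \<longrightarrow> P n z \<longrightarrow> y = z"
    proof (rule om_induct[OF that(1)])
      show "df (\<lambda>e. \<forall>y z. P (e 0) y \<longrightarrow> P (e 0) z \<longrightarrow> y = z)"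
        by (intro df_rules df_fun2[OF df_P])
    qed (use P_em P_sc in metis)+
    then show ?thesis using that by blast
  qed
  \<comment> \<open>The condition on \<open>n\<close> is repeated inside the relation, since
    \<open>P\<close> is known to be single-valued only on \<open>om\<close>.\<close>
  have "is_set (\<lambda>y. \<exists>n. n \<epsilon> om \<and> (n \<epsilon> om \<and> P n y))"
    by (rule replacement_set) (intro df_rules df_fun2[OF df_P], use uniq in blast)
  then obtain S where S: "\<And>y. y \<epsilon> S \<longleftrightarrow> (\<exists>n. n \<epsilon> om \<and> P n y)"
    unfolding is_set_def by auto
  show ?thesis
    using S P0 P_step em_om sc_om by (intro exI[of _ S]) metis
qed

definition tr :: "'a \<Rightarrow> bool" where
  "tr x \<longleftrightarrow> (\<forall>y z. z \<epsilon> y \<longrightarrow> y \<epsilon> x \<longrightarrow> z \<epsilon> x)"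

text \<open>The union of a family closed under \<open>Uni\<close> is transitive; iteration gives
  such a family containing \<open>x\<close>.\<close>

lemma transitive_superset: "\<exists>t. tr t \<and> (\<forall>y. y \<epsilon> x \<longrightarrow> y \<epsilon> t)"
proof -
  obtain S where S: "x \<epsilon> S" "\<And>u. u \<epsilon> S \<Longrightarrow> Uni u \<epsilon> S"
    using closure_set[of Uni x] dt_Uni0 by blast
  have "tr (Uni S)" unfolding tr_def using S(2) by (metis mem_Uni)
  moreover have "y \<epsilon> Uni S" if "y \<epsilon> x" for y using that S(1) by (auto simp: mem_Uni)
  ultimately show ?thesis by blast
qed

text \<open>Foundation speaks of sets, so the class of counterexamples is first cut down to a
  transitive set containing \<open>x\<close>, where a minimal counterexample is minimal
  outright.\<close>

lemma mem_induct:
  assumes "df (\<lambda>e. Q (e 0))" "\<And>x. (\<And>y. y \<epsilon> x \<Longrightarrow> Q y) \<Longrightarrow> Q x"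
  shows "Q x"
proof (rule ccontr)
  assume nQ: "\<not> Q x"
  obtain t where t: "tr t" "\<And>y. y \<epsilon> upair x x \<Longrightarrow> y \<epsilon> t" using transitive_superset by blast
  obtain b where b: "\<And>z. z \<epsilon> b \<longleftrightarrow> z \<epsilon> t \<and> \<not> Q z"
    using separation_set[OF df_not[OF assms(1)]] unfolding is_set_def by blast
  have "x \<epsilon> b" using b nQ t by simp
  then obtain y where "y \<epsilon> b" "\<And>z. z \<epsilon> b \<Longrightarrow> \<not> z \<epsilon> y" using foundation_true by blast
  then show False using b assms(2)[of y] t(1) unfolding tr_def by blast
qed

lemma mem_minimal:
  assumes "df (\<lambda>e. Q (e 0))" "Q x"
  shows "\<exists>x. Q x \<and> (\<forall>y. y \<epsilon> x \<longrightarrow> \<not> Q y)"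
  using mem_induct[OF df_not[OF assms(1)], of x] assms(2) by blast

section \<open>Levels of the cumulative hierarchy and reflection\<close>

definition sub :: "'a \<Rightarrow> 'a \<Rightarrow> bool" where
  "sub x y \<longleftrightarrow> (\<forall>u. u \<epsilon> x \<longrightarrow> u \<epsilon> y)"

text \<open>
  Levels are defined without ordinals or recursion, following Scott, Derrick and Potter.
\<close>

definition hist :: "'a \<Rightarrow> bool" where
  "hist h \<longleftrightarrow> (\<forall>x. x \<epsilon> h \<longrightarrow> (\<forall>z. z \<epsilon> x \<longleftrightarrow> (\<exists>c. c \<epsilon> x \<and> c \<epsilon> h \<and> sub z c)))"

definition lev :: "'a \<Rightarrow> bool" where
  "lev s \<longleftrightarrow> (\<exists>h. hist h \<and> (\<forall>z. z \<epsilon> s \<longleftrightarrow> (\<exists>c. c \<epsilon> h \<and> sub z c)))"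

lemma df_sub: "dt f \<Longrightarrow> dt g \<Longrightarrow> df (\<lambda>e. sub (f e) (g e))"
  by (rule df_fun2) (unfold sub_def, intro df_rules)

lemma df_lev: "dt f \<Longrightarrow> df (\<lambda>e. lev (f e))"
  by (rule df_fun1) (unfold lev_def hist_def, intro df_rules df_sub)

lemma df_tr: "dt f \<Longrightarrow> df (\<lambda>e. tr (f e))"
  by (rule df_fun1) (unfold tr_def, intro df_rules)

lemma sub_refl: "sub x x" and sub_trans: "sub x y \<Longrightarrow> sub y z \<Longrightarrow> sub x z"
  unfolding sub_def by auto

lemma tr_sub: "tr x \<Longrightarrow> y \<epsilon> x \<Longrightarrow> sub y x"
  unfolding tr_def sub_def by blast

lemma hist_tr:
  assumes "hist h" "x \<epsilon> h"
  shows "tr x"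
proof -
  have "x \<epsilon> h \<longrightarrow> tr x"
  proof (rule mem_induct[where x = x])
    show "df (\<lambda>e. e 0 \<epsilon> h \<longrightarrow> tr (e 0))" by (intro df_rules df_tr)
  next
    fix x assume ih: "\<And>y. y \<epsilon> x \<Longrightarrow> y \<epsilon> h \<longrightarrow> tr y"
    show "x \<epsilon> h \<longrightarrow> tr x"
    proof
      assume x: "x \<epsilon> h"
      show "tr x" unfolding tr_def
      proof (intro allI impI)
        fix y z assume "z \<epsilon> y" "y \<epsilon> x"
        then obtain c where c: "c \<epsilon> x" "c \<epsilon> h" "sub y c" using assms(1) x unfolding hist_def by blast
        then have "sub z c" using \<open>z \<epsilon> y\<close> ih by (auto simp: sub_def[of y] intro: tr_sub)
        then show "z \<epsilon> x" using assms(1) x c unfolding hist_def by blast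
      qed
    qed
  qed
  then show ?thesis using assms(2) by blast
qed

text \<open>The members of \<open>h\<close> that belong to \<open>x\<close> again form a history, by
  transitivity of \<open>x\<close>, and that history accumulates to \<open>x\<close>.\<close>

lemma hist_lev:
  assumes h: "hist h" and x: "x \<epsilon> h"
  shows "lev x"
proof -
  obtain h' where h': "\<And>z. z \<epsilon> h' \<longleftrightarrow> z \<epsilon> x \<and> z \<epsilon> h"
    using separation_set[OF df_mem[OF dt_var[of 0] dt_const[of h]], of x] unfolding is_set_def by blast
  have "hist h'"
    unfolding hist_def
  proof (intro allI impI)
    fix y z assume "y \<epsilon> h'"
    then have y: "y \<epsilon> x" "y \<epsilon> h" by (simp_all add: h')
    then have "z \<epsilon> y \<longleftrightarrow> (\<exists>c. c \<epsilon> y \<and> c \<epsilon> h \<and> sub z c)" using h unfolding hist_def by blast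
    then show "z \<epsilon> y \<longleftrightarrow> (\<exists>c. c \<epsilon> y \<and> c \<epsilon> h' \<and> sub z c)"
      using hist_tr[OF h x] y(1) unfolding tr_def h' by blast
  qed
  moreover have "z \<epsilon> x \<longleftrightarrow> (\<exists>c. c \<epsilon> h' \<and> sub z c)" for z
    using h x unfolding hist_def h' by blast
  ultimately show ?thesis unfolding lev_def by blast
qed

lemma lev_tr: "lev s \<Longrightarrow> tr s"
  unfolding tr_def lev_def by (meson hist_tr sub_def tr_sub)

lemma lev_mem_sub: "lev s \<Longrightarrow> z \<epsilon> s \<Longrightarrow> sub u z \<Longrightarrow> u \<epsilon> s"
  unfolding lev_def using sub_trans by blast

text \<open>A level is thus recovered from the levels that belong to it; the comparison of two
  levels rests on this.\<close>

lemma lev_mem_iff: "lev s \<Longrightarrow> z \<epsilon> s \<longleftrightarrow> (\<exists>c. lev c \<and> c \<epsilon> s \<and> sub z c)"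
  by (metis hist_lev lev_def lev_mem_sub sub_refl)

text \<open>Choose \<open>s\<close> minimal among the levels incomparable with some level, then
  \<open>t\<close> minimal among the levels incomparable with \<open>s\<close>. Both contain the
  same levels and are therefore equal.\<close>

lemma lev_linear:
  assumes "lev s" "lev t"
  shows "s \<epsilon> t \<or> s = t \<or> t \<epsilon> s"
proof (rule ccontr)
  define comp where "comp s t \<longleftrightarrow> s \<epsilon> t \<or> s = t \<or> t \<epsilon> s" for s t
  have df_comp: "df (\<lambda>e. comp (f e) (g e))" if "dt f" "dt g" for f g
    unfolding comp_def using that by (intro df_rules)
  have df_s: "df (\<lambda>e. lev (e 0) \<and> (\<exists>t. lev t \<and> \<not> comp (e 0) t))"
    by (intro df_intros df_lev df_comp)
  have df_t: "df (\<lambda>e. lev (e 0) \<and> \<not> comp s (e 0))" for s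
    by (intro df_intros df_lev df_comp)
  assume "\<not> (s \<epsilon> t \<or> s = t \<or> t \<epsilon> s)"
  then have "lev s \<and> (\<exists>t. lev t \<and> \<not> comp s t)" using assms unfolding comp_def by blast
  then obtain s where s: "lev s" "\<exists>t. lev t \<and> \<not> comp s t"
    and s_min: "\<And>r. r \<epsilon> s \<Longrightarrow> lev r \<Longrightarrow> (\<forall>t. lev t \<longrightarrow> comp r t)"
    using mem_minimal[OF df_s] by blast
  then obtain t where t: "lev t" "\<not> comp s t"
    and t_min: "\<And>r. r \<epsilon> t \<Longrightarrow> lev r \<Longrightarrow> comp s r"
    using mem_minimal[OF df_t[of s]] by blast
  have "r \<epsilon> t" if "r \<epsilon> s" "lev r" for r
    using s_min[OF that] t that lev_tr[OF s(1)] unfolding comp_def tr_def by blast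
  moreover have "r \<epsilon> s" if "r \<epsilon> t" "lev r" for r
    using t_min[OF that] t that lev_tr[OF t(1)] unfolding comp_def tr_def by blast
  ultimately have "s = t"
    by (intro ext, subst lev_mem_iff[OF s(1)], subst lev_mem_iff[OF t(1)]) blast
  then show False using t(2) unfolding comp_def by blast
qed

text \<open>Scott's device: the least level with a property is unique, so it can be fed to
  Replacement where the witnesses themselves are not unique.\<close>

definition least_lev :: "('a \<Rightarrow> bool) \<Rightarrow> 'a \<Rightarrow> bool" where
  "least_lev Q t \<longleftrightarrow> lev t \<and> Q t \<and> (\<forall>r. r \<epsilon> t \<longrightarrow> \<not> (lev r \<and> Q r))"

lemma least_lev_unique: "least_lev Q s \<Longrightarrow> least_lev Q t \<Longrightarrow> s = t"
  unfolding least_lev_def using lev_linear by blast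

lemma least_lev_exists: "df (\<lambda>e. Q (e 0)) \<Longrightarrow> lev t \<Longrightarrow> Q t \<Longrightarrow> \<exists>t. least_lev Q t"
  unfolding least_lev_def using mem_minimal[of "\<lambda>t. lev t \<and> Q t" t] df_conj[OF df_lev[OF dt_var]] by blast

text \<open>Induction on membership: least levels including the elements of \<open>x\<close> are
  gathered by Replacement, and the history that they generate yields a level containing all elements
  of \<open>x\<close>.\<close>

lemma sub_level: "\<exists>s. lev s \<and> sub x s"
proof (rule mem_induct[where x = x])
  show "df (\<lambda>e. \<exists>s. lev s \<and> sub (e 0) s)" by (intro df_rules df_lev df_sub)
next
  fix x assume ih: "\<And>y. y \<epsilon> x \<Longrightarrow> \<exists>s. lev s \<and> sub y s"
  have "is_set (\<lambda>t. \<exists>y. y \<epsilon> x \<and> least_lev (sub y) t)"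
    by (rule replacement_set, unfold least_lev_def, intro df_rules df_lev df_sub)
      (use least_lev_unique in \<open>unfold least_lev_def, blast\<close>)
  then obtain a where a: "\<And>t. t \<epsilon> a \<longleftrightarrow> (\<exists>y. y \<epsilon> x \<and> least_lev (sub y) t)"
    unfolding is_set_def by blast
  \<comment> \<open>Adding \<open>Uni a\<close> makes the collection downward closed among levels,
    as a history requires.\<close>
  obtain h where h: "\<And>r. r \<epsilon> h \<longleftrightarrow> r \<epsilon> un a (Uni a) \<and> lev r"
    using separation_set[OF df_lev[OF dt_var], of "un a (Uni a)"] unfolding is_set_def by blast
  have lev_a: "lev t" if "t \<epsilon> a" for t using that a unfolding least_lev_def by blast
  have down: "c \<epsilon> h" if "r \<epsilon> h" "c \<epsilon> r" "lev c" for r c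
    using that lev_tr[OF lev_a] unfolding h mem_un mem_Uni tr_def by blast
  have "hist h"
    unfolding hist_def
  proof (intro allI impI)
    fix r z assume r: "r \<epsilon> h"
    then have "lev r" by (simp add: h)
    then show "z \<epsilon> r \<longleftrightarrow> (\<exists>c. c \<epsilon> r \<and> c \<epsilon> h \<and> sub z c)"
      using lev_mem_iff down[OF r] h by blast
  qed
  moreover have "is_set (\<lambda>z. \<exists>c. c \<epsilon> h \<and> sub z c)"
    by (rule is_set_subset[of _ "Pw (Uni h)"], intro df_rules df_sub) (auto simp: sub_def mem_Uni)
  then obtain s where s: "\<And>z. z \<epsilon> s \<longleftrightarrow> (\<exists>c. c \<epsilon> h \<and> sub z c)" unfolding is_set_def by blast
  ultimately have "lev s" unfolding lev_def by blast
  moreover have "sub x s"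
    unfolding sub_def
  proof (intro allI impI)
    fix y assume y: "y \<epsilon> x"
    then obtain t where t: "least_lev (sub y) t"
      using ih[OF y] least_lev_exists[OF df_sub[OF dt_const dt_var]] by blast
    then have "t \<epsilon> h" using y a unfolding h least_lev_def by auto
    then show "y \<epsilon> s" using t s unfolding least_lev_def by blast
  qed
  ultimately show "\<exists>s. lev s \<and> sub x s" by blast
qed

text \<open>Replacement handles functional relations; the least level that contains a witness for
  \<open>x\<close> stands in for a choice of witness.\<close>

lemma collection:
  assumes R: "df (\<lambda>e. R (e 0) (e 1))"
  shows "\<exists>s. lev s \<and> (\<forall>x. x \<epsilon> a \<longrightarrow> (\<exists>y. R x y) \<longrightarrow> (\<exists>y. y \<epsilon> s \<and> R x y))"
proof -
  define Q where "Q x t \<longleftrightarrow> (\<exists>y. y \<epsilon> t \<and> R x y)" for x t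
  have df_Q: "df (\<lambda>e. Q (f e) (g e))" if "dt f" "dt g" for f g
    by (rule df_fun2[OF _ that]) (unfold Q_def, intro df_rules df_fun2[OF R])
  have "is_set (\<lambda>t. \<exists>x. x \<epsilon> a \<and> least_lev (Q x) t)"
    by (rule replacement_set, unfold least_lev_def, intro df_intros df_lev df_Q)
      (use least_lev_unique in \<open>unfold least_lev_def, blast\<close>)
  then obtain b where b: "\<And>t. t \<epsilon> b \<longleftrightarrow> (\<exists>x. x \<epsilon> a \<and> least_lev (Q x) t)"
    unfolding is_set_def by blast
  obtain s where s: "lev s" "sub b s" using sub_level by blast
  have "\<exists>y. y \<epsilon> s \<and> R x y" if x: "x \<epsilon> a" and y: "R x y" for x y
  proof -
    obtain t where "lev t" "sub (upair y y) t" using sub_level by blast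
    then have "Q x t" using y unfolding sub_def Q_def by auto
    then obtain t where t: "least_lev (Q x) t"
      using least_lev_exists[OF df_Q[OF dt_const dt_var] \<open>lev t\<close>] by blast
    then have "t \<epsilon> s" using b x s(2) unfolding sub_def by blast
    then show ?thesis using t lev_tr[OF s(1)] unfolding least_lev_def tr_def Q_def by blast
  qed
  then show ?thesis using s(1) by blast
qed

lemma df_ball_finite: "finite A \<Longrightarrow> (\<And>R. R \<in> A \<Longrightarrow> df (P R)) \<Longrightarrow> df (\<lambda>e. \<forall>R\<in>A. P R e)"
proof (induction rule: finite_induct)
  case empty
  then show ?case using df_const[of True] by simp
next
  case (insert x A)
  then show ?case using df_conj[of "P x" "\<lambda>e. \<forall>R\<in>A. P R e"] by simp
qed

text \<open>Closure properties of \<open>V_\<lambda>\<close> for a limit ordinal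
  \<open>\<lambda>\<close>. Closure under arbitrary subsets is what later gives Separation and
  Choice inside \<open>B\<close>.\<close>

definition limit_level :: "'a \<Rightarrow> bool" where
  "limit_level B \<longleftrightarrow> tr B \<and> (\<forall>x y. x \<epsilon> B \<longrightarrow> sub y x \<longrightarrow> y \<epsilon> B) \<and>
    (\<forall>x y. x \<epsilon> B \<longrightarrow> y \<epsilon> B \<longrightarrow> upair x y \<epsilon> B) \<and>
    (\<forall>x. x \<epsilon> B \<longrightarrow> Pw x \<epsilon> B) \<and> (\<forall>x. x \<epsilon> B \<longrightarrow> Uni x \<epsilon> B)"

text \<open>A Skolem-closure form of the reflection principle: pass repeatedly to a level that
  contains witnesses for all elements obtained so far, and take the union along
  \<open>om\<close>.\<close>

lemma reflection:
  assumes fin: "finite \<R>" and df_R: "\<And>R. R \<in> \<R> \<Longrightarrow> df (\<lambda>e. R (e 0) (e 1))"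
  shows "\<exists>B. p \<epsilon> B \<and> limit_level B \<and> (\<forall>R\<in>\<R>. \<forall>x. x \<epsilon> B \<longrightarrow> (\<exists>y. R x y) \<longrightarrow> (\<exists>y. y \<epsilon> B \<and> R x y))"
proof -
  define step where "step s t \<longleftrightarrow> s \<epsilon> t \<and> (\<forall>R\<in>\<R>. \<forall>x. x \<epsilon> s \<longrightarrow> (\<exists>y. R x y) \<longrightarrow> (\<exists>y. y \<epsilon> t \<and> R x y))" for s t
  have df_step: "df (\<lambda>e. step (f e) (g e))" if "dt f" "dt g" for f g
    by (rule df_fun2[OF _ that]) (unfold step_def, intro df_rules df_ball_finite[OF fin] df_fun2[of _, OF df_R])
  have step_ex: "\<exists>t. lev t \<and> step s t" for s
  proof -
    have "\<forall>R\<in>\<R>. \<exists>t. lev t \<and> (\<forall>x. x \<epsilon> s \<longrightarrow> (\<exists>y. R x y) \<longrightarrow> (\<exists>y. y \<epsilon> t \<and> R x y))"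
      by (intro ballI collection df_R)
    then obtain T where T: "\<And>R x. R \<in> \<R> \<Longrightarrow> x \<epsilon> s \<Longrightarrow> (\<exists>y. R x y) \<Longrightarrow> (\<exists>y. y \<epsilon> T R \<and> R x y)"
      by metis
    obtain c where c: "\<And>z. z \<epsilon> c \<longleftrightarrow> z \<in> insert s (T ` \<R>)"
      using is_set_finite[of "insert s (T ` \<R>)"] fin unfolding is_set_def by blast
    obtain t where t: "lev t" "sub c t" using sub_level by blast
    then have "s \<epsilon> t" "\<And>R. R \<in> \<R> \<Longrightarrow> T R \<epsilon> t" using c unfolding sub_def by auto
    moreover have "\<exists>y. y \<epsilon> t \<and> R x y" if R: "R \<in> \<R>" "x \<epsilon> s" "\<exists>y. R x y" for R x
    proof -
      obtain y where "y \<epsilon> T R" "R x y" using T[OF R] by blast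
      moreover have "T R \<epsilon> t" using R calculation c t(2) unfolding sub_def by auto
      ultimately show ?thesis using lev_tr[OF t(1)] unfolding tr_def by blast
    qed
    ultimately show ?thesis using t(1) unfolding step_def by blast
  qed
  \<comment> \<open>Taking the least level turns the step into a definable function, as the
    iteration requires.\<close>
  define G where "G s = (THE t. least_lev (step s) t)" for s
  have ex1: "\<exists>!t. least_lev (step s) t" for s
    using step_ex[of s] least_lev_exists[OF df_step[OF dt_const dt_var]] least_lev_unique by blast
  have G: "least_lev (step s) (G s)" for s
    unfolding G_def by (rule theI') (rule ex1)
  have G_iff: "t = G s \<longleftrightarrow> least_lev (step s) t" for s t
    using G least_lev_unique by blast
  have dt_G: "dt (\<lambda>e. G (e 0))"
    unfolding dt_def G_iff least_lev_def by (intro df_intros df_lev df_step)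
  obtain s0 where s0: "lev s0" "sub (upair p p) s0" using sub_level by blast
  obtain S where S: "s0 \<epsilon> S" "\<And>s. s \<epsilon> S \<Longrightarrow> G s \<epsilon> S" using closure_set[OF dt_G] by blast
  \<comment> \<open>\<open>S\<close> is known to be closed under \<open>G\<close> but may contain
    sets that are not levels; these are discarded.\<close>
  obtain S' where S': "\<And>s. s \<epsilon> S' \<longleftrightarrow> s \<epsilon> S \<and> lev s"
    using separation_set[OF df_lev[OF dt_var], of S] unfolding is_set_def by blast
  have next_lev: "\<exists>t. t \<epsilon> S' \<and> step s t" if "s \<epsilon> S'" for s
    using G[of s] S(2) that unfolding S' least_lev_def by blast
  define B where "B = Uni S'"
  have mem_B: "x \<epsilon> B \<longleftrightarrow> (\<exists>s. x \<epsilon> s \<and> s \<epsilon> S')" for x unfolding B_def by (rule mem_Uni)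
  have lev_S': "lev s" if "s \<epsilon> S'" for s using that S' by blast
  have in_B: "x \<epsilon> B" if x: "sub x s" "s \<epsilon> S'" for x s
  proof -
    \<comment> \<open>A subset of \<open>s\<close> is an element of the next level, because
      \<open>s\<close> itself is.\<close>
    obtain t where t: "t \<epsilon> S'" "step s t" using next_lev[OF x(2)] by blast
    then have "x \<epsilon> t" using lev_mem_sub[OF lev_S'] x(1) unfolding step_def by blast
    then show ?thesis using t(1) mem_B by blast
  qed
  have "tr B"
    using lev_tr[OF lev_S'] unfolding tr_def mem_B by blast
  moreover have "y \<epsilon> B" if "x \<epsilon> B" "sub y x" for x y
    using that lev_mem_sub[OF lev_S'] unfolding mem_B by blast
  moreover have "upair x y \<epsilon> B" if xy: "x \<epsilon> B" "y \<epsilon> B" for x y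
  proof -
    obtain s where s: "x \<epsilon> s" "s \<epsilon> S'" using xy(1) unfolding mem_B by blast
    obtain t where t: "y \<epsilon> t" "t \<epsilon> S'" using xy(2) unfolding mem_B by blast
    from s t have linear: "s \<epsilon> t \<or> s = t \<or> t \<epsilon> s" "tr s" "tr t"
      by (simp_all add: lev_linear lev_tr lev_S')
    obtain u where "u \<epsilon> S'" "x \<epsilon> u" "y \<epsilon> u"
    proof (cases "s \<epsilon> t")
      case True
      then have "x \<epsilon> t" using linear(3) s(1) unfolding tr_def by blast
      then show ?thesis using that[OF t(2)] t(1) by simp
    next
      case False
      then have "y \<epsilon> s" using linear(1,2) t(1) unfolding tr_def by blast
      then show ?thesis using that[OF s(2) s(1)] by simp
    qed
    then show ?thesis by (intro in_B[of _ u]) (auto simp: sub_def)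
  qed
  moreover have "Pw x \<epsilon> B" if x: "x \<epsilon> B" for x
  proof -
    obtain s where s: "x \<epsilon> s" "s \<epsilon> S'" using x unfolding mem_B by blast
    have "u \<epsilon> s" if "u \<epsilon> Pw x" for u
      by (rule lev_mem_sub[OF lev_S'[OF s(2)] s(1)]) (use that in \<open>simp add: sub_def\<close>)
    then show ?thesis using s(2) by (intro in_B[of _ s]) (simp_all add: sub_def)
  qed
  moreover have "Uni x \<epsilon> B" if x: "x \<epsilon> B" for x
  proof -
    obtain s where s: "x \<epsilon> s" "s \<epsilon> S'" using x unfolding mem_B by blast
    then have "tr s" using lev_tr[OF lev_S'] by blast
    then have "sub (Uni x) s" using s(1) unfolding tr_def sub_def mem_Uni by blast
    then show ?thesis using s(2) by (rule in_B)
  qed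
  ultimately have "limit_level B" unfolding limit_level_def by blast
  moreover have "p \<epsilon> B" using s0 S(1) unfolding mem_B S' sub_def by auto
  moreover have "\<exists>y. y \<epsilon> B \<and> R x y" if R: "R \<in> \<R>" "x \<epsilon> B" "\<exists>y. R x y" for R x
  proof -
    obtain s where "x \<epsilon> s" "s \<epsilon> S'" using R(2) unfolding mem_B by blast
    moreover obtain t where "t \<epsilon> S'" "step s t" using next_lev calculation by blast
    ultimately obtain y where "y \<epsilon> t" "R x y" using R unfolding step_def by blast
    then show ?thesis using \<open>t \<epsilon> S'\<close> mem_B by blast
  qed
  ultimately show ?thesis by blast
qed

section \<open>Sets satisfying a fragment of ZFC\<close>

abbreviation elems :: "'a \<Rightarrow> 'a set" where
  "elems B \<equiv> {x. x \<epsilon> B}"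

text \<open>Besides giving absoluteness, the conditions on parameters and free variables yield the
  syntactic requirements on the final \<open>\<sigma>\<close>.\<close>

definition d0 :: "nat \<Rightarrow> ((nat \<Rightarrow> 'a) \<Rightarrow> bool) \<Rightarrow> bool" where
  "d0 n P \<longleftrightarrow> (\<exists>\<phi>. delta0 \<phi> \<and> params \<phi> = {} \<and> fv \<phi> \<subseteq> {..<n} \<and> (\<forall>e. sat E e \<phi> \<longleftrightarrow> P e))"

lemma d0_mem: "i < n \<Longrightarrow> j < n \<Longrightarrow> d0 n (\<lambda>e. e i \<epsilon> e j)"
  unfolding d0_def by (rule exI[of _ "Var i \<^bold>\<in> Var j"]) (simp add: delta0.intros)

lemma d0_eq: "i < n \<Longrightarrow> j < n \<Longrightarrow> d0 n (\<lambda>e. e i = e j)"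
  unfolding d0_def by (rule exI[of _ "Var i \<^bold>= Var j"]) (simp add: delta0.intros)

lemma d0_imp: "d0 n P \<Longrightarrow> d0 n Q \<Longrightarrow> d0 n (\<lambda>e. P e \<longrightarrow> Q e)"
  unfolding d0_def
proof (elim exE conjE)
  fix \<phi> \<psi> assume "delta0 \<phi>" "delta0 \<psi>" "params \<phi> = {}" "params \<psi> = {}" "fv \<phi> \<subseteq> {..<n}" "fv \<psi> \<subseteq> {..<n}"
    "\<forall>e. sat E e \<phi> \<longleftrightarrow> P e" "\<forall>e. sat E e \<psi> \<longleftrightarrow> Q e"
  then show "\<exists>\<phi>. delta0 \<phi> \<and> params \<phi> = {} \<and> fv \<phi> \<subseteq> {..<n} \<and> (\<forall>e. sat E e \<phi> \<longleftrightarrow> P e \<longrightarrow> Q e)"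
    by (intro exI[of _ "\<phi> \<^bold>\<longrightarrow> \<psi>"]) (simp add: delta0.intros)
qed

lemma d0_False: "d0 n (\<lambda>e. False)"
  unfolding d0_def by (rule exI[of _ Bot]) (simp add: delta0.intros)

lemma d0_not: "d0 n P \<Longrightarrow> d0 n (\<lambda>e. \<not> P e)"
  using d0_imp[OF _ d0_False, of n P] by simp

lemma d0_conj: "d0 n P \<Longrightarrow> d0 n Q \<Longrightarrow> d0 n (\<lambda>e. P e \<and> Q e)"
  using d0_not[OF d0_imp[OF _ d0_not, of n P Q]] by simp

lemma d0_disj: "d0 n P \<Longrightarrow> d0 n Q \<Longrightarrow> d0 n (\<lambda>e. P e \<or> Q e)"
  using d0_imp[OF d0_not, of n P Q] by (simp add: disj_imp)

lemma d0_iff: "d0 n P \<Longrightarrow> d0 n Q \<Longrightarrow> d0 n (\<lambda>e. P e \<longleftrightarrow> Q e)"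
  using d0_conj[OF d0_imp d0_imp, of n P Q Q P] by (simp add: iff_conv_conj_imp)

lemma d0_ball:
  assumes "d0 (Suc n) (\<lambda>e. Q (\<lambda>i. e (Suc i)) (e 0))" "i < n"
  shows "d0 n (\<lambda>e. \<forall>x\<in>elems (e i). Q e x)"
proof -
  obtain \<phi> where \<phi>: "delta0 \<phi>" "params \<phi> = {}" "fv \<phi> \<subseteq> {..<Suc n}"
    "\<And>e. sat E e \<phi> \<longleftrightarrow> Q (\<lambda>i. e (Suc i)) (e 0)" using assms(1) unfolding d0_def by blast
  have "delta0 (Forall (Var 0 \<^bold>\<in> lift_tm (Var i) \<^bold>\<longrightarrow> \<phi>))" using \<phi>(1) by (rule delta0.intros)
  then show ?thesis unfolding d0_def using \<phi>(2-4) assms(2)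
    by (intro exI[of _ "Forall (Var 0 \<^bold>\<in> lift_tm (Var i) \<^bold>\<longrightarrow> \<phi>)"]) auto
qed

lemma d0_bex:
  assumes "d0 (Suc n) (\<lambda>e. Q (\<lambda>i. e (Suc i)) (e 0))" "i < n"
  shows "d0 n (\<lambda>e. \<exists>x\<in>elems (e i). Q e x)"
  using d0_not[OF d0_ball[OF d0_not[OF assms(1)] assms(2)]] by simp

lemmas d0_intros = d0_not d0_conj d0_disj d0_imp d0_iff d0_ball d0_bex d0_mem d0_eq d0_False

lemma d0_df: "d0 n P \<Longrightarrow> df P"
  unfolding d0_def df_def by blast

lemma d0_absolute:
  assumes "d0 n P"
  obtains \<phi> where "delta0 \<phi>" "params \<phi> = {}" "fv \<phi> \<subseteq> {..<n}" "\<And>e. sat E e \<phi> \<longleftrightarrow> P e"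
    "\<And>D e. transitive_in E D \<Longrightarrow> range e \<subseteq> D \<Longrightarrow> satI E D (\<lambda>c. c) e \<phi> \<longleftrightarrow> P e"
proof -
  obtain \<phi> where \<phi>: "delta0 \<phi>" "params \<phi> = {}" "fv \<phi> \<subseteq> {..<n}" "\<And>e. sat E e \<phi> \<longleftrightarrow> P e"
    using assms unfolding d0_def by blast
  have "satI E D (\<lambda>c. c) e \<phi> \<longleftrightarrow> P e" if "transitive_in E D" "range e \<subseteq> D" for D e
    using delta0_absolute[OF \<phi>(1) that] \<phi>(2,4) by simp
  with \<phi> show ?thesis using that by blast
qed

text \<open>Relative to a set, all quantifiers of a fixed formula become bounded by that set. The
  map \<open>r\<close> tells at which places of the outer assignment the variables of
  \<open>\<phi>\<close> are found, and it shifts with each binder.\<close>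

lemma d0_satI:
  assumes "params \<phi> = {}" "i < n" "\<And>j. j \<in> fv \<phi> \<Longrightarrow> r j < n"
  shows "d0 n (\<lambda>e. satI E (elems (e i)) (\<lambda>c. c) (\<lambda>j. e (r j)) \<phi>)"
  using assms
proof (induction \<phi> arbitrary: n i r)
  case Bot
  then show ?case by (simp add: d0_False)
next
  case (Mem s t)
  then show ?case by (cases s; cases t) (auto intro: d0_mem)
next
  case (Eq s t)
  then show ?case by (cases s; cases t) (auto intro: d0_eq)
next
  case (Imp \<phi> \<psi>)
  then show ?case by (auto intro!: d0_imp)
next
  case (Forall \<phi>)
  have "d0 (Suc n) (\<lambda>e. satI E (elems (e (Suc i))) (\<lambda>c. c) (\<lambda>j. e (case_nat 0 (\<lambda>j. Suc (r j)) j)) \<phi>)"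
    by (rule Forall.IH) (use Forall.prems in \<open>auto split: nat.split\<close>)
  moreover have "(\<lambda>j. e (case_nat 0 (\<lambda>j. Suc (r j)) j)) = case_nat (e 0) (\<lambda>j. e (Suc (r j)))" for e :: "nat \<Rightarrow> 'a"
    by (rule HOL.ext) (auto split: nat.split)
  ultimately have "d0 (Suc n) (\<lambda>e. satI E (elems (e (Suc i))) (\<lambda>c. c) (case_nat (e 0) (\<lambda>j. e (Suc (r j)))) \<phi>)"
    by simp
  from d0_ball[where Q = "\<lambda>e a. satI E (elems (e i)) (\<lambda>c. c) (case_nat a (\<lambda>j. e (r j))) \<phi>", OF this Forall.prems(2)]
  show ?case by (simp only: satI.simps)
qed

text \<open>Kuratowski's pair, with all quantifiers bounded by \<open>q\<close> and its elements:
  \<open>pr\<close> is not a term of the language, and this form may occur in Delta_0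
  formulas.\<close>

definition is_pr :: "'a \<Rightarrow> 'a \<Rightarrow> 'a \<Rightarrow> bool" where
  "is_pr q x y \<longleftrightarrow> (\<exists>u\<in>elems q. \<exists>v\<in>elems q. (x \<epsilon> u \<and> (\<forall>t\<in>elems u. t = x)) \<and>
    (x \<epsilon> v \<and> y \<epsilon> v \<and> (\<forall>t\<in>elems v. t = x \<or> t = y)) \<and> (\<forall>t\<in>elems q. t = u \<or> t = v))"

lemma is_pr_iff: "is_pr q x y \<longleftrightarrow> q = pr x y"
proof
  assume "is_pr q x y"
  then obtain u v where q: "u \<epsilon> q" "v \<epsilon> q" "\<forall>t\<in>elems q. t = u \<or> t = v"
    and u: "x \<epsilon> u" "\<forall>t\<in>elems u. t = x" and v: "x \<epsilon> v" "y \<epsilon> v" "\<forall>t\<in>elems v. t = x \<or> t = y"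
    unfolding is_pr_def by blast
  have "u = upair x x" by (rule ext, unfold mem_upair) (use u in blast)
  moreover have "v = upair x y" by (rule ext, unfold mem_upair) (use v in blast)
  moreover have "q = upair u v" by (rule ext, unfold mem_upair) (use q in blast)
  ultimately show "q = pr x y" unfolding pr_def by simp
next
  assume "q = pr x y"
  then show "is_pr q x y" unfolding is_pr_def pr_def
    by (intro bexI[of _ "upair x x"] bexI[of _ "upair x y"]) simp_all
qed

definition memp :: "'a \<Rightarrow> 'a \<Rightarrow> 'a \<Rightarrow> bool" where
  "memp F x y \<longleftrightarrow> (\<exists>q\<in>elems F. is_pr q x y)"

lemma memp_iff: "memp F x y \<longleftrightarrow> pr x y \<epsilon> F"
  by (auto simp: memp_def is_pr_iff)

lemma d0_is_pr: "i < n \<Longrightarrow> j < n \<Longrightarrow> k < n \<Longrightarrow> d0 n (\<lambda>e. is_pr (e i) (e j) (e k))"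
  unfolding is_pr_def by (intro d0_intros) simp_all

lemma d0_memp: "i < n \<Longrightarrow> j < n \<Longrightarrow> k < n \<Longrightarrow> d0 n (\<lambda>e. memp (e i) (e j) (e k))"
  unfolding memp_def by (intro d0_intros d0_is_pr) simp_all

text \<open>
  A relation on \<open>B\<close> is coded as a subset of \<open>B\<close>, the tuple \<open>(x\<^sub>0, x\<^sub>1, \<dots>, w)\<close> being the iterated pair
  \<open>pr x\<^sub>0 (pr x\<^sub>1 (\<dots> w))\<close>. The operations below generate all first-order definable relations.
\<close>

definition is_Eps :: "'a \<Rightarrow> 'a \<Rightarrow> bool" where
  "is_Eps B Y \<longleftrightarrow> (\<forall>x\<in>elems B. \<forall>y\<in>elems B. \<forall>w\<in>elems B. \<forall>v\<in>elems B.
    is_pr v y w \<longrightarrow> (memp Y x v \<longleftrightarrow> x \<epsilon> y))"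

definition is_Id :: "'a \<Rightarrow> 'a \<Rightarrow> bool" where
  "is_Id B Y \<longleftrightarrow> (\<forall>x\<in>elems B. \<forall>y\<in>elems B. \<forall>w\<in>elems B. \<forall>v\<in>elems B.
    is_pr v y w \<longrightarrow> (memp Y x v \<longleftrightarrow> x = y))"

definition is_Bot :: "'a \<Rightarrow> 'a \<Rightarrow> bool" where
  "is_Bot B Y \<longleftrightarrow> (\<forall>w\<in>elems B. \<not> w \<epsilon> Y)"

definition is_Weak :: "'a \<Rightarrow> 'a \<Rightarrow> 'a \<Rightarrow> bool" where
  "is_Weak B X Y \<longleftrightarrow> (\<forall>x\<in>elems B. \<forall>w\<in>elems B. memp Y x w \<longleftrightarrow> w \<epsilon> X)"

definition is_Swap :: "'a \<Rightarrow> 'a \<Rightarrow> 'a \<Rightarrow> bool" where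
  "is_Swap B X Y \<longleftrightarrow> (\<forall>x\<in>elems B. \<forall>y\<in>elems B. \<forall>w\<in>elems B. \<forall>v\<in>elems B. \<forall>v'\<in>elems B.
    is_pr v y w \<longrightarrow> is_pr v' x w \<longrightarrow> (memp Y x v \<longleftrightarrow> memp X y v'))"

definition is_All :: "'a \<Rightarrow> 'a \<Rightarrow> 'a \<Rightarrow> bool" where
  "is_All B X Y \<longleftrightarrow> (\<forall>w\<in>elems B. w \<epsilon> Y \<longleftrightarrow> (\<forall>a\<in>elems B. memp X a w))"

definition is_Imp :: "'a \<Rightarrow> 'a \<Rightarrow> 'a \<Rightarrow> 'a \<Rightarrow> bool" where
  "is_Imp B X Z Y \<longleftrightarrow> (\<forall>w\<in>elems B. w \<epsilon> Y \<longleftrightarrow> (w \<epsilon> X \<longrightarrow> w \<epsilon> Z))"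

text \<open>One tuple \<open>w\<close> carries the parameters of an instance, so a single bounded
  quantifier does the work of a universal closure of any length.\<close>

definition separates :: "'a \<Rightarrow> 'a \<Rightarrow> bool" where
  "separates B X \<longleftrightarrow> (\<forall>w\<in>elems B. \<forall>a\<in>elems B. \<exists>b\<in>elems B. \<forall>z\<in>elems B. z \<epsilon> b \<longleftrightarrow> z \<epsilon> a \<and> memp X z w)"

definition replaces :: "'a \<Rightarrow> 'a \<Rightarrow> bool" where
  "replaces B X \<longleftrightarrow> (\<forall>w\<in>elems B. \<forall>a\<in>elems B.
    (\<forall>x\<in>elems B. \<forall>y\<in>elems B. \<forall>z\<in>elems B. \<forall>v\<in>elems B. \<forall>v'\<in>elems B.
      is_pr v y w \<longrightarrow> is_pr v' z w \<longrightarrow> memp X x v \<longrightarrow> memp X x v' \<longrightarrow> y = z) \<longrightarrow>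
    (\<exists>b\<in>elems B. \<forall>y\<in>elems B. y \<epsilon> b \<longleftrightarrow>
      (\<exists>x\<in>elems B. x \<epsilon> a \<and> (\<exists>v\<in>elems B. is_pr v y w \<and> memp X x v))))"

definition single_axioms :: "'a fm set" where
  "single_axioms = {extensionality, foundation, pairing, union_set, power_set, infinity, choice}"

text \<open>
  \<open>C k B F U\<close> says that \<open>B\<close> satisfies the fragment of ZFC of complexity \<open>k\<close>: the pairs
  \<open>pr i X \<in> F\<close> list definable relations \<open>X \<in> U\<close> of rank \<open>i \<in> k\<close>, and the schemes hold for them.
\<close>

definition C :: "'a \<Rightarrow> 'a \<Rightarrow> 'a \<Rightarrow> 'a \<Rightarrow> bool" where
  "C k B F U \<longleftrightarrow>
    (\<forall>x\<in>elems B. \<forall>y\<in>elems x. y \<epsilon> B) \<and>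
    (\<forall>x\<in>elems B. \<forall>y\<in>elems B. \<exists>z\<in>elems B. is_pr z x y) \<and>
    (\<forall>\<phi>\<in>single_axioms. satI E (elems B) (\<lambda>c. c) (\<lambda>_. B) \<phi>) \<and>
    (\<forall>i\<in>elems k.
      (\<exists>Y\<in>elems U. memp F i Y \<and> is_Eps B Y) \<and>
      (\<exists>Y\<in>elems U. memp F i Y \<and> is_Id B Y) \<and>
      (\<exists>Y\<in>elems U. memp F i Y \<and> is_Bot B Y) \<and>
      (\<forall>j\<in>elems k. j \<epsilon> i \<longrightarrow> (\<forall>X\<in>elems U. memp F j X \<longrightarrow>
        (\<exists>Y\<in>elems U. memp F i Y \<and> is_Weak B X Y) \<and>
        (\<exists>Y\<in>elems U. memp F i Y \<and> is_Swap B X Y) \<and>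
        (\<exists>Y\<in>elems U. memp F i Y \<and> is_All B X Y) \<and>
        (\<forall>Z\<in>elems U. memp F j Z \<longrightarrow> (\<exists>Y\<in>elems U. memp F i Y \<and> is_Imp B X Z Y)))) \<and>
      (\<forall>X\<in>elems U. memp F i X \<longrightarrow> separates B X \<and> replaces B X))"

lemma finite_single_axioms: "finite single_axioms"
  by (simp add: single_axioms_def)

lemma single_axioms_closed: "\<phi> \<in> single_axioms \<Longrightarrow> params \<phi> = {} \<and> fv \<phi> = {}"
  unfolding single_axioms_def
  by (auto simp: extensionality_def foundation_def pairing_def union_set_def power_set_def infinity_def
      choice_def subset_fm_def inductive_fm_def empty_fm_def succ_fm_def numeral_2_eq_2 numeral_3_eq_3 less_Suc_eq)

lemma d0_ball_finite: "finite A \<Longrightarrow> (\<And>R. R \<in> A \<Longrightarrow> d0 n (P R)) \<Longrightarrow> d0 n (\<lambda>e. \<forall>R\<in>A. P R e)"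
proof (induction rule: finite_induct)
  case empty
  then show ?case using d0_not[OF d0_False] by simp
next
  case (insert x A)
  then show ?case using d0_conj[of n "P x" "\<lambda>e. \<forall>R\<in>A. P R e"] by simp
qed

text \<open>All quantifiers in \<open>C\<close> are bounded by its arguments or by elements of them.
  The argument \<open>U\<close> bounds the quantifiers over listed relations, which would otherwise
  have to be sought inside the pairs in \<open>F\<close>.\<close>

lemma d0_C:
  assumes "i1 < n" "i2 < n" "i3 < n" "i4 < n"
  shows "d0 n (\<lambda>e. C (e i1) (e i2) (e i3) (e i4))"
proof -
  have "d0 n (\<lambda>e. \<forall>\<phi>\<in>single_axioms. satI E (elems (e i2)) (\<lambda>c. c) (\<lambda>_. e i2) \<phi>)"
    by (intro d0_ball_finite finite_single_axioms d0_satI[where r = "\<lambda>_. i2"])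
      (use single_axioms_closed assms in auto)
  then show ?thesis
    unfolding C_def is_Eps_def is_Id_def is_Bot_def is_Weak_def is_Swap_def is_All_def is_Imp_def
      separates_def replaces_def
    by (intro d0_intros d0_is_pr d0_memp) (use assms in simp_all)
qed

section \<open>Fragments contain all of ZFC\<close>

lemma C_tr: "C k B F U \<Longrightarrow> x \<epsilon> B \<Longrightarrow> y \<epsilon> x \<Longrightarrow> y \<epsilon> B"
  unfolding C_def by blast

lemma C_pr: "C k B F U \<Longrightarrow> x \<epsilon> B \<Longrightarrow> y \<epsilon> B \<Longrightarrow> pr x y \<epsilon> B"
  unfolding C_def is_pr_iff by blast

lemma C_rank:
  assumes "C k B F U" "i \<epsilon> k"
  shows "\<exists>Y. Y \<epsilon> U \<and> memp F i Y \<and> is_Eps B Y"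
    "\<exists>Y. Y \<epsilon> U \<and> memp F i Y \<and> is_Id B Y"
    "\<exists>Y. Y \<epsilon> U \<and> memp F i Y \<and> is_Bot B Y"
    "X \<epsilon> U \<Longrightarrow> memp F i X \<Longrightarrow> separates B X \<and> replaces B X"
  using assms unfolding C_def by blast+

lemma C_step:
  assumes "C k B F U" "i \<epsilon> k" "j \<epsilon> k" "j \<epsilon> i" "X \<epsilon> U" "memp F j X"
  shows "\<exists>Y. Y \<epsilon> U \<and> memp F i Y \<and> is_Weak B X Y"
    "\<exists>Y. Y \<epsilon> U \<and> memp F i Y \<and> is_Swap B X Y"
    "\<exists>Y. Y \<epsilon> U \<and> memp F i Y \<and> is_All B X Y"
    "Z \<epsilon> U \<Longrightarrow> memp F j Z \<Longrightarrow> \<exists>Y. Y \<epsilon> U \<and> memp F i Y \<and> is_Imp B X Z Y"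
proof -
  have "\<forall>X\<in>elems U. memp F j X \<longrightarrow>
        (\<exists>Y\<in>elems U. memp F i Y \<and> is_Weak B X Y) \<and>
        (\<exists>Y\<in>elems U. memp F i Y \<and> is_Swap B X Y) \<and>
        (\<exists>Y\<in>elems U. memp F i Y \<and> is_All B X Y) \<and>
        (\<forall>Z\<in>elems U. memp F j Z \<longrightarrow> (\<exists>Y\<in>elems U. memp F i Y \<and> is_Imp B X Z Y))"
    using assms(1-4) unfolding C_def by blast
  then show "\<exists>Y. Y \<epsilon> U \<and> memp F i Y \<and> is_Weak B X Y"
    "\<exists>Y. Y \<epsilon> U \<and> memp F i Y \<and> is_Swap B X Y"
    "\<exists>Y. Y \<epsilon> U \<and> memp F i Y \<and> is_All B X Y"
    "Z \<epsilon> U \<Longrightarrow> memp F j Z \<Longrightarrow> \<exists>Y. Y \<epsilon> U \<and> memp F i Y \<and> is_Imp B X Z Y"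
    using assms(5,6) by auto
qed

text \<open>The tail beyond the first \<open>l\<close> entries is an arbitrary element of
  \<open>B\<close>; it ends the iterated pair and leaves the values of \<open>e\<close> from
  \<open>l\<close> on unconstrained.\<close>

primrec codes :: "'a \<Rightarrow> nat \<Rightarrow> 'a \<Rightarrow> (nat \<Rightarrow> 'a) \<Rightarrow> bool" where
  "codes B 0 w e \<longleftrightarrow> w \<epsilon> B"
| "codes B (Suc l) w e \<longleftrightarrow> e 0 \<epsilon> B \<and> (\<exists>w'. w = pr (e 0) w' \<and> codes B l w' (\<lambda>i. e (Suc i)))"

lemma codes_mem: "C k B F U \<Longrightarrow> codes B l w e \<Longrightarrow> w \<epsilon> B"
  by (induction l arbitrary: w e) (auto intro: C_pr)

lemma codes_exists:
  assumes "C k B F U" "range e \<subseteq> elems B"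
  shows "\<exists>w. codes B l w e"
  using assms(2)
proof (induction l arbitrary: e)
  case 0
  then show ?case by auto
next
  case (Suc l)
  have "range (\<lambda>i. e (Suc i)) \<subseteq> elems B" using Suc.prems by auto
  then obtain w where "codes B l w (\<lambda>i. e (Suc i))" using Suc.IH by blast
  moreover have "e 0 \<epsilon> B" using Suc.prems by auto
  ultimately show ?case by auto
qed

definition represents :: "'a \<Rightarrow> nat \<Rightarrow> 'a \<Rightarrow> ((nat \<Rightarrow> 'a) \<Rightarrow> bool) \<Rightarrow> bool" where
  "represents B l X P \<longleftrightarrow> (\<forall>w e. codes B l w e \<longrightarrow> (w \<epsilon> X \<longleftrightarrow> P e))"

text \<open>One rank \<open>d\<close> of the metatheory must do for all fragments, also for
  nonstandard \<open>k\<close>. All ranks from \<open>d\<close> on are demanded because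
  \<open>C\<close> does not ask that a relation listed at one rank be listed again at later ranks,
  and two relations must meet at a common rank to be combined.\<close>

definition definable :: "nat \<Rightarrow> ('a \<Rightarrow> (nat \<Rightarrow> 'a) \<Rightarrow> bool) \<Rightarrow> bool" where
  "definable l P \<longleftrightarrow> (\<exists>d. \<forall>i\<ge>d. \<forall>k B F U. C k B F U \<longrightarrow> (\<forall>i'\<le>i. num i' \<epsilon> k) \<longrightarrow>
    (\<exists>X. X \<epsilon> U \<and> memp F (num i) X \<and> represents B l X (P B)))"

lemma definable_basic:
  assumes "\<And>k B F U i. C k B F U \<Longrightarrow> i \<epsilon> k \<Longrightarrow> \<exists>X. X \<epsilon> U \<and> memp F i X \<and> represents B l X (P B)"
  shows "definable l P"
  unfolding definable_def using assms by blast

lemma definable_step: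
  assumes "definable l P"
    "\<And>k B F U i j X. C k B F U \<Longrightarrow> i \<epsilon> k \<Longrightarrow> j \<epsilon> k \<Longrightarrow> j \<epsilon> i \<Longrightarrow> X \<epsilon> U \<Longrightarrow> memp F j X \<Longrightarrow> represents B l X (P B) \<Longrightarrow>
      \<exists>Y. Y \<epsilon> U \<and> memp F i Y \<and> represents B l' Y (Q B)"
  shows "definable l' Q"
proof -
  obtain d where d: "\<And>i k B F U. d \<le> i \<Longrightarrow> C k B F U \<Longrightarrow> \<forall>i'\<le>i. num i' \<epsilon> k \<Longrightarrow>
    \<exists>X. X \<epsilon> U \<and> memp F (num i) X \<and> represents B l X (P B)"
    using assms(1) unfolding definable_def by blast
  show ?thesis
    unfolding definable_def
  proof (intro exI[of _ "Suc d"] allI impI)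
    fix i k B F U assume i: "Suc d \<le> i" and C: "C k B F U" and k: "\<forall>i'\<le>i. num i' \<epsilon> k"
    then obtain j where j: "i = Suc j" "d \<le> j" by (cases i) auto
    obtain X where X: "X \<epsilon> U" "memp F (num j) X" "represents B l X (P B)"
      using d[OF j(2) C] k j(1) by auto
    show "\<exists>Y. Y \<epsilon> U \<and> memp F (num i) Y \<and> represents B l' Y (Q B)"
      by (rule assms(2)[OF C _ _ _ X]) (use k j(1) in \<open>auto simp: num_mem_num\<close>)
  qed
qed

lemma definable_Eps: "definable (Suc (Suc l)) (\<lambda>B e. e 0 \<epsilon> e 1)"
proof (rule definable_basic)
  fix k B F U i assume C: "C k B F U" and "i \<epsilon> k"
  then obtain Y where Y: "Y \<epsilon> U" "memp F i Y" "is_Eps B Y" using C_rank(1) by blast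
  have "represents B (Suc (Suc l)) Y (\<lambda>e. e 0 \<epsilon> e 1)"
    using Y(3) codes_mem[OF C] C_pr[OF C] by (auto simp: represents_def is_Eps_def is_pr_iff memp_iff)
  then show "\<exists>X. X \<epsilon> U \<and> memp F i X \<and> represents B (Suc (Suc l)) X (\<lambda>e. e 0 \<epsilon> e 1)" using Y by blast
qed

lemma definable_Id: "definable (Suc (Suc l)) (\<lambda>B e. e 0 = e 1)"
proof (rule definable_basic)
  fix k B F U i assume C: "C k B F U" and "i \<epsilon> k"
  then obtain Y where Y: "Y \<epsilon> U" "memp F i Y" "is_Id B Y" using C_rank(2) by blast
  have "represents B (Suc (Suc l)) Y (\<lambda>e. e 0 = e 1)"
    using Y(3) codes_mem[OF C] C_pr[OF C] by (auto simp: represents_def is_Id_def is_pr_iff memp_iff)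
  then show "\<exists>X. X \<epsilon> U \<and> memp F i X \<and> represents B (Suc (Suc l)) X (\<lambda>e. e 0 = e 1)" using Y by blast
qed

lemma definable_False: "definable l (\<lambda>B e. False)"
proof (rule definable_basic)
  fix k B F U i assume C: "C k B F U" and "i \<epsilon> k"
  then obtain Y where Y: "Y \<epsilon> U" "memp F i Y" "is_Bot B Y" using C_rank(3) by blast
  have "represents B l Y (\<lambda>e. False)"
    using Y(3) codes_mem[OF C] by (auto simp: represents_def is_Bot_def)
  then show "\<exists>X. X \<epsilon> U \<and> memp F i X \<and> represents B l X (\<lambda>e. False)" using Y by blast
qed

lemma definable_Weak: "definable l P \<Longrightarrow> definable (Suc l) (\<lambda>B e. P B (\<lambda>i. e (Suc i)))"
proof (erule definable_step)
  fix k B F U i j X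
  assume C: "C k B F U" and "i \<epsilon> k" "j \<epsilon> k" "j \<epsilon> i" "X \<epsilon> U" "memp F j X" and X: "represents B l X (P B)"
  then obtain Y where Y: "Y \<epsilon> U" "memp F i Y" "is_Weak B X Y" using C_step(1) by blast
  have "represents B (Suc l) Y (\<lambda>e. P B (\<lambda>i. e (Suc i)))"
    using Y(3) X codes_mem[OF C] by (auto simp: represents_def is_Weak_def memp_iff)
  then show "\<exists>Y. Y \<epsilon> U \<and> memp F i Y \<and> represents B (Suc l) Y (\<lambda>e. P B (\<lambda>i. e (Suc i)))" using Y by blast
qed

definition swap :: "(nat \<Rightarrow> 'b) \<Rightarrow> nat \<Rightarrow> 'b" where
  "swap e = case_nat (e 1) (case_nat (e 0) (\<lambda>i. e (Suc (Suc i))))"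

lemma swap_simps [simp]: "swap e 0 = e 1" "swap e (Suc 0) = e 0" "swap e (Suc (Suc i)) = e (Suc (Suc i))"
  by (simp_all add: swap_def)

lemma definable_Swap: "definable (Suc (Suc l)) P \<Longrightarrow> definable (Suc (Suc l)) (\<lambda>B e. P B (swap e))"
proof (erule definable_step)
  fix k B F U i j X
  assume C: "C k B F U" and "i \<epsilon> k" "j \<epsilon> k" "j \<epsilon> i" "X \<epsilon> U" "memp F j X"
    and X: "represents B (Suc (Suc l)) X (P B)"
  then obtain Y where Y: "Y \<epsilon> U" "memp F i Y" "is_Swap B X Y" using C_step(2) by blast
  have "represents B (Suc (Suc l)) Y (\<lambda>e. P B (swap e))"
    unfolding represents_def
  proof (intro allI impI)
    fix w e assume w: "codes B (Suc (Suc l)) w e"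
    then obtain w' where w': "w = pr (e 0) (pr (e 1) w')" "e 0 \<epsilon> B" "e 1 \<epsilon> B"
      "codes B l w' (\<lambda>i. e (Suc (Suc i)))" by auto
    then have "codes B (Suc (Suc l)) (pr (e 1) (pr (e 0) w')) (swap e)" by simp
    then have "pr (e 1) (pr (e 0) w') \<epsilon> X \<longleftrightarrow> P B (swap e)" using X unfolding represents_def by blast
    moreover have "w \<epsilon> Y \<longleftrightarrow> pr (e 1) (pr (e 0) w') \<epsilon> X"
      using Y(3) w'(2,3) codes_mem[OF C w'(4)] C_pr[OF C] unfolding w'(1) is_Swap_def is_pr_iff memp_iff
      by blast
    ultimately show "w \<epsilon> Y \<longleftrightarrow> P B (swap e)" by blast
  qed
  then show "\<exists>Y. Y \<epsilon> U \<and> memp F i Y \<and> represents B (Suc (Suc l)) Y (\<lambda>e. P B (swap e))" using Y by blast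
qed

lemma definable_All: "definable (Suc l) P \<Longrightarrow> definable l (\<lambda>B e. \<forall>a\<in>elems B. P B (case_nat a e))"
proof (erule definable_step)
  fix k B F U i j X
  assume C: "C k B F U" and "i \<epsilon> k" "j \<epsilon> k" "j \<epsilon> i" "X \<epsilon> U" "memp F j X"
    and X: "represents B (Suc l) X (P B)"
  then obtain Y where Y: "Y \<epsilon> U" "memp F i Y" "is_All B X Y" using C_step(3) by blast
  have "represents B l Y (\<lambda>e. \<forall>a\<in>elems B. P B (case_nat a e))"
    unfolding represents_def
  proof (intro allI impI)
    fix w e assume w: "codes B l w e"
    have "codes B (Suc l) (pr a w) (case_nat a e)" if "a \<epsilon> B" for a using w that by simp
    then have "pr a w \<epsilon> X \<longleftrightarrow> P B (case_nat a e)" if "a \<epsilon> B" for a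
      using X that unfolding represents_def by blast
    moreover have "w \<epsilon> Y \<longleftrightarrow> (\<forall>a\<in>elems B. pr a w \<epsilon> X)"
      using Y(3) codes_mem[OF C w] unfolding is_All_def memp_iff by blast
    ultimately show "w \<epsilon> Y \<longleftrightarrow> (\<forall>a\<in>elems B. P B (case_nat a e))" by blast
  qed
  then show "\<exists>Y. Y \<epsilon> U \<and> memp F i Y \<and> represents B l Y (\<lambda>e. \<forall>a\<in>elems B. P B (case_nat a e))" using Y by blast
qed

lemma definable_Imp:
  assumes "definable l P" "definable l Q"
  shows "definable l (\<lambda>B e. P B e \<longrightarrow> Q B e)"
proof -
  obtain d where d: "\<And>i k B F U. d \<le> i \<Longrightarrow> C k B F U \<Longrightarrow> \<forall>i'\<le>i. num i' \<epsilon> k \<Longrightarrow>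
    \<exists>X. X \<epsilon> U \<and> memp F (num i) X \<and> represents B l X (P B)"
    using assms(1) unfolding definable_def by blast
  obtain d' where d': "\<And>i k B F U. d' \<le> i \<Longrightarrow> C k B F U \<Longrightarrow> \<forall>i'\<le>i. num i' \<epsilon> k \<Longrightarrow>
    \<exists>X. X \<epsilon> U \<and> memp F (num i) X \<and> represents B l X (Q B)"
    using assms(2) unfolding definable_def by blast
  show ?thesis
    unfolding definable_def
  proof (intro exI[of _ "Suc (max d d')"] allI impI)
    fix i k B F U assume i: "Suc (max d d') \<le> i" and C: "C k B F U" and k: "\<forall>i'\<le>i. num i' \<epsilon> k"
    then obtain j where j: "i = Suc j" "d \<le> j" "d' \<le> j" by (cases i) auto
    obtain X where X: "X \<epsilon> U" "memp F (num j) X" "represents B l X (P B)"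
      using d[OF j(2) C] k j(1) by auto
    obtain Z where Z: "Z \<epsilon> U" "memp F (num j) Z" "represents B l Z (Q B)"
      using d'[OF j(3) C] k j(1) by auto
    have "num i \<epsilon> k" "num j \<epsilon> k" "num j \<epsilon> num i" using k j(1) by (auto simp: num_mem_num)
    from C_step(4)[OF C this X(1,2) Z(1,2)]
    obtain Y where Y: "Y \<epsilon> U" "memp F (num i) Y" "is_Imp B X Z Y" by blast
    have "represents B l Y (\<lambda>e. P B e \<longrightarrow> Q B e)"
      using Y(3) X(3) Z(3) codes_mem[OF C] unfolding represents_def is_Imp_def by blast
    then show "\<exists>Y. Y \<epsilon> U \<and> memp F (num i) Y \<and> represents B l Y (\<lambda>e. P B e \<longrightarrow> Q B e)" using Y by blast
  qed
qed

text \<open>Weakening raises both indices by one and a swap brings the smaller one back to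
  \<open>0\<close>, so repetition separates the indices by any distance. Further weakenings move
  both away from \<open>0\<close>. Equal indices start from the diagonal, which is a hypothesis of
  its own.\<close>

lemma definable_atomic:
  assumes "\<And>l. definable (Suc (Suc l)) (\<lambda>B e. T (e 0) (e 1))" "\<And>l. definable (Suc l) (\<lambda>B e. T (e 0) (e 0))"
  shows "i < l \<Longrightarrow> j < l \<Longrightarrow> definable l (\<lambda>B e. T (e i) (e j))"
proof -
  have right: "definable (Suc (Suc (j + l))) (\<lambda>B e. T (e 0) (e (Suc j)))" for j l
  proof (induction j arbitrary: l)
    case 0
    then show ?case using assms(1) by simp
  next
    case (Suc j)
    then show ?case using definable_Swap[OF definable_Weak[OF Suc]] by simp
  qed
  have left: "definable (Suc (Suc (j + l))) (\<lambda>B e. T (e (Suc j)) (e 0))" for j l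
  proof (induction j arbitrary: l)
    case 0
    then show ?case using definable_Swap[OF assms(1)] by simp
  next
    case (Suc j)
    then show ?case using definable_Swap[OF definable_Weak[OF Suc]] by simp
  qed
  show "i < l \<Longrightarrow> j < l \<Longrightarrow> definable l (\<lambda>B e. T (e i) (e j))"
  proof (induction l arbitrary: i j)
    case (Suc l)
    show ?case
    proof (cases i)
      case 0
      show ?thesis
      proof (cases j)
        case (Suc j')
        then obtain m where "l = Suc (j' + m)" using \<open>j < Suc l\<close> less_iff_Suc_add by auto
        then show ?thesis using right[of j' m] 0 Suc by simp
      qed (use 0 assms(2) in simp)
    next
      case i: (Suc i')
      show ?thesis
      proof (cases j)
        case 0
        obtain m where "l = Suc (i' + m)" using \<open>i < Suc l\<close> i less_iff_Suc_add by auto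
        then show ?thesis using left[of i' m] 0 i by simp
      next
        case (Suc j')
        then show ?thesis using definable_Weak[OF Suc.IH[of i' j']] Suc.prems i by simp
      qed
    qed
  qed simp
qed

text \<open>Induction on \<open>\<phi>\<close>, where each operation moves to a later rank. On the
  diagonal, membership is false by Foundation and equality is obtained as an implication between two
  falsehoods.\<close>

lemma definable_sat:
  assumes "params \<phi> = {}" "fv \<phi> \<subseteq> {..<l}"
  shows "definable l (\<lambda>B e. satI E (elems B) I e \<phi>)"
  using assms
proof (induction \<phi> arbitrary: l)
  case Bot
  then show ?case using definable_False by simp
next
  case (Mem s t)
  then obtain i j where "s = Var i" "t = Var j" by (cases s; cases t) auto
  then show ?case using Mem.prems definable_atomic[of "(\<epsilon>)" i l j] definable_Eps definable_False
    by (simp add: not_mem_self)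
next
  case (Eq s t)
  then obtain i j where "s = Var i" "t = Var j" by (cases s; cases t) auto
  then show ?case
    using Eq.prems definable_atomic[of "(=)" i l j] definable_Id definable_Imp[OF definable_False definable_False]
    by simp
next
  case (Imp \<phi> \<psi>)
  then show ?case using definable_Imp by simp
next
  case (Forall \<phi>)
  have "fv \<phi> \<subseteq> {..<Suc l}"
  proof
    fix i assume "i \<in> fv \<phi>"
    then show "i \<in> {..<Suc l}" using Forall.prems by (cases i) auto
  qed
  then show ?case using definable_All[OF Forall.IH[of "Suc l"]] Forall.prems by simp
qed

lemma finite_fv: "finite (fv \<phi>)"
proof (induction \<phi>)
  case (Mem s t)
  then show ?case by (cases s; cases t) auto
next
  case (Eq s t)
  then show ?case by (cases s; cases t) auto
next
  case (Forall \<phi>)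
  then show ?case using finite_vimageI[of "fv \<phi>" Suc] by (simp add: vimage_def)
qed auto

lemma schema_relation:
  assumes "params \<phi> = {}"
  shows "\<exists>d. \<forall>k B F U. C k B F U \<longrightarrow> (\<forall>i\<le>d. num i \<epsilon> k) \<longrightarrow>
    (\<exists>X l. separates B X \<and> replaces B X \<and> represents B (Suc (Suc l)) X (\<lambda>e. satI E (elems B) (\<lambda>c. c) e \<phi>))"
proof -
  obtain l where "fv \<phi> \<subseteq> {..<l}" using finite_fv[of \<phi>] unfolding finite_nat_set_iff_bounded by blast
  \<comment> \<open>The first two coordinates are reserved for the two variables that the schemes
    single out.\<close>
  then have "fv \<phi> \<subseteq> {..<Suc (Suc l)}" by auto
  from definable_sat[OF assms this, of "\<lambda>c. c"] obtain d where
    d: "\<And>i k B F U. i \<ge> d \<Longrightarrow> C k B F U \<Longrightarrow> \<forall>i'\<le>i. num i' \<epsilon> k \<Longrightarrow>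
    \<exists>X. X \<epsilon> U \<and> memp F (num i) X \<and> represents B (Suc (Suc l)) X (\<lambda>e. satI E (elems B) (\<lambda>c. c) e \<phi>)"
    unfolding definable_def by blast
  show ?thesis
  proof (intro exI[of _ d] allI impI)
    fix k B F U assume C: "C k B F U" and k: "\<forall>i\<le>d. num i \<epsilon> k"
    obtain X where X: "X \<epsilon> U" "memp F (num d) X"
      "represents B (Suc (Suc l)) X (\<lambda>e. satI E (elems B) (\<lambda>c. c) e \<phi>)"
      using d[OF order_refl C k] by blast
    have "num d \<epsilon> k" using k by simp
    from C_rank(4)[OF C this X(1,2)] X(3)
    show "\<exists>X l. separates B X \<and> replaces B X \<and>
      represents B (Suc (Suc l)) X (\<lambda>e. satI E (elems B) (\<lambda>c. c) e \<phi>)" by blast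
  qed
qed

lemma satI_Con: "satI E D I e (\<phi> \<^bold>\<and> \<psi>) \<longleftrightarrow> satI E D I e \<phi> \<and> satI E D I e \<psi>"
  and satI_Iff: "satI E D I e (\<phi> \<^bold>\<longleftrightarrow> \<psi>) \<longleftrightarrow> (satI E D I e \<phi> \<longleftrightarrow> satI E D I e \<psi>)"
  and satI_Exists: "satI E D I e (Exists \<phi>) \<longleftrightarrow> (\<exists>a\<in>D. satI E D I (case_nat a e) \<phi>)"
  by auto

text \<open>The bound \<open>d\<close> is standard while \<open>k\<close> may be nonstandard: what
  counts is that \<open>k\<close> contains the first \<open>d + 1\<close> standard numbers.\<close>

definition true_from :: "nat \<Rightarrow> 'a fm \<Rightarrow> bool" where
  "true_from d \<psi> \<longleftrightarrow> (\<forall>k B F U. C k B F U \<longrightarrow> (\<forall>i\<le>d. num i \<epsilon> k) \<longrightarrow>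
    (\<forall>I e. range e \<subseteq> elems B \<longrightarrow> satI E (elems B) I e \<psi>))"

lemma satI_no_params: "params \<phi> = {} \<Longrightarrow> satI E D I e \<phi> \<longleftrightarrow> satI E D (\<lambda>c. c) e \<phi>"
  by (rule satI_cong) auto

lemma fragment_separation:
  assumes \<phi>: "params \<phi> = {}"
  shows "\<exists>d. true_from d (separation \<phi>)"
proof -
  obtain d where d: "\<And>k B F U. C k B F U \<Longrightarrow> \<forall>i\<le>d. num i \<epsilon> k \<Longrightarrow>
    \<exists>X l. separates B X \<and> represents B (Suc (Suc l)) X (\<lambda>e. satI E (elems B) (\<lambda>c. c) e \<phi>)"
    using schema_relation[OF \<phi>] by meson
  show ?thesis
    unfolding true_from_def
  proof (intro exI[of _ d] allI impI)
    fix k B F U and I :: "'a \<Rightarrow> 'a" and e :: "nat \<Rightarrow> 'a"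
    assume C: "C k B F U" and k: "\<forall>i\<le>d. num i \<epsilon> k" and e: "range e \<subseteq> elems B"
    let ?\<psi> = "Forall (Exists (Forall (Var 0 \<^bold>\<in> Var 1 \<^bold>\<longleftrightarrow> Var 0 \<^bold>\<in> Var 2 \<^bold>\<and> lift_at 1 \<phi>)))"
    obtain X l where X: "separates B X"
      "represents B (Suc (Suc l)) X (\<lambda>e. satI E (elems B) (\<lambda>c. c) e \<phi>)"
      using d[OF C k] by blast
    have "satI E (elems B) I e ?\<psi>" if e: "range e \<subseteq> elems B" for e
    proof -
      define P where "P z a \<longleftrightarrow> satI E (elems B) (\<lambda>c. c) (case_nat z (case_nat a e)) \<phi>" for z a
      obtain w where w: "codes B l w e" using codes_exists[OF C e] by blast
      have "(\<lambda>i. case_nat z (case_nat b (case_nat a e)) (if i < 1 then i else Suc i)) =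
          case_nat z (case_nat a e)" for z b a
        by (rule HOL.ext) (auto split: nat.split)
      then have lift: "satI E (elems B) I (case_nat z (case_nat b (case_nat a e))) (lift_at 1 \<phi>) \<longleftrightarrow> P z a"
        for z b a
        by (simp only: P_def satI_lift_at satI_no_params[OF \<phi>, of _ I])
      have "\<exists>b\<in>elems B. \<forall>z\<in>elems B. z \<epsilon> b \<longleftrightarrow> z \<epsilon> a \<and> P z a"
        if a: "a \<epsilon> B" for a
      proof -
        have "pr z (pr a w) \<epsilon> X \<longleftrightarrow> P z a" if "z \<epsilon> B" for z
          using X(2) w a that unfolding represents_def P_def by simp
        \<comment> \<open>Index \<open>1\<close> of \<open>\<phi>\<close> is the set
          \<open>a\<close> itself, so \<open>a\<close> is put in front of the parameter
          tuple.\<close>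
        moreover have "pr a w \<epsilon> B" using C_pr[OF C a] codes_mem[OF C w] by blast
        ultimately show ?thesis using X(1) a unfolding separates_def memp_iff by auto
      qed
      then show ?thesis
        by (simp only: satI_Iff satI_Exists satI.simps(5), simp only: satI_Con lift) (simp add: numeral_2_eq_2)
    qed
    then show "satI E (elems B) I e (separation \<phi>)"
      unfolding separation_def using satI_universal_closure[of "elems B" E I ?\<psi>] e by blast
  qed
qed

lemma fragment_replacement:
  assumes \<phi>: "params \<phi> = {}"
  shows "\<exists>d. true_from d (replacement \<phi>)"
proof -
  obtain d where d: "\<And>k B F U. C k B F U \<Longrightarrow> \<forall>i\<le>d. num i \<epsilon> k \<Longrightarrow>
    \<exists>X l. replaces B X \<and> represents B (Suc (Suc l)) X (\<lambda>e. satI E (elems B) (\<lambda>c. c) e \<phi>)"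
    using schema_relation[OF \<phi>] by meson
  show ?thesis
    unfolding true_from_def
  proof (intro exI[of _ d] allI impI)
    fix k B F U and I :: "'a \<Rightarrow> 'a" and e :: "nat \<Rightarrow> 'a"
    assume C: "C k B F U" and k: "\<forall>i\<le>d. num i \<epsilon> k" and e: "range e \<subseteq> elems B"
    let ?f = "Forall (Forall (Forall (lift_at 1 \<phi> \<^bold>\<and> lift_at 2 \<phi> \<^bold>\<longrightarrow> Var 2 \<^bold>= Var 1)))"
    let ?g = "Forall (Exists (Forall (Var 0 \<^bold>\<in> Var 1 \<^bold>\<longleftrightarrow>
       Exists (Var 0 \<^bold>\<in> Var 3 \<^bold>\<and> lift_at 2 (lift_at 2 \<phi>)))))"
    obtain X l where X: "replaces B X"
      "represents B (Suc (Suc l)) X (\<lambda>e. satI E (elems B) (\<lambda>c. c) e \<phi>)"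
      using d[OF C k] by blast
    have "satI E (elems B) I e (?f \<^bold>\<longrightarrow> ?g)" if e: "range e \<subseteq> elems B" for e
    proof -
      define P where "P x y \<longleftrightarrow> satI E (elems B) (\<lambda>c. c) (case_nat x (case_nat y e)) \<phi>" for x y
      obtain w where w: "codes B l w e" using codes_exists[OF C e] by blast
      have wB: "w \<epsilon> B" using codes_mem[OF C w] .
      have P: "pr x (pr y w) \<epsilon> X \<longleftrightarrow> P x y" if "x \<epsilon> B" "y \<epsilon> B" for x y
        using X(2) w that unfolding represents_def P_def by simp
      have "(\<lambda>i. case_nat x (case_nat y (case_nat z e)) (if i < 1 then i else Suc i)) = case_nat x (case_nat z e)"
        "(\<lambda>i. case_nat x (case_nat y (case_nat z e)) (if i < 2 then i else Suc i)) = case_nat x (case_nat y e)"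
        "(\<lambda>i. (\<lambda>i. case_nat x (case_nat y (case_nat z (case_nat u e)))
          (if i < 2 then i else Suc i)) (if i < 2 then i else Suc i)) = case_nat x (case_nat y e)"
        for x y z u
        by (rule HOL.ext; auto split: nat.split)+
      then have lift:
        "satI E (elems B) I (case_nat x (case_nat y (case_nat z e))) (lift_at 1 \<phi>) \<longleftrightarrow> P x z"
        "satI E (elems B) I (case_nat x (case_nat y (case_nat z e))) (lift_at 2 \<phi>) \<longleftrightarrow> P x y"
        "satI E (elems B) I (case_nat x (case_nat y (case_nat z (case_nat u e)))) (lift_at 2 (lift_at 2 \<phi>)) \<longleftrightarrow> P x y"
        for x y z u
        by (simp_all only: P_def satI_lift_at satI_no_params[OF \<phi>, of _ I])
      show ?thesis
      proof (cases "satI E (elems B) I e ?f")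
        case True
        then have fn: "y = z" if "x \<epsilon> B" "y \<epsilon> B" "z \<epsilon> B" "P x y" "P x z" for x y z
          using that by (simp only: satI.simps lift) (auto simp: numeral_2_eq_2)
        have "\<exists>b\<in>elems B. \<forall>y\<in>elems B. y \<epsilon> b \<longleftrightarrow> (\<exists>x\<in>elems B. x \<epsilon> a \<and> P x y)" if a: "a \<epsilon> B" for a
        proof -
          have "\<exists>b\<in>elems B. \<forall>y\<in>elems B. y \<epsilon> b \<longleftrightarrow>
            (\<exists>x\<in>elems B. x \<epsilon> a \<and> (\<exists>v\<in>elems B. v = pr y w \<and> pr x v \<epsilon> X))"
            by (rule X(1)[unfolded replaces_def is_pr_iff memp_iff, rule_format, OF _ _])
              (use wB a P fn in auto)
          then show ?thesis using P C_pr[OF C _ wB] by simp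
        qed
        then have "satI E (elems B) I e ?g"
          by (simp only: satI_Iff satI_Exists satI.simps(5), simp only: satI_Con lift) (simp add: numeral_3_eq_3)
        then show ?thesis unfolding satI.simps(4)[of _ _ _ _ ?f ?g] by blast
      next
        case False
        then show ?thesis unfolding satI.simps(4)[of _ _ _ _ ?f ?g] by blast
      qed
    qed
    then show "satI E (elems B) I e (replacement \<phi>)"
      unfolding replacement_def using satI_universal_closure[of "elems B" E I "?f \<^bold>\<longrightarrow> ?g"] e by blast
  qed
qed

lemma fragment_ZFC:
  assumes "\<psi> \<in> ZFC"
  shows "\<exists>d. true_from d \<psi>"
proof (cases "\<psi> \<in> single_axioms")
  case True
  have *: "satI E (elems B) I e \<psi>" if C: "C k B F U" for k B F U and I :: "'a \<Rightarrow> 'a" and e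
  proof -
    have "\<forall>\<phi>\<in>single_axioms. satI E (elems B) (\<lambda>c. c) (\<lambda>_. B) \<phi>" using C unfolding C_def by (elim conjE)
    then have "satI E (elems B) (\<lambda>c. c) (\<lambda>_. B) \<psi>" using True by (rule bspec)
    moreover have "satI E (elems B) I e \<psi> \<longleftrightarrow> satI E (elems B) (\<lambda>c. c) (\<lambda>_. B) \<psi>"
      by (rule satI_cong) (use single_axioms_closed[OF True] in simp_all)
    ultimately show ?thesis by blast
  qed
  have "true_from 0 \<psi>" unfolding true_from_def by (intro allI impI) (rule *)
  then show ?thesis ..
next
  case False
  then consider \<phi> where "params \<phi> = {}" "\<psi> = separation \<phi>" | \<phi> where "params \<phi> = {}" "\<psi> = replacement \<phi>"
    using assms unfolding ZFC_def single_axioms_def by blast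
  then show ?thesis using fragment_separation fragment_replacement by cases auto
qed

lemma fragment_finite:
  assumes "finite Z" "Z \<subseteq> ZFC"
  shows "\<exists>d. \<forall>\<psi>\<in>Z. true_from d \<psi>"
proof -
  obtain f where f: "\<And>\<psi>. \<psi> \<in> Z \<Longrightarrow> true_from (f \<psi>) \<psi>"
    using fragment_ZFC assms(2) by (metis subsetD)
  obtain d where d: "\<And>\<psi>. \<psi> \<in> Z \<Longrightarrow> f \<psi> \<le> d"
    using finite_nat_set_iff_bounded_le[of "f ` Z"] assms(1) by auto
  have "true_from d \<psi>" if "\<psi> \<in> Z" for \<psi>
    using f[OF that] d[OF that] unfolding true_from_def by (meson order_trans)
  then show ?thesis by blast
qed

section \<open>Limit levels satisfy standard fragments\<close>

text \<open>Unfolded for an arbitrary domain, since Choice is used in the whole model and proved in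
  \<open>B\<close>.\<close>

lemma sat_choice:
  fixes I :: "'c \<Rightarrow> 'a"
  shows "satI E D I e choice \<longleftrightarrow> (\<forall>a\<in>D. (\<forall>x\<in>D. x \<epsilon> a \<longrightarrow> (\<exists>y\<in>D. y \<epsilon> x)) \<and>
    (\<forall>x\<in>D. x \<epsilon> a \<longrightarrow> (\<forall>y\<in>D. y \<epsilon> a \<longrightarrow> (\<exists>z\<in>D. z \<epsilon> x \<and> z \<epsilon> y) \<longrightarrow> x = y)) \<longrightarrow>
    (\<exists>c\<in>D. \<forall>x\<in>D. x \<epsilon> a \<longrightarrow> (\<exists>y\<in>D. \<forall>z\<in>D. z \<epsilon> x \<and> z \<epsilon> c \<longleftrightarrow> z = y)))"
proof -
  let ?A = "Forall (Var 0 \<^bold>\<in> Var 1 \<^bold>\<longrightarrow> Exists (Var 0 \<^bold>\<in> Var 1)) :: 'c fm"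
  let ?B = "Forall (Var 0 \<^bold>\<in> Var 1 \<^bold>\<longrightarrow> Forall (Var 0 \<^bold>\<in> Var 2 \<^bold>\<longrightarrow>
           Exists (Var 0 \<^bold>\<in> Var 2 \<^bold>\<and> Var 0 \<^bold>\<in> Var 1) \<^bold>\<longrightarrow> Var 1 \<^bold>= Var 0)) :: 'c fm"
  let ?T = "Var 0 \<^bold>\<in> Var 2 \<^bold>\<and> Var 0 \<^bold>\<in> Var 3 \<^bold>\<longleftrightarrow> Var 0 \<^bold>= Var 1 :: 'c fm"
  let ?G = "Exists (Forall (Var 0 \<^bold>\<in> Var 2 \<^bold>\<longrightarrow> Exists (Forall ?T))) :: 'c fm"
  have A: "satI E D I (case_nat a e) ?A \<longleftrightarrow> (\<forall>x\<in>D. x \<epsilon> a \<longrightarrow> (\<exists>y\<in>D. y \<epsilon> x))" for a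
    by simp
  have B: "satI E D I (case_nat a e) ?B \<longleftrightarrow>
      (\<forall>x\<in>D. x \<epsilon> a \<longrightarrow> (\<forall>y\<in>D. y \<epsilon> a \<longrightarrow> (\<exists>z\<in>D. z \<epsilon> x \<and> z \<epsilon> y) \<longrightarrow> x = y))" for a
    by (simp add: numeral_2_eq_2)
  have T: "satI E D I (case_nat z (case_nat y (case_nat x (case_nat c e')))) ?T \<longleftrightarrow> (z \<epsilon> x \<and> z \<epsilon> c \<longleftrightarrow> z = y)"
    for x y z c e'
    unfolding satI_Iff unfolding satI_Con by (simp add: numeral_2_eq_2 numeral_3_eq_3)
  have G: "satI E D I (case_nat a e) ?G \<longleftrightarrow>
      (\<exists>c\<in>D. \<forall>x\<in>D. x \<epsilon> a \<longrightarrow> (\<exists>y\<in>D. \<forall>z\<in>D. z \<epsilon> x \<and> z \<epsilon> c \<longleftrightarrow> z = y))" for a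
    unfolding satI_Exists satI.simps(5) satI.simps(4)[of _ _ _ _ _ "Exists (Forall ?T)"] T
    by (simp only: satI.simps(2) valI.simps nat.case numeral_2_eq_2)
  show ?thesis
    unfolding choice_def satI.simps(5) satI.simps(4)[of _ _ _ _ "?A \<^bold>\<and> ?B" ?G] satI_Con
    unfolding A[unfolded satI.simps(5)] B[unfolded satI.simps(5)] G ..
qed

lemma single_axioms_limit_level:
  assumes B: "limit_level B" "om \<epsilon> B" and \<phi>: "\<phi> \<in> single_axioms"
  shows "satI E (elems B) I e \<phi>"
proof -
  have B_tr: "y \<epsilon> B" if "x \<epsilon> B" "y \<epsilon> x" for x y
    using B(1) that unfolding limit_level_def tr_def by blast
  have B_sub: "y \<epsilon> B" if "x \<epsilon> B" "sub y x" for x y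
    using B(1) that unfolding limit_level_def by blast
  have B_ops: "upair x y \<epsilon> B" "Pw x \<epsilon> B" "Uni x \<epsilon> B" if "x \<epsilon> B" "y \<epsilon> B" for x y
    using B(1) that unfolding limit_level_def by blast+
  have "satI E (elems B) I e extensionality"
    unfolding extensionality_def satI_Iff satI.simps using B_tr
    by (auto simp: numeral_2_eq_2 intro!: ext)
  moreover have "satI E (elems B) I e foundation"
  proof -
    have "\<exists>y. y \<epsilon> B \<and> y \<epsilon> x \<and> \<not> (\<exists>z. z \<epsilon> B \<and> z \<epsilon> x \<and> z \<epsilon> y)" if "x \<epsilon> B" "y \<epsilon> x" for x y
      using foundation_true[OF that(2)] B_tr[OF that(1)] by blast
    then show ?thesis
      unfolding foundation_def satI_Exists satI_Con unfolding satI.simps by (simp add: numeral_2_eq_2) blast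
  qed
  moreover have "satI E (elems B) I e pairing"
  proof -
    have "\<exists>b. b \<epsilon> B \<and> (\<forall>z. z \<epsilon> B \<longrightarrow> (z \<epsilon> b \<longleftrightarrow> z = x \<or> z = y))" if "x \<epsilon> B" "y \<epsilon> B" for x y
      using B_ops(1)[OF that] by (intro exI[of _ "upair x y"]) simp
    then show ?thesis
      unfolding pairing_def satI.simps(5) satI_Exists satI_Iff
      by (simp add: numeral_2_eq_2 numeral_3_eq_3 disj_imp)
  qed
  moreover have "satI E (elems B) I e union_set"
  proof -
    have "\<exists>b. b \<epsilon> B \<and> (\<forall>z. z \<epsilon> B \<longrightarrow> (z \<epsilon> b \<longleftrightarrow> (\<exists>y. y \<epsilon> B \<and> z \<epsilon> y \<and> y \<epsilon> x)))" if "x \<epsilon> B" for x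
      using B_ops(3)[OF that that] B_tr[OF that] by (intro exI[of _ "Uni x"]) (auto simp: mem_Uni)
    then show ?thesis
      unfolding union_set_def satI.simps(5) satI_Exists satI_Iff unfolding satI_Con
      by (simp add: numeral_2_eq_2 numeral_3_eq_3)
  qed
  moreover have "satI E (elems B) I e power_set"
  proof -
    have "\<exists>b. b \<epsilon> B \<and> (\<forall>z. z \<epsilon> B \<longrightarrow> (z \<epsilon> b \<longleftrightarrow> (\<forall>u. u \<epsilon> B \<longrightarrow> u \<epsilon> z \<longrightarrow> u \<epsilon> x)))" if "x \<epsilon> B" for x
      using B_ops(2)[OF that that] B_tr by (intro exI[of _ "Pw x"]) auto
    then show ?thesis
      unfolding power_set_def subset_fm_def satI.simps(5) satI_Exists satI_Iff
      by (simp add: numeral_2_eq_2 numeral_3_eq_3)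
  qed
  moreover have "satI E (elems B) I e infinity"
  proof -
    have empty: "satI E (elems B) I e (empty_fm i) \<longleftrightarrow> (\<forall>z\<in>elems B. \<not> z \<epsilon> e i)" for e i
      by (simp add: empty_fm_def)
    have succ: "satI E (elems B) I e (succ_fm i j) \<longleftrightarrow> (\<forall>z\<in>elems B. z \<epsilon> e j \<longleftrightarrow> z \<epsilon> e i \<or> z = e i)" for e i j
      unfolding succ_fm_def satI.simps(5) satI_Iff by (simp add: disj_imp)
    have "em \<epsilon> B" using em_om B_tr[OF B(2)] by blast
    moreover have "\<exists>y\<in>elems B. y \<epsilon> om \<and> (\<forall>z\<in>elems B. z \<epsilon> y \<longleftrightarrow> z \<epsilon> x \<or> z = x)" if x: "x \<epsilon> om" for x
      by (rule bexI[of _ "sc x"]) (use sc_om[OF x] B_tr[OF B(2)] in simp_all)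
    ultimately have "satI E (elems B) I (case_nat om e) (inductive_fm 0)"
      unfolding inductive_fm_def satI_Con satI_Exists
      by (auto simp: empty succ em_om intro!: bexI[of _ em])
    then show ?thesis
      unfolding infinity_def satI_Exists using B(2) by blast
  qed
  moreover have "satI E (elems B) I e choice"
    unfolding sat_choice
  proof (intro ballI impI, elim conjE)
    fix a assume a: "a \<in> elems B" and ne: "\<forall>x\<in>elems B. x \<epsilon> a \<longrightarrow> (\<exists>y\<in>elems B. y \<epsilon> x)"
      and disj: "\<forall>x\<in>elems B. x \<epsilon> a \<longrightarrow> (\<forall>y\<in>elems B. y \<epsilon> a \<longrightarrow> (\<exists>z\<in>elems B. z \<epsilon> x \<and> z \<epsilon> y) \<longrightarrow> x = y)"
    have in_B: "x \<epsilon> B" if "x \<epsilon> a" for x using a that B_tr by blast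
    have "sat E (\<lambda>_. undefined) choice" by (rule axiom_true) (simp add: ZFC_def)
    then have "(\<forall>x. x \<epsilon> a \<longrightarrow> (\<exists>y. y \<epsilon> x)) \<and> (\<forall>x. x \<epsilon> a \<longrightarrow> (\<forall>y. y \<epsilon> a \<longrightarrow> (\<exists>z. z \<epsilon> x \<and> z \<epsilon> y) \<longrightarrow> x = y)) \<longrightarrow>
        (\<exists>c. \<forall>x. x \<epsilon> a \<longrightarrow> (\<exists>y. \<forall>z. z \<epsilon> x \<and> z \<epsilon> c \<longleftrightarrow> z = y))"
      unfolding sat_eq_satI sat_choice by simp
    moreover have "\<forall>x. x \<epsilon> a \<longrightarrow> (\<exists>y. y \<epsilon> x)" using ne in_B by blast
    moreover have "\<forall>x. x \<epsilon> a \<longrightarrow> (\<forall>y. y \<epsilon> a \<longrightarrow> (\<exists>z. z \<epsilon> x \<and> z \<epsilon> y) \<longrightarrow> x = y)"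
      using disj in_B B_tr by blast
    ultimately obtain c where c: "\<And>x. x \<epsilon> a \<Longrightarrow> \<exists>y. \<forall>z. z \<epsilon> x \<and> z \<epsilon> c \<longleftrightarrow> z = y" by blast
    \<comment> \<open>The transversal found in the model need not lie in \<open>B\<close>. Its part
      inside \<open>Uni a\<close> is a subset of an element of \<open>B\<close> and meets the
      members of \<open>a\<close> in the same points.\<close>
    obtain c' where c': "\<And>z. z \<epsilon> c' \<longleftrightarrow> z \<epsilon> Uni a \<and> z \<epsilon> c"
      using separation_set[OF df_mem[OF dt_var[of 0] dt_const[of c]], of "Uni a"] unfolding is_set_def by blast
    have "c' \<epsilon> B"
      by (rule B_sub[of "Uni a"]) (use B_ops(3) a c' in \<open>auto simp: sub_def\<close>)
    moreover have "\<exists>y\<in>elems B. \<forall>z\<in>elems B. z \<epsilon> x \<and> z \<epsilon> c' \<longleftrightarrow> z = y" if x: "x \<epsilon> a" for x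
    proof -
      obtain y where y: "\<And>z. z \<epsilon> x \<and> z \<epsilon> c \<longleftrightarrow> z = y" using c[OF x] by blast
      then have "y \<epsilon> B" using B_tr in_B x by blast
      moreover have "z \<epsilon> x \<and> z \<epsilon> c' \<longleftrightarrow> z = y" for z
        using y[of z] x unfolding c' mem_Uni by blast
      ultimately show ?thesis by blast
    qed
    ultimately show "\<exists>c\<in>elems B. \<forall>x\<in>elems B. x \<epsilon> a \<longrightarrow> (\<exists>y\<in>elems B. \<forall>z\<in>elems B. z \<epsilon> x \<and> z \<epsilon> c \<longleftrightarrow> z = y)"
      by blast
  qed
  ultimately show ?thesis using \<phi> unfolding single_axioms_def by blast
qed

section \<open>Definable classes of standard rank\<close>

definition cEps :: "'a \<Rightarrow> bool" where "cEps z \<longleftrightarrow> (\<exists>x y w. z = pr x (pr y w) \<and> x \<epsilon> y)"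
definition cId :: "'a \<Rightarrow> bool" where "cId z \<longleftrightarrow> (\<exists>x w. z = pr x (pr x w))"
definition cBot :: "'a \<Rightarrow> bool" where "cBot z \<longleftrightarrow> False"
definition cWeak :: "('a \<Rightarrow> bool) \<Rightarrow> 'a \<Rightarrow> bool" where "cWeak P z \<longleftrightarrow> (\<exists>x w. z = pr x w \<and> P w)"
definition cSwap :: "('a \<Rightarrow> bool) \<Rightarrow> 'a \<Rightarrow> bool" where
  "cSwap P z \<longleftrightarrow> (\<exists>x y w. z = pr x (pr y w) \<and> P (pr y (pr x w)))"
definition cAll :: "('a \<Rightarrow> bool) \<Rightarrow> 'a \<Rightarrow> bool" where "cAll P w \<longleftrightarrow> (\<forall>a. P (pr a w))"
definition cImp :: "('a \<Rightarrow> bool) \<Rightarrow> ('a \<Rightarrow> bool) \<Rightarrow> 'a \<Rightarrow> bool" where "cImp P Q z \<longleftrightarrow> (P z \<longrightarrow> Q z)"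

text \<open>Counterparts, on the whole model, of the relations that \<open>C\<close> lists; the
  quantifier in \<open>cAll\<close> is accordingly unbounded. For each standard \<open>n\<close>
  there are finitely many, as reflection requires.\<close>

primrec cls :: "nat \<Rightarrow> ('a \<Rightarrow> bool) set" where
  "cls 0 = {}"
| "cls (Suc n) = cls n \<union> {cEps, cId, cBot} \<union> cWeak ` cls n \<union> cSwap ` cls n \<union> cAll ` cls n \<union>
    (\<lambda>(P, Q). cImp P Q) ` (cls n \<times> cls n)"

lemma finite_cls: "finite (cls n)"
  by (induction n) auto

lemma cls_mono: "m \<le> n \<Longrightarrow> cls m \<subseteq> cls n"
  by (induction n) (auto simp: le_Suc_eq)

lemma df_cls: "P \<in> cls n \<Longrightarrow> df (\<lambda>e. P (e 0))"
proof (induction n arbitrary: P)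
  case (Suc n)
  have "df (\<lambda>e. cEps (e 0))" "df (\<lambda>e. cId (e 0))" "df (\<lambda>e. cBot (e 0))"
    unfolding cEps_def cId_def cBot_def by (intro df_rules)+
  moreover have "df (\<lambda>e. cWeak Q (e 0))" "df (\<lambda>e. cSwap Q (e 0))" "df (\<lambda>e. cAll Q (e 0))"
    if "Q \<in> cls n" for Q
    unfolding cWeak_def cSwap_def cAll_def by (intro df_rules df_fun1[OF Suc.IH[OF that]])+
  moreover have "df (\<lambda>e. cImp Q R (e 0))" if "Q \<in> cls n" "R \<in> cls n" for Q R
    unfolding cImp_def using that by (intro df_imp Suc.IH)
  ultimately show ?case using Suc by auto
qed simp

lemma num_eq_iff: "num m = num n \<longleftrightarrow> m = n"
  by (metis linorder_neqE_nat not_mem_self num_mem_num)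

text \<open>Finitely many classes are concerned, so reflection gives a \<open>B\<close> for which
  quantifying over \<open>B\<close> agrees with quantifying over the model in each of them. Their
  traces on \<open>B\<close> serve as the listed relations.\<close>

lemma standard_fragment: "\<exists>B F U. p \<epsilon> B \<and> C (num n) B F U"
proof -
  \<comment> \<open>A counterexample to a universal statement: once these are reflected,
    \<open>cAll\<close> agrees with quantification over \<open>B\<close>.\<close>
  define R1 where "R1 P w t \<longleftrightarrow> \<not> P (pr t w)" for P w t
  \<comment> \<open>A set \<open>t\<close> that contains a value for each element of
    \<open>a\<close> having one. With such a \<open>t\<close> in \<open>B\<close>, Replacement in
    \<open>B\<close> reduces to Separation from \<open>t\<close>.\<close>
  define R2 where "R2 P v t \<longleftrightarrow> (\<forall>w a. v = pr w a \<longrightarrow> (\<forall>x. x \<epsilon> a \<longrightarrow>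
    (\<exists>y. P (pr x (pr y w))) \<longrightarrow> (\<exists>y. y \<epsilon> t \<and> P (pr x (pr y w)))))" for P v t
  have df_R: "df (\<lambda>e. R (e 0) (e 1))" if R: "R \<in> R1 ` cls n \<union> R2 ` cls n" for R
  proof -
    obtain P where P: "P \<in> cls n" "R = R1 P \<or> R = R2 P" using R by blast
    have "df (\<lambda>e. R1 P (e 0) (e 1))" "df (\<lambda>e. R2 P (e 0) (e 1))"
      unfolding R1_def R2_def by (intro df_rules df_fun1[OF df_cls[OF P(1)]])+
    then show ?thesis using P(2) by auto
  qed
  have "\<exists>B. upair p om \<epsilon> B \<and> limit_level B \<and>
      (\<forall>R\<in>R1 ` cls n \<union> R2 ` cls n. \<forall>x. x \<epsilon> B \<longrightarrow> (\<exists>y. R x y) \<longrightarrow> (\<exists>y. y \<epsilon> B \<and> R x y))"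
    by (rule reflection) (simp add: finite_cls, rule df_R)
  then obtain B where B: "upair p om \<epsilon> B" "limit_level B"
    and refl_B: "\<forall>R\<in>R1 ` cls n \<union> R2 ` cls n. \<forall>x. x \<epsilon> B \<longrightarrow> (\<exists>y. R x y) \<longrightarrow> (\<exists>y. y \<epsilon> B \<and> R x y)"
    by (elim exE conjE)
  have refl: "\<exists>y. y \<epsilon> B \<and> R x y" if "R \<in> R1 ` cls n \<union> R2 ` cls n" "x \<epsilon> B" "R x y" for R x y
  proof -
    have "x \<epsilon> B \<longrightarrow> (\<exists>y. R x y) \<longrightarrow> (\<exists>y. y \<epsilon> B \<and> R x y)" using bspec[OF refl_B that(1)] by (rule spec)
    then show ?thesis using that(2,3) by blast
  qed
  have B_tr: "y \<epsilon> B" if "x \<epsilon> B" "y \<epsilon> x" for x y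
    using B(2) that unfolding limit_level_def tr_def by blast
  have B_sub: "y \<epsilon> B" if "x \<epsilon> B" "sub y x" for x y
    using B(2) that unfolding limit_level_def by blast
  have "upair x y \<epsilon> B" if "x \<epsilon> B" "y \<epsilon> B" for x y
    using B(2) that unfolding limit_level_def by blast
  then have B_pr: "pr x y \<epsilon> B" if "x \<epsilon> B" "y \<epsilon> B" for x y
    using that unfolding pr_def by simp
  have all_B: "(\<forall>a. P (pr a w)) \<longleftrightarrow> (\<forall>a\<in>elems B. P (pr a w))" if "P \<in> cls n" "w \<epsilon> B" for P w
    using refl[of "R1 P" w] that unfolding R1_def by auto
  have coll_B: "\<exists>t. t \<epsilon> B \<and> (\<forall>x. x \<epsilon> a \<longrightarrow> (\<exists>y. P (pr x (pr y w))) \<longrightarrow> (\<exists>y. y \<epsilon> t \<and> P (pr x (pr y w))))"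
    if P: "P \<in> cls n" and "w \<epsilon> B" "a \<epsilon> B" for P w a
  proof -
    have "df (\<lambda>e. P (pr (e 0) (pr (e 1) w)))" by (intro df_fun1[OF df_cls[OF P]] df_rules)
    from collection[OF this, of a] obtain t where "R2 P (pr w a) t" unfolding R2_def by auto
    with refl[of "R2 P" "pr w a" t] B_pr[OF that(2,3)] P obtain t where "t \<epsilon> B" "R2 P (pr w a) t" by auto
    then show ?thesis unfolding R2_def by auto
  qed
  define cl where "cl P = the_set (\<lambda>z. z \<epsilon> B \<and> P z)" for P
  have cl: "z \<epsilon> cl P \<longleftrightarrow> z \<epsilon> B \<and> P z" if "P \<in> cls m" for z P m
    unfolding cl_def by (rule mem_the_set) (rule separation_set[OF df_cls[OF that]])
  obtain U where U: "\<And>X. X \<epsilon> U \<longleftrightarrow> X \<in> cl ` cls n"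
    using is_set_finite[of "cl ` cls n"] finite_cls unfolding is_set_def by auto
  \<comment> \<open>Rank \<open>m\<close> lists \<open>cls (Suc m)\<close>, since rank
    \<open>0\<close> must already contain the basic relations whereas \<open>cls 0\<close> is
    empty.\<close>
  have "finite (\<Union>m<n. (\<lambda>P. pr (num m) (cl P)) ` cls (Suc m))" using finite_cls by blast
  from is_set_finite[OF this] obtain F where F: "\<And>q. q \<epsilon> F \<longleftrightarrow> q \<in> (\<Union>m<n. (\<lambda>P. pr (num m) (cl P)) ` cls (Suc m))"
    unfolding is_set_def by blast
  have memp_F: "memp F (num m) X \<longleftrightarrow> X \<in> cl ` cls (Suc m)" if "m < n" for m X
    unfolding memp_iff F using that by (auto simp: num_eq_iff simp del: cls.simps)
  have ex: "\<exists>Y\<in>elems U. memp F (num m) Y \<and> S Y" if "P \<in> cls (Suc m)" "m < n" "S (cl P)" for S m P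
    using that cls_mono[of "Suc m" n] U memp_F by (intro bexI[of _ "cl P"]) (auto simp del: cls.simps)
  have "C (num n) B F U"
    unfolding C_def
  proof (intro conjI)
    show "\<forall>x\<in>elems B. \<forall>y\<in>elems x. y \<epsilon> B" using B_tr by blast
    show "\<forall>x\<in>elems B. \<forall>y\<in>elems B. \<exists>z\<in>elems B. is_pr z x y" using B_pr by (simp add: is_pr_iff)
    have "om \<epsilon> B" by (rule B_tr[OF B(1)]) simp
    then show "\<forall>\<phi>\<in>single_axioms. satI E (elems B) (\<lambda>c. c) (\<lambda>_. B) \<phi>"
      using single_axioms_limit_level[OF B(2)] by blast
    show "\<forall>i\<in>elems (num n).
      (\<exists>Y\<in>elems U. memp F i Y \<and> is_Eps B Y) \<and>
      (\<exists>Y\<in>elems U. memp F i Y \<and> is_Id B Y) \<and>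
      (\<exists>Y\<in>elems U. memp F i Y \<and> is_Bot B Y) \<and>
      (\<forall>j\<in>elems (num n). j \<epsilon> i \<longrightarrow> (\<forall>X\<in>elems U. memp F j X \<longrightarrow>
        (\<exists>Y\<in>elems U. memp F i Y \<and> is_Weak B X Y) \<and>
        (\<exists>Y\<in>elems U. memp F i Y \<and> is_Swap B X Y) \<and>
        (\<exists>Y\<in>elems U. memp F i Y \<and> is_All B X Y) \<and>
        (\<forall>Z\<in>elems U. memp F j Z \<longrightarrow> (\<exists>Y\<in>elems U. memp F i Y \<and> is_Imp B X Z Y)))) \<and>
      (\<forall>X\<in>elems U. memp F i X \<longrightarrow> separates B X \<and> replaces B X)"
    proof
      fix i assume "i \<in> elems (num n)"
      then obtain m where m: "i = num m" "m < n" by (auto simp: mem_num)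
      have basic: "cEps \<in> cls (Suc m)" "cId \<in> cls (Suc m)" "cBot \<in> cls (Suc m)" by auto
      have "is_Eps B (cl cEps)" "is_Id B (cl cId)" "is_Bot B (cl cBot)"
        unfolding is_Eps_def is_Id_def is_Bot_def is_pr_iff memp_iff
        using cl[OF basic(1)] cl[OF basic(2)] cl[OF basic(3)] B_pr by (auto simp: cEps_def cId_def cBot_def)
      then have 1: "\<exists>Y\<in>elems U. memp F i Y \<and> is_Eps B Y" "\<exists>Y\<in>elems U. memp F i Y \<and> is_Id B Y"
        "\<exists>Y\<in>elems U. memp F i Y \<and> is_Bot B Y"
        unfolding m(1) using basic m(2) by (blast intro: ex)+
      have 2: "(\<exists>Y\<in>elems U. memp F i Y \<and> is_Weak B X Y) \<and>
        (\<exists>Y\<in>elems U. memp F i Y \<and> is_Swap B X Y) \<and>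
        (\<exists>Y\<in>elems U. memp F i Y \<and> is_All B X Y) \<and>
        (\<forall>Z\<in>elems U. memp F j Z \<longrightarrow> (\<exists>Y\<in>elems U. memp F i Y \<and> is_Imp B X Z Y))"
        if j: "j \<epsilon> i" and X: "memp F j X" for j X
      proof -
        obtain m' where m': "j = num m'" "m' < m" using j unfolding m(1) mem_num by blast
        \<comment> \<open>Relations of an earlier rank \<open>m'\<close> come from
          \<open>cls (Suc m')\<close>, which is included in \<open>cls m\<close>; one operation then
          leads to \<open>cls (Suc m)\<close>, the list of rank \<open>m\<close>.\<close>
        have lower: "P \<in> cls m" if "P \<in> cls (Suc m')" for P
          using cls_mono[of "Suc m'" m] m'(2) that by auto
        obtain P where P: "P \<in> cls m" "X = cl P"
          using X memp_F[of m' X] m' m(2) lower by (auto simp del: cls.simps)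
        then have in_cls: "cWeak P \<in> cls (Suc m)" "cSwap P \<in> cls (Suc m)" "cAll P \<in> cls (Suc m)" by auto
        have "P \<in> cls n" using P(1) cls_mono[of m n] m(2) by auto
        note cls_simps = cl[OF P(1)] cl[OF in_cls(1)] cl[OF in_cls(2)] cl[OF in_cls(3)]
        have "is_Weak B X (cl (cWeak P))" "is_Swap B X (cl (cSwap P))"
          unfolding is_Weak_def is_Swap_def is_pr_iff memp_iff P(2)
          using B_pr by (auto simp: cls_simps cWeak_def cSwap_def)
        moreover have "is_All B X (cl (cAll P))"
          unfolding is_All_def memp_iff P(2)
          using B_pr all_B[OF \<open>P \<in> cls n\<close>] by (auto simp: cls_simps cAll_def)
        moreover have "\<exists>Y\<in>elems U. memp F i Y \<and> is_Imp B X Z Y" if Z: "memp F j Z" for Z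
        proof -
          obtain Q where Q: "Q \<in> cls m" "Z = cl Q"
            using Z memp_F[of m' Z] m' m(2) lower by (auto simp del: cls.simps)
          then have "cImp P Q \<in> cls (Suc m)" using P(1) by force
          moreover from this have "is_Imp B X Z (cl (cImp P Q))"
            unfolding is_Imp_def P(2) Q(2) using cl[OF P(1)] cl[OF Q(1)] cl[of "cImp P Q"]
            by (auto simp: cImp_def simp del: cls.simps)
          ultimately show ?thesis unfolding m(1) using m(2) by (blast intro: ex)
        qed
        ultimately show ?thesis unfolding m(1) using in_cls m(2) by (blast intro: ex)
      qed
      have 3: "separates B X \<and> replaces B X" if X: "memp F i X" for X
      proof -
        obtain P where P: "P \<in> cls n" "X = cl P"
          using X memp_F[of m X] m cls_mono[of "Suc m" n] by (auto simp del: cls.simps)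
        have "separates B X"
          unfolding separates_def memp_iff P(2)
        proof (intro ballI)
          fix w a assume wa: "w \<in> elems B" "a \<in> elems B"
          have "df (\<lambda>e. P (pr (e 0) w))" by (intro df_fun1[OF df_cls[OF P(1)]] df_rules)
          from separation_set[OF this] obtain b where b: "\<And>z. z \<epsilon> b \<longleftrightarrow> z \<epsilon> a \<and> P (pr z w)"
            unfolding is_set_def by blast
          moreover have "b \<epsilon> B" by (rule B_sub[of a]) (use wa b in \<open>auto simp: sub_def\<close>)
          ultimately show "\<exists>b\<in>elems B. \<forall>z\<in>elems B. z \<epsilon> b \<longleftrightarrow> z \<epsilon> a \<and> pr z w \<epsilon> cl P"
            using wa B_pr cl[OF P(1)] by auto
        qed
        moreover have "replaces B X"
          unfolding replaces_def memp_iff is_pr_iff P(2)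
        proof (intro ballI impI)
          fix w a assume wa: "w \<in> elems B" "a \<in> elems B"
            and *: "\<forall>x\<in>elems B. \<forall>y\<in>elems B. \<forall>z\<in>elems B. \<forall>v\<in>elems B. \<forall>v'\<in>elems B.
              v = pr y w \<longrightarrow> v' = pr z w \<longrightarrow> pr x v \<epsilon> cl P \<longrightarrow> pr x v' \<epsilon> cl P \<longrightarrow> y = z"
          have mem_cl: "pr x (pr y w) \<epsilon> cl P \<longleftrightarrow> P (pr x (pr y w))" if "x \<epsilon> B" "y \<epsilon> B" for x y
            using that wa B_pr cl[OF P(1)] by auto
          have fn: "y = z" if "x \<epsilon> B" "y \<epsilon> B" "z \<epsilon> B" "P (pr x (pr y w))" "P (pr x (pr z w))" for x y z
            using * that mem_cl B_pr wa by auto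
          obtain t where t: "t \<epsilon> B"
            "\<And>x. x \<epsilon> a \<Longrightarrow> \<exists>y. P (pr x (pr y w)) \<Longrightarrow> \<exists>y. y \<epsilon> t \<and> P (pr x (pr y w))"
            using coll_B[OF P(1), of w a] wa by auto
          have "df (\<lambda>e. \<exists>x. x \<epsilon> a \<and> P (pr x (pr (e 0) w)))" by (intro df_rules df_fun1[OF df_cls[OF P(1)]])
          from separation_set[OF this] obtain b where
            b: "\<And>y. y \<epsilon> b \<longleftrightarrow> y \<epsilon> t \<and> (\<exists>x. x \<epsilon> a \<and> P (pr x (pr y w)))"
            unfolding is_set_def by blast
          have "b \<epsilon> B" by (rule B_sub[OF t(1)]) (use b in \<open>auto simp: sub_def\<close>)
          moreover have "y \<epsilon> b \<longleftrightarrow> (\<exists>x\<in>elems B. x \<epsilon> a \<and> (\<exists>v\<in>elems B. v = pr y w \<and> pr x v \<epsilon> cl P))"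
            if y: "y \<epsilon> B" for y
          proof -
            \<comment> \<open>The element that \<open>t\<close> provides for \<open>x\<close> is
              some value of the relation at \<open>x\<close>; functionality identifies it with
              \<open>y\<close>.\<close>
            have "y \<epsilon> t" if "x \<epsilon> a" "P (pr x (pr y w))" for x
              using t(2)[of x] that fn[of x y] y B_tr[OF t(1)] B_tr[of a x] wa by blast
            then have "y \<epsilon> b \<longleftrightarrow> (\<exists>x. x \<epsilon> a \<and> P (pr x (pr y w)))" using b by blast
            also have "\<dots> \<longleftrightarrow> (\<exists>x\<in>elems B. x \<epsilon> a \<and> pr x (pr y w) \<epsilon> cl P)"
              using mem_cl y B_tr wa by blast
            finally show ?thesis using B_pr y wa by auto
          qed
          ultimately show "\<exists>b\<in>elems B. \<forall>y\<in>elems B. y \<epsilon> b \<longleftrightarrow>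
            (\<exists>x\<in>elems B. x \<epsilon> a \<and> (\<exists>v\<in>elems B. v = pr y w \<and> pr x v \<epsilon> cl P))" by blast
        qed
        ultimately show ?thesis by blast
      qed
      show "(\<exists>Y\<in>elems U. memp F i Y \<and> is_Eps B Y) \<and>
      (\<exists>Y\<in>elems U. memp F i Y \<and> is_Id B Y) \<and>
      (\<exists>Y\<in>elems U. memp F i Y \<and> is_Bot B Y) \<and>
      (\<forall>j\<in>elems (num n). j \<epsilon> i \<longrightarrow> (\<forall>X\<in>elems U. memp F j X \<longrightarrow>
        (\<exists>Y\<in>elems U. memp F i Y \<and> is_Weak B X Y) \<and>
        (\<exists>Y\<in>elems U. memp F i Y \<and> is_Swap B X Y) \<and>
        (\<exists>Y\<in>elems U. memp F i Y \<and> is_All B X Y) \<and>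
        (\<forall>Z\<in>elems U. memp F j Z \<longrightarrow> (\<exists>Y\<in>elems U. memp F i Y \<and> is_Imp B X Z Y)))) \<and>
      (\<forall>X\<in>elems U. memp F i X \<longrightarrow> separates B X \<and> replaces B X)"
        using 1 2 3 by auto
    qed
  qed
  moreover have "p \<epsilon> B" by (rule B_tr[OF B(1)]) simp
  ultimately show ?thesis by blast
qed

section \<open>Consistency with the \<open>\<Sigma>\<^sub>2\<close> diagram\<close>

text \<open>A derivation of \<open>Bot\<close> uses finitely many hypotheses. The set
  \<open>p\<close> gathers the witnesses and parameters of those in the diagram, so a transitive
  \<open>B\<close> above \<open>p\<close> that satisfies the axioms used and \<open>\<sigma>\<close>
  contradicts soundness.\<close>

lemma consistent_extension:
  assumes \<sigma>: "params \<sigma> = {}"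
    and ex: "\<And>Z p. finite Z \<Longrightarrow> Z \<subseteq> ZFC \<Longrightarrow> \<exists>B. p \<epsilon> B \<and> n \<epsilon> B \<and> transitive_in E (elems B) \<and>
      (\<forall>\<psi>\<in>Z. \<forall>(I :: 'a \<Rightarrow> 'a) e. range e \<subseteq> elems B \<longrightarrow> satI E (elems B) I e \<psi>) \<and>
      satI E (elems B) (\<lambda>c. c) (\<lambda>_. n) \<sigma>"
    and fv: "fv \<sigma> \<subseteq> {0}"
  shows "consistent (ZFC \<union> sigma_diagram 2 E \<union> {inst \<sigma> (Cst n)})"
  unfolding consistent_def
proof
  assume "ZFC \<union> sigma_diagram 2 E \<union> {inst \<sigma> (Cst n)} \<turnstile> Bot"
  from derives_sound[OF this] obtain T where T: "T \<subseteq> ZFC \<union> sigma_diagram 2 E \<union> {inst \<sigma> (Cst n)}" "finite T"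
    and ent: "entails E T Bot" by blast
  define S where "S = T \<inter> sigma_diagram 2 E"
  have "\<exists>K. finite K \<and> (\<forall>D. transitive_in E D \<longrightarrow> K \<subseteq> D \<longrightarrow> n \<in> D \<longrightarrow> params \<phi> \<subseteq> D \<longrightarrow>
      satI E D (\<lambda>c. c) (\<lambda>_. n) \<phi>)" if "\<phi> \<in> S" for \<phi>
    using sigma_2_upward[of \<phi> E "\<lambda>_. n"] that unfolding S_def sigma_diagram_def true_in_def by auto
  then obtain K where K: "\<And>\<phi>. \<phi> \<in> S \<Longrightarrow> finite (K \<phi>)"
    "\<And>\<phi> D. \<phi> \<in> S \<Longrightarrow> transitive_in E D \<Longrightarrow> K \<phi> \<subseteq> D \<Longrightarrow> n \<in> D \<Longrightarrow> params \<phi> \<subseteq> D \<Longrightarrow>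
      satI E D (\<lambda>c. c) (\<lambda>_. n) \<phi>"
    by metis
  have "finite S" using T(2) unfolding S_def by simp
  then have "finite (\<Union>\<phi>\<in>S. K \<phi> \<union> params \<phi>)" using K(1) finite_params by blast
  from is_set_finite[OF this] obtain p where p: "\<And>z. z \<epsilon> p \<longleftrightarrow> z \<in> (\<Union>\<phi>\<in>S. K \<phi> \<union> params \<phi>)"
    unfolding is_set_def by blast
  have "finite (T \<inter> ZFC)" "T \<inter> ZFC \<subseteq> ZFC" using T(2) by auto
  from ex[OF this] obtain B where B: "p \<epsilon> B" "n \<epsilon> B" and tr: "transitive_in E (elems B)"
    and Z: "\<forall>\<psi>\<in>T \<inter> ZFC. \<forall>(I :: 'a \<Rightarrow> 'a) e. range e \<subseteq> elems B \<longrightarrow> satI E (elems B) I e \<psi>"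
    and \<sigma>_B: "satI E (elems B) (\<lambda>c. c) (\<lambda>_. n) \<sigma>"
    by blast
  \<comment> \<open>\<open>I\<close> must map into \<open>B\<close>, so constants outside
    \<open>B\<close> get the default \<open>n\<close>. The parameters of the diagram part and
    \<open>n\<close> itself lie in \<open>B\<close> and keep their meaning.\<close>
  define I where "I c = (if c \<epsilon> B then c else n)" for c
  have "satI E (elems B) I (\<lambda>_. n) Bot"
  proof (rule entailsD[OF ent])
    fix \<phi> assume "\<phi> \<in> T"
    then consider "\<phi> \<in> T \<inter> ZFC" | "\<phi> \<in> S" | "\<phi> = inst \<sigma> (Cst n)" using T(1) unfolding S_def by blast
    then show "satI E (elems B) I (\<lambda>_. n) \<phi>"
    proof cases
      case 1
      then show ?thesis using bspec[OF Z 1] B(2) by auto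
    next
      case 2
      have sub: "K \<phi> \<union> params \<phi> \<subseteq> elems B"
        using 2 p tr B(1) unfolding transitive_in_def by blast
      then have "satI E (elems B) (\<lambda>c. c) (\<lambda>_. n) \<phi>" using K(2)[OF 2 tr] B(2) by blast
      moreover have "satI E (elems B) I (\<lambda>_. n) \<phi> \<longleftrightarrow> satI E (elems B) (\<lambda>c. c) (\<lambda>_. n) \<phi>"
        by (rule satI_cong) (use sub in \<open>auto simp: I_def\<close>)
      ultimately show ?thesis by blast
    next
      case 3
      have "satI E (elems B) I (case_nat n (\<lambda>_. n)) \<sigma> \<longleftrightarrow> satI E (elems B) (\<lambda>c. c) (\<lambda>_. n) \<sigma>"
        by (rule satI_cong) (use \<sigma> in \<open>auto split: nat.split\<close>)
      then show ?thesis using \<sigma>_B B(2) unfolding 3 satI_inst by (simp add: I_def)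
    qed
  qed (use B(2) in \<open>auto simp: I_def\<close>)
  then show False by simp
qed

definition bounded :: "'a \<Rightarrow> bool" where
  "bounded k \<longleftrightarrow> (\<exists>p. \<forall>B F U. \<not> (p \<epsilon> B \<and> C k B F U))"

lemma not_bounded_num: "\<not> bounded (num i)"
  using standard_fragment unfolding bounded_def by blast

text \<open>
  An \<open>\<epsilon>\<close>-minimal \<open>B\<close> above \<open>q\<close> believes that no such set exists above \<open>q\<close>, because \<open>C\<close> is absolute.
\<close>

lemma minimal_witness:
  assumes k: "\<not> bounded k" "\<forall>i\<le>d. num i \<epsilon> k" and Z: "\<forall>\<psi>\<in>Z. true_from d \<psi>"
  shows "\<exists>B. p \<epsilon> B \<and> k \<epsilon> B \<and> transitive_in E (elems B) \<and>
    (\<forall>\<psi>\<in>Z. \<forall>(I :: 'a \<Rightarrow> 'a) e. range e \<subseteq> elems B \<longrightarrow> satI E (elems B) I e \<psi>) \<and>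
    (\<exists>q\<in>elems B. \<forall>B'\<in>elems B. \<forall>F'\<in>elems B. \<forall>U'\<in>elems B. \<not> (q \<epsilon> B' \<and> C k B' F' U'))"
proof -
  \<comment> \<open>The single membership \<open>q \<epsilon> B\<close> will put both
    \<open>p\<close> and \<open>k\<close> into the transitive set \<open>B\<close>.\<close>
  define q where "q = upair p k"
  have "df (\<lambda>e. C (e 0) (e 3) (e 2) (e 1))" by (rule d0_df[OF d0_C[of _ 4]]) simp_all
  then have "df (\<lambda>e. C k (e 2) (e 1) (e 0))"
    using df_subst[of "\<lambda>x e. C x (e 2) (e 1) (e 0)", OF _ dt_const] by (simp add: eval_nat_numeral)
  then have df_Q: "df (\<lambda>e. q \<epsilon> e 0 \<and> (\<exists>F U. C k (e 0) F U))"
    by (intro df_intros) (simp add: eval_nat_numeral)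
  obtain B0 where "q \<epsilon> B0 \<and> (\<exists>F U. C k B0 F U)" using k(1) unfolding bounded_def by blast
  from mem_minimal[OF df_Q this] obtain B F U where B: "q \<epsilon> B" and C: "C k B F U"
    and minimal: "\<And>B'. B' \<epsilon> B \<Longrightarrow> \<not> (q \<epsilon> B' \<and> (\<exists>F U. C k B' F U))" by blast
  have "p \<epsilon> B" "k \<epsilon> B" by (rule C_tr[OF C B]; simp add: q_def)+
  moreover have "transitive_in E (elems B)" using C_tr[OF C] unfolding transitive_in_def by blast
  moreover have "\<forall>\<psi>\<in>Z. \<forall>(I :: 'a \<Rightarrow> 'a) e. range e \<subseteq> elems B \<longrightarrow> satI E (elems B) I e \<psi>"
  proof (intro ballI allI impI)
    fix \<psi> and I :: "'a \<Rightarrow> 'a" and e :: "nat \<Rightarrow> 'a"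
    assume \<psi>: "\<psi> \<in> Z" and e: "range e \<subseteq> elems B"
    show "satI E (elems B) I e \<psi>"
      by (rule bspec[OF Z \<psi>, unfolded true_from_def, rule_format, OF C _ e]) (use k(2) in blast)
  qed
  moreover have "\<exists>q\<in>elems B. \<forall>B'\<in>elems B. \<forall>F'\<in>elems B. \<forall>U'\<in>elems B. \<not> (q \<epsilon> B' \<and> C k B' F' U')"
    using B minimal by blast
  ultimately show ?thesis by blast
qed

section \<open>Standard numbers inside a nonstandard one, and the form of the final
  assertions\<close>

lemma em_or_mem: "n \<epsilon> om \<Longrightarrow> n = em \<or> em \<epsilon> n"
  by (erule om_induct) (intro df_rules, auto)

lemma sc_mem_or_eq:
  assumes "n \<epsilon> om" "j \<epsilon> n"
  shows "sc j \<epsilon> n \<or> sc j = n"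
proof -
  have "\<forall>j. j \<epsilon> n \<longrightarrow> sc j \<epsilon> n \<or> sc j = n"
    by (rule om_induct[OF assms(1)]) (intro df_rules, auto)
  then show ?thesis using assms(2) by blast
qed

text \<open>Induction on \<open>i\<close> in the metatheory: the successor of an element of
  \<open>n\<close> belongs to \<open>n\<close> or equals it, and equality would make
  \<open>n\<close> standard.\<close>

lemma num_mem_nonstandard:
  assumes "n \<epsilon> om" "\<And>i. n \<noteq> num i"
  shows "num i \<epsilon> n"
proof (induction i)
  case 0
  then show ?case using em_or_mem[OF assms(1)] assms(2)[of 0] by (simp add: num_0)
next
  case (Suc i)
  then show ?case using sc_mem_or_eq[OF assms(1) Suc] assms(2)[of "Suc i"] by (simp add: num_Suc)
qed

text \<open>\<open>em\<close> and \<open>sc\<close> are replaced by descriptions with bounded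
  quantifiers. Membership in \<open>om\<close> then costs one universal quantifier over inductive
  sets, which fits into the Pi_1 part of a Sigma_2 formula.\<close>

lemma d0_ind: "i < n \<Longrightarrow> d0 n (\<lambda>e. ind (e i))"
proof -
  assume i: "i < n"
  have "ind I \<longleftrightarrow> (\<exists>x\<in>elems I. \<forall>z\<in>elems x. False) \<and>
    (\<forall>x\<in>elems I. \<exists>y\<in>elems I. (\<forall>z\<in>elems y. z \<epsilon> x \<or> z = x) \<and> (\<forall>z\<in>elems x. z \<epsilon> y) \<and> x \<epsilon> y)" for I
  proof -
    have "(\<forall>z\<in>elems x. False) \<longleftrightarrow> x = em" for x unfolding em_eq_iff by blast
    then have "em \<epsilon> I \<longleftrightarrow> (\<exists>x\<in>elems I. \<forall>z\<in>elems x. False)" by simp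
    moreover have "sc x \<epsilon> I \<longleftrightarrow> (\<exists>y\<in>elems I. (\<forall>z\<in>elems y. z \<epsilon> x \<or> z = x) \<and> (\<forall>z\<in>elems x. z \<epsilon> y) \<and> x \<epsilon> y)" for x
    proof -
      have "(\<forall>z\<in>elems y. z \<epsilon> x \<or> z = x) \<and> (\<forall>z\<in>elems x. z \<epsilon> y) \<and> x \<epsilon> y \<longleftrightarrow> y = sc x" for y
      proof
        assume y: "(\<forall>z\<in>elems y. z \<epsilon> x \<or> z = x) \<and> (\<forall>z\<in>elems x. z \<epsilon> y) \<and> x \<epsilon> y"
        show "y = sc x"
        proof (rule ext)
          fix z
          show "z \<epsilon> y \<longleftrightarrow> z \<epsilon> sc x" using y by (cases "z = x") auto
        qed
      qed simp
      then show ?thesis by auto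
    qed
    ultimately show ?thesis unfolding ind_def by auto
  qed
  moreover have "d0 n (\<lambda>e. (\<exists>x\<in>elems (e i). \<forall>z\<in>elems x. False) \<and>
    (\<forall>x\<in>elems (e i). \<exists>y\<in>elems (e i). (\<forall>z\<in>elems y. z \<epsilon> x \<or> z = x) \<and> (\<forall>z\<in>elems x. z \<epsilon> y) \<and> x \<epsilon> y))"
    by (intro d0_intros) (use i in simp_all)
  ultimately show ?thesis by presburger
qed

lemma levy_pi_1_intros:
  "delta0 \<phi> \<Longrightarrow> levy_pi (Suc 0) \<phi>" "levy_pi (Suc 0) \<phi> \<Longrightarrow> levy_pi (Suc 0) (Forall \<phi>)"
  by (auto intro: levy_sigma_levy_pi.intros)

lemma levy_sigma_2_intros:
  "levy_pi (Suc 0) \<phi> \<Longrightarrow> levy_sigma 2 \<phi>" "levy_sigma 2 \<phi> \<Longrightarrow> levy_sigma 2 (Exists \<phi>)"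
  unfolding numeral_2_eq_2 by (auto intro: levy_sigma_levy_pi.intros)

lemma sigma_2_nonmaximal:
  "\<exists>(\<sigma> :: 'a fm) n. levy_sigma 2 \<sigma> \<and> params \<sigma> = {} \<and> fv \<sigma> \<subseteq> {0} \<and> natural_in E n \<and>
    \<not> true_in E (inst \<sigma> (Cst n)) \<and> consistent (ZFC \<union> sigma_diagram 2 E \<union> {inst \<sigma> (Cst n)})"
proof (cases "\<exists>k. k \<epsilon> om \<and> bounded k")
  case True
  \<comment> \<open>Places \<open>4\<close> down to \<open>0\<close> stand for \<open>k\<close>, the
    witness \<open>p\<close>, and \<open>B\<close>, \<open>F\<close>, \<open>U\<close>, in the order
    of binding.\<close>
  have "d0 5 (\<lambda>e. \<not> (e 3 \<epsilon> e 2 \<and> C (e 4) (e 2) (e 1) (e 0)))"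
    by (intro d0_not d0_conj d0_mem d0_C) simp_all
  then obtain \<theta> where \<theta>: "delta0 \<theta>" "params \<theta> = {}" "fv \<theta> \<subseteq> {..<5}"
    "\<And>e. sat E e \<theta> \<longleftrightarrow> \<not> (e 3 \<epsilon> e 2 \<and> C (e 4) (e 2) (e 1) (e 0))"
    "\<And>D e. transitive_in E D \<Longrightarrow> range e \<subseteq> D \<Longrightarrow>
      satI E D (\<lambda>c. c) e \<theta> \<longleftrightarrow> \<not> (e 3 \<epsilon> e 2 \<and> C (e 4) (e 2) (e 1) (e 0))"
    by (rule d0_absolute) blast
  define \<sigma> where "\<sigma> = Exists (Forall (Forall (Forall \<theta>)))"
  have sat_\<sigma>: "sat E (case_nat k e) \<sigma> \<longleftrightarrow> bounded k" for k e
    unfolding \<sigma>_def bounded_def by (simp add: \<theta>(4) eval_nat_numeral)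
  have satI_\<sigma>: "satI E D (\<lambda>c. c) (\<lambda>_. k) \<sigma>"
    if D: "transitive_in E D" "k \<in> D" and q: "q \<in> D" "\<forall>B\<in>D. \<forall>F\<in>D. \<forall>U\<in>D. \<not> (q \<epsilon> B \<and> C k B F U)" for D k q
  proof -
    have "satI E D (\<lambda>c. c) (case_nat U (case_nat F (case_nat B (case_nat q (\<lambda>_. k))))) \<theta>"
      if "B \<in> D" "F \<in> D" "U \<in> D" for B F U
      using that D q by (subst \<theta>(5)) (simp_all add: range_case_nat eval_nat_numeral)
    then show ?thesis unfolding \<sigma>_def using q(1) by auto
  qed
  obtain k0 where "k0 \<epsilon> om \<and> bounded k0" using True by blast
  moreover have "df (\<lambda>e. e 0 \<epsilon> om \<and> bounded (e 0))"
    unfolding bounded_def by (intro df_intros d0_df[OF d0_C[of _ 5]]) simp_all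
  ultimately obtain k where k: "k \<epsilon> om" "bounded k"
    and k_min: "\<And>y. y \<epsilon> k \<Longrightarrow> \<not> (y \<epsilon> om \<and> bounded y)"
    using mem_minimal[of "\<lambda>k. k \<epsilon> om \<and> bounded k" k0] by blast
  have k_num: "k \<noteq> num i" for i using k(2) not_bounded_num by blast
  obtain m where m: "m \<epsilon> om" "k = sc m"
    using om_cases[OF k(1)] k_num[of 0] by (auto simp: num_0)
  \<comment> \<open>A standard \<open>m\<close> would make \<open>k = sc m\<close> standard as
    well.\<close>
  have "m \<noteq> num i" for i using k_num[of "Suc i"] m(2) by (auto simp: num_Suc)
  then have num_m: "num i \<epsilon> m" for i using num_mem_nonstandard[OF m(1)] by blast
  \<comment> \<open>This serves twice: \<open>\<sigma>\<close> fails at \<open>m\<close> in the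
    model, and sets \<open>B\<close> for the fragment \<open>m\<close> exist above any given
    set.\<close>
  have "\<not> bounded m" using k_min[of m] m by simp
  show ?thesis
  proof (intro exI conjI)
    show "levy_sigma 2 \<sigma>" unfolding \<sigma>_def by (intro levy_sigma_2_intros levy_pi_1_intros \<theta>(1))
    show par: "params \<sigma> = {}" unfolding \<sigma>_def using \<theta>(2) by simp
    show fv: "fv \<sigma> \<subseteq> {0}" unfolding \<sigma>_def using \<theta>(3) by (auto simp: eval_nat_numeral less_Suc_eq)
    show "natural_in E m" using m(1) om_natural_in by blast
    show "\<not> true_in E (inst \<sigma> (Cst m))"
      using sat_\<sigma> \<open>\<not> bounded m\<close> by (simp add: true_in_def sat_eq_satI satI_inst)
    show "consistent (ZFC \<union> sigma_diagram 2 E \<union> {inst \<sigma> (Cst m)})"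
    proof (rule consistent_extension[OF par _ fv])
      fix Z :: "'a fm set" and p assume "finite Z" "Z \<subseteq> ZFC"
      from fragment_finite[OF this] obtain d where d: "\<forall>\<psi>\<in>Z. true_from d \<psi>" by blast
      have "\<forall>i\<le>d. num i \<epsilon> m" using num_m by blast
      from minimal_witness[OF \<open>\<not> bounded m\<close> this d, of p] obtain B where
        "p \<epsilon> B" "m \<epsilon> B" and tr: "transitive_in E (elems B)"
        "\<forall>\<psi>\<in>Z. \<forall>(I :: 'a \<Rightarrow> 'a) e. range e \<subseteq> elems B \<longrightarrow> satI E (elems B) I e \<psi>"
        and q: "\<exists>q\<in>elems B. \<forall>B'\<in>elems B. \<forall>F'\<in>elems B. \<forall>U'\<in>elems B. \<not> (q \<epsilon> B' \<and> C m B' F' U')"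
        by (elim exE conjE)
      moreover have "satI E (elems B) (\<lambda>c. c) (\<lambda>_. m) \<sigma>"
        using q satI_\<sigma>[OF tr(1)] \<open>m \<epsilon> B\<close> by blast
      ultimately show "\<exists>B. p \<epsilon> B \<and> m \<epsilon> B \<and> transitive_in E (elems B) \<and>
        (\<forall>\<psi>\<in>Z. \<forall>(I :: 'a \<Rightarrow> 'a) e. range e \<subseteq> elems B \<longrightarrow> satI E (elems B) I e \<psi>) \<and>
        satI E (elems B) (\<lambda>c. c) (\<lambda>_. m) \<sigma>" by (intro exI conjI)
    qed
  qed
next
  case False
  \<comment> \<open>That \<open>k\<close>, at place \<open>5\<close>, is a natural number is
    expressed by membership in every inductive set \<open>I\<close>, at place \<open>0\<close>; this
    quantifier joins the universal block.\<close>
  have "d0 6 (\<lambda>e. (ind (e 0) \<longrightarrow> e 5 \<epsilon> e 0) \<and> \<not> (e 4 \<epsilon> e 3 \<and> C (e 5) (e 3) (e 2) (e 1)))"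
    by (intro d0_not d0_conj d0_imp d0_mem d0_ind d0_C) simp_all
  then obtain \<theta> where \<theta>: "delta0 \<theta>" "params \<theta> = {}" "fv \<theta> \<subseteq> {..<6}"
    "\<And>e. sat E e \<theta> \<longleftrightarrow> (ind (e 0) \<longrightarrow> e 5 \<epsilon> e 0) \<and> \<not> (e 4 \<epsilon> e 3 \<and> C (e 5) (e 3) (e 2) (e 1))"
    "\<And>D e. transitive_in E D \<Longrightarrow> range e \<subseteq> D \<Longrightarrow>
      satI E D (\<lambda>c. c) e \<theta> \<longleftrightarrow> (ind (e 0) \<longrightarrow> e 5 \<epsilon> e 0) \<and> \<not> (e 4 \<epsilon> e 3 \<and> C (e 5) (e 3) (e 2) (e 1))"
    by (rule d0_absolute) blast
  define \<sigma> where "\<sigma> = Exists (Exists (Forall (Forall (Forall (Forall \<theta>)))))"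
  have sat_\<sigma>: "\<not> sat E e \<sigma>" for e
  proof -
    have "sat E e \<sigma> \<longleftrightarrow> (\<exists>k p. \<forall>B F U I. (ind I \<longrightarrow> k \<epsilon> I) \<and> \<not> (p \<epsilon> B \<and> C k B F U))"
      unfolding \<sigma>_def by (simp add: \<theta>(4) eval_nat_numeral)
    then show ?thesis using False unfolding bounded_def mem_om by blast
  qed
  have satI_\<sigma>: "satI E D (\<lambda>c. c) (\<lambda>_. n) \<sigma>"
    if D: "transitive_in E D" "k \<in> D" "k \<epsilon> om" "n \<in> D"
      and q: "q \<in> D" "\<forall>B\<in>D. \<forall>F\<in>D. \<forall>U\<in>D. \<not> (q \<epsilon> B \<and> C k B F U)" for D k q n
  proof -
    \<comment> \<open>Every inductive set in \<open>D\<close> is inductive in the model, so a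
      natural number of the model passes the test in \<open>D\<close>.\<close>
    have "satI E D (\<lambda>c. c) (case_nat I (case_nat U (case_nat F (case_nat B (case_nat q (case_nat k (\<lambda>_. n))))))) \<theta>"
      if "B \<in> D" "F \<in> D" "U \<in> D" "I \<in> D" for B F U I
      using that D q by (subst \<theta>(5)) (simp_all add: range_case_nat eval_nat_numeral mem_om)
    then show ?thesis
      unfolding \<sigma>_def satI_Exists satI.simps(5) using q(1) D(2)
      by (intro bexI[of _ k] bexI[of _ q] ballI)
  qed
  show ?thesis
  proof (intro exI conjI)
    show "levy_sigma 2 \<sigma>" unfolding \<sigma>_def by (intro levy_sigma_2_intros levy_pi_1_intros \<theta>(1))
    show par: "params \<sigma> = {}" unfolding \<sigma>_def using \<theta>(2) by simp
    show fv: "fv \<sigma> \<subseteq> {0}" unfolding \<sigma>_def using \<theta>(3) by (auto simp: eval_nat_numeral less_Suc_eq)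
    \<comment> \<open>\<open>\<sigma>\<close> is a sentence in this case, and \<open>em\<close>
      fills the place of the parameter.\<close>
    show "natural_in E em" using em_om om_natural_in by blast
    show "\<not> true_in E (inst \<sigma> (Cst em))"
      using sat_\<sigma> by (simp add: true_in_def sat_eq_satI satI_inst)
    show "consistent (ZFC \<union> sigma_diagram 2 E \<union> {inst \<sigma> (Cst em)})"
    proof (rule consistent_extension[OF par _ fv])
      fix Z :: "'a fm set" and p assume "finite Z" "Z \<subseteq> ZFC"
      from fragment_finite[OF this] obtain d where d: "\<forall>\<psi>\<in>Z. true_from d \<psi>" by blast
      \<comment> \<open>\<open>num (Suc d)\<close> has exactly the elements \<open>num 0\<close> to
        \<open>num d\<close>, as \<open>true_from d\<close> asks. It depends on \<open>Z\<close>,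
        which is why the number is quantified inside \<open>\<sigma>\<close>.\<close>
      have "\<forall>i\<le>d. num i \<epsilon> num (Suc d)" by (simp add: num_mem_num)
      from minimal_witness[OF not_bounded_num this d, of "upair p em"] obtain B where
        B: "upair p em \<epsilon> B" "num (Suc d) \<epsilon> B" and tr: "transitive_in E (elems B)"
        "\<forall>\<psi>\<in>Z. \<forall>(I :: 'a \<Rightarrow> 'a) e. range e \<subseteq> elems B \<longrightarrow> satI E (elems B) I e \<psi>"
        and q: "\<exists>q\<in>elems B. \<forall>B'\<in>elems B. \<forall>F'\<in>elems B. \<forall>U'\<in>elems B. \<not> (q \<epsilon> B' \<and> C (num (Suc d)) B' F' U')"
        by (elim exE conjE)
      have "p \<epsilon> B" "em \<epsilon> B" using tr(1) B(1) unfolding transitive_in_def by auto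
      moreover have "satI E (elems B) (\<lambda>c. c) (\<lambda>_. em) \<sigma>"
        using q satI_\<sigma>[OF tr(1)] B(2) \<open>em \<epsilon> B\<close> num_om by blast
      ultimately show "\<exists>B. p \<epsilon> B \<and> em \<epsilon> B \<and> transitive_in E (elems B) \<and>
        (\<forall>\<psi>\<in>Z. \<forall>(I :: 'a \<Rightarrow> 'a) e. range e \<subseteq> elems B \<longrightarrow> satI E (elems B) I e \<psi>) \<and>
        satI E (elems B) (\<lambda>c. c) (\<lambda>_. em) \<sigma>" using tr by (intro exI conjI)
    qed
  qed
qed

end

theorem theorem4:
  fixes E :: "'a \<Rightarrow> 'a \<Rightarrow> bool"
  assumes "models E ZFC"
  shows "\<exists>(\<sigma> :: 'a fm) n.
    levy_sigma 2 \<sigma> \<and> params \<sigma> = {} \<and> fv \<sigma> \<subseteq> {0} \<and> natural_in E n \<and>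
    \<not> true_in E (inst \<sigma> (Cst n)) \<and>
    consistent (ZFC \<union> sigma_diagram 2 E \<union> {inst \<sigma> (Cst n)})"
proof -
  interpret zfc_model E by unfold_locales (rule assms)
  show ?thesis by (rule sigma_2_nonmaximal)
qed

end
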